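(* Let $\mathcal{A}\subseteq\mathbb{P}^n_{\mathbb{K}}$ be a nonempty hyperplane arrangement and suppose that $D_0(\mathcal{A})$ has splitting type $(a_1,a_2,\ldots,a_n)$ with $a_1<a_2\leq a_3\leq\cdots\leq a_n$. If there is a nonzero homogeneous element of $D_0(\mathcal{A})$ of degree $<a_2$, then $D_0(\mathcal{A})$ has a minimal generator in degree $a_1$.
   Context: $\mathbb{K}$ is an algebraically closed field of arbitrary characteristic, and $S=\mathbb{K}[Y_0,\ldots,Y_n]$ is the coordinate ring of $\mathbb{P}^n_{\mathbb{K}}$. A hyperplane arrangement is a finite set of hyperplanes in $\mathbb{P}^n$. $D(\mathcal{A})$ is the $S$-module of $\mathbb{K}$-linear derivations $\theta:S\to S$ with $\theta(I(H))\subseteq I(H)$ for all $H\in\mathcal{A}$, graded so that $\deg\theta=\deg\theta(\ell)$ for linear forms $\ell$. $\theta_e=\sum_iY_i\,\partial/\partial Y_i$ and $D_0(\mathcal{A})=D(\mathcal{A})/S\theta_e$. The splitting type of $D_0(\mathcal{A})$ is the unique tuple of integers $0\le a_1\leq\cdots\leq a_n$ such that, for a general line $L\subseteq\mathbb{P}^n$, the restriction of the sheaf $\widetilde{D_0(\mathcal{A})}$ to $L$ is isomorphic to $\bigoplus_{i=1}^n\mathcal{O}_L(-a_i)$. *)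

theory Defs
  imports
    "HOL-Analysis.Cartesian_Space"
    "HOL-Computational_Algebra.Polynomial"
    "HOL-Library.Poly_Mapping"
    "HOL-Library.Function_Algebras"
begin

section \<open>The coordinate ring\<close>

text \<open>Polynomials over \<open>'k\<close> in the variables \<open>Y i\<close>, \<open>i :: 'n\<close>, as finitely supported functions on
  exponent vectors. The coordinates of projective \<open>n\<close>-space are indexed by a type with \<open>n + 1\<close>
  elements.\<close>

type_synonym ('n, 'k) mpoly = "('n \<Rightarrow>\<^sub>0 nat) \<Rightarrow>\<^sub>0 'k"

definition Const :: "'k::zero \<Rightarrow> ('n, 'k) mpoly" where
  "Const c = Poly_Mapping.single 0 c"

definition Var :: "'n \<Rightarrow> ('n, 'k::zero_neq_one) mpoly" where
  "Var i = Poly_Mapping.single (Poly_Mapping.single i 1) 1"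

definition mp_eval :: "'k ^ 'n \<Rightarrow> ('n::finite, 'k::comm_ring_1) mpoly \<Rightarrow> 'k" where
  "mp_eval v p = (\<Sum>m\<in>Poly_Mapping.keys p. Poly_Mapping.lookup p m * (\<Prod>i\<in>UNIV. (v $ i) ^ Poly_Mapping.lookup m i))"

text \<open>The homogeneous part \<open>S\<^sub>d\<close>; it is zero for negative \<open>d\<close>, and \<open>0\<close> belongs to every \<open>S\<^sub>d\<close>.\<close>

definition homog :: "int \<Rightarrow> ('n::finite, 'k::comm_ring_1) mpoly set" where
  "homog d = {p. \<forall>m\<in>Poly_Mapping.keys p. int (\<Sum>i\<in>UNIV. Poly_Mapping.lookup m i) = d}"

text \<open>Truncated subtraction in the exponent is harmless: if \<open>Y i\<close> does not occur in \<open>m\<close>, the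
  coefficient vanishes.\<close>

definition partial_deriv :: "'n \<Rightarrow> ('n::finite, 'k::comm_ring_1) mpoly \<Rightarrow> ('n, 'k) mpoly" where
  "partial_deriv i p =
     (\<Sum>m\<in>Poly_Mapping.keys p. Poly_Mapping.single (m - Poly_Mapping.single i 1) (of_nat (Poly_Mapping.lookup m i) * Poly_Mapping.lookup p m))"

section \<open>Linear subvarieties of projective space\<close>

text \<open>A linear subvariety of projective \<open>n\<close>-space is given by its affine cone, a linear subspace of
  \<open>'k ^ 'n\<close>; the homogeneous ideal of the subvariety is the vanishing ideal of the cone.\<close>

definition hyperplane :: "('k::field ^ 'n) set \<Rightarrow> bool" where
  "hyperplane H \<longleftrightarrow> vec.subspace H \<and> vec.dim H + 1 = CARD('n)"

definition proj_lines :: "('k::field ^ 'n) set set" where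
  "proj_lines = {L. vec.subspace L \<and> vec.dim L = 2}"

definition vanishing_ideal :: "('k::field ^ 'n) set \<Rightarrow> ('n::finite, 'k) mpoly set" where
  "vanishing_ideal V = {p. \<forall>v\<in>V. mp_eval v p = 0}"

definition hyperplane_arrangement :: "('k::field ^ 'n) set set \<Rightarrow> bool" where
  "hyperplane_arrangement A \<longleftrightarrow> finite A \<and> (\<forall>H\<in>A. hyperplane H)"

text \<open>The Zariski topology on the Grassmannian of lines, via the Pluecker embedding: an open set is
  the complement of the common zero set of a family of homogeneous polynomials in the Pluecker
  coordinates. Nonvanishing does not depend on the basis \<open>u, v\<close> of \<open>L\<close>.\<close>

definition pluecker :: "'k::field ^ 'n \<Rightarrow> 'k ^ 'n \<Rightarrow> 'k ^ ('n \<times> 'n)" where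
  "pluecker u v = (\<chi> ij. u $ fst ij * v $ snd ij - u $ snd ij * v $ fst ij)"

definition zariski_open_lines :: "('k::field ^ 'n) set set \<Rightarrow> bool" where
  "zariski_open_lines U \<longleftrightarrow>
     (\<exists>\<F> :: ('n \<times> 'n, 'k) mpoly set. \<F> \<subseteq> (\<Union>d. homog d) \<and>
        U = {L \<in> proj_lines. \<exists>F\<in>\<F>. \<exists>u v. vec.span {u, v} = L \<and> mp_eval (pluecker u v) F \<noteq> 0})"

definition for_general_line :: "(('k::field ^ 'n) set \<Rightarrow> bool) \<Rightarrow> bool" where
  "for_general_line P \<longleftrightarrow> (\<exists>U. zariski_open_lines U \<and> U \<noteq> {} \<and> (\<forall>L\<in>U. P L))"

section \<open>Graded modules\<close>

definition pscale :: "'s::comm_ring_1 \<Rightarrow> ('i \<Rightarrow> 's) \<Rightarrow> 'i \<Rightarrow> 's" where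
  "pscale p x = (\<lambda>i. p * x i)"

interpretation pmod: module "pscale :: 's::comm_ring_1 \<Rightarrow> ('i \<Rightarrow> 's) \<Rightarrow> 'i \<Rightarrow> 's"
  by unfold_locales (auto simp: pscale_def fun_eq_iff algebra_simps)

text \<open>A record presents the graded \<open>S\<close>-module \<open>upper / lower\<close>, where \<open>lower \<subseteq> upper\<close> are
  submodules of the module of all functions \<open>'i \<Rightarrow> S\<close>; \<open>grad d\<close> cuts out the homogeneous
  representatives of degree \<open>d\<close>. The elements of the module are the cosets of \<open>lower\<close> in \<open>upper\<close>,
  and its zero is \<open>lower\<close>.\<close>

record (overloaded) ('i, 'n, 'k) grmod =
  upper :: "('i \<Rightarrow> ('n, 'k) mpoly) set"
  lower :: "('i \<Rightarrow> ('n, 'k) mpoly) set"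
  grad :: "int \<Rightarrow> ('i \<Rightarrow> ('n, 'k) mpoly) set"

definition coset :: "('i, 'n, 'k::comm_ring_1) grmod \<Rightarrow> ('i \<Rightarrow> ('n, 'k) mpoly) \<Rightarrow> ('i \<Rightarrow> ('n, 'k) mpoly) set"
  where "coset M x = {y. y - x \<in> lower M}"

definition homog_elements :: "('i, 'n, 'k::comm_ring_1) grmod \<Rightarrow> int \<Rightarrow> ('i \<Rightarrow> ('n, 'k) mpoly) set set"
  where "homog_elements M d = coset M ` (upper M \<inter> grad M d)"

text \<open>Here \<open>G\<close> is a set of elements of the module, that is, a set of cosets.\<close>

definition generates :: "('i, 'n, 'k::comm_ring_1) grmod \<Rightarrow> ('i \<Rightarrow> ('n, 'k) mpoly) set set \<Rightarrow> bool" where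
  "generates M G \<longleftrightarrow> pmod.span (\<Union>G \<union> lower M) = upper M"

definition minimal_homog_generators ::
  "('i, 'n, 'k::comm_ring_1) grmod \<Rightarrow> ('i \<Rightarrow> ('n, 'k) mpoly) set set \<Rightarrow> bool" where
  "minimal_homog_generators M G \<longleftrightarrow>
     G \<subseteq> (\<Union>d. homog_elements M d) \<and> generates M G \<and> (\<forall>G'. G' \<subset> G \<longrightarrow> \<not> generates M G')"

definition has_minimal_generator_in_degree :: "('i, 'n, 'k::comm_ring_1) grmod \<Rightarrow> int \<Rightarrow> bool" where
  "has_minimal_generator_in_degree M d \<longleftrightarrow>
     (\<exists>G. minimal_homog_generators M G \<and> G \<inter> homog_elements M d \<noteq> {})"

text \<open>For \<open>M = P / Q\<close> and a line \<open>L\<close> with ideal \<open>I\<close>, this is \<open>M / I M = P / (Q + I P)\<close>, i.e.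
  \<open>M\<close> tensored with the coordinate ring \<open>S / I\<close> of \<open>L\<close>. Its associated sheaf is the restriction to
  \<open>L\<close> of the sheaf associated with \<open>M\<close>.\<close>

definition restrict_to :: "('k::field ^ 'n) set \<Rightarrow> ('i, 'n::finite, 'k) grmod \<Rightarrow> ('i, 'n, 'k) grmod" where
  "restrict_to L M =
     M\<lparr>lower := pmod.span (lower M \<union> {pscale p x | p x. p \<in> vanishing_ideal L \<and> x \<in> upper M})\<rparr>"

text \<open>The free module \<open>S(-a\<^sub>1) \<oplus> \<dots> \<oplus> S(-a\<^sub>n)\<close>, whose associated sheaf is the direct sum of the
  \<open>\<O>(-a\<^sub>i)\<close>.\<close>

definition twisted_free :: "nat \<Rightarrow> (nat \<Rightarrow> int) \<Rightarrow> (nat, 'n::finite, 'k::comm_ring_1) grmod" where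
  "twisted_free n a =
     \<lparr>upper = {c. \<forall>i. i \<notin> {1..n} \<longrightarrow> c i = 0}, lower = {0},
      grad = (\<lambda>d. {c. \<forall>i\<in>{1..n}. c i \<in> homog (d - a i)})\<rparr>"

section \<open>Isomorphisms of associated sheaves\<close>

text \<open>The sheaf associated with a graded module \<open>M\<close> is described by its sections over the
  distinguished open sets \<open>D\<^sub>+(f)\<close>, \<open>f\<close> homogeneous of positive degree. These form a basis of the
  topology, and the module of sections over \<open>D\<^sub>+(f)\<close> is the degree zero part of the localization
  of \<open>M\<close> at \<open>f\<close>. A pair \<open>(m, k)\<close> stands for the fraction \<open>m / f ^ k\<close>.\<close>

definition distinguished :: "('n::finite, 'k::comm_ring_1) mpoly set" where
  "distinguished = {f. f \<noteq> 0 \<and> (\<exists>e>0. f \<in> homog e)}"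

definition fractions ::
  "('i, 'n::finite, 'k::comm_ring_1) grmod \<Rightarrow> ('n, 'k) mpoly \<Rightarrow> (('i \<Rightarrow> ('n, 'k) mpoly) \<times> nat) set" where
  "fractions M f = {(m, k). m \<in> upper M \<and> (\<exists>e. f \<in> homog e \<and> m \<in> grad M (int k * e))}"

definition fraction_rel ::
  "('i, 'n::finite, 'k::comm_ring_1) grmod \<Rightarrow> ('n, 'k) mpoly \<Rightarrow> (('i \<Rightarrow> ('n, 'k) mpoly) \<times> nat) rel" where
  "fraction_rel M f = {((m, k), (m', k')). (m, k) \<in> fractions M f \<and> (m', k') \<in> fractions M f \<and>
     (\<exists>j. pscale (f ^ j) (pscale (f ^ k') m - pscale (f ^ k) m') \<in> lower M)}"

definition frac ::
  "('i, 'n::finite, 'k::comm_ring_1) grmod \<Rightarrow> ('n, 'k) mpoly \<Rightarrow> ('i \<Rightarrow> ('n, 'k) mpoly) \<Rightarrow> nat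
     \<Rightarrow> (('i \<Rightarrow> ('n, 'k) mpoly) \<times> nat) set" where
  "frac M f m k = fraction_rel M f `` {(m, k)}"

definition sections ::
  "('i, 'n::finite, 'k::comm_ring_1) grmod \<Rightarrow> ('n, 'k) mpoly \<Rightarrow> (('i \<Rightarrow> ('n, 'k) mpoly) \<times> nat) set set" where
  "sections M f = fractions M f // fraction_rel M f"

definition sec_add ::
  "('i, 'n::finite, 'k::comm_ring_1) grmod \<Rightarrow> ('n, 'k) mpoly \<Rightarrow> (('i \<Rightarrow> ('n, 'k) mpoly) \<times> nat) set
     \<Rightarrow> (('i \<Rightarrow> ('n, 'k) mpoly) \<times> nat) set \<Rightarrow> (('i \<Rightarrow> ('n, 'k) mpoly) \<times> nat) set" where
  "sec_add M f X Y =
     (\<Union>(m, k)\<in>X. \<Union>(m', k')\<in>Y. frac M f (pscale (f ^ k') m + pscale (f ^ k) m') (k + k'))"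

text \<open>The action of the regular function \<open>s / f ^ j\<close> on sections over \<open>D\<^sub>+(f)\<close>.\<close>

definition sec_scale ::
  "('i, 'n::finite, 'k::comm_ring_1) grmod \<Rightarrow> ('n, 'k) mpoly \<Rightarrow> ('n, 'k) mpoly \<Rightarrow> nat
     \<Rightarrow> (('i \<Rightarrow> ('n, 'k) mpoly) \<times> nat) set \<Rightarrow> (('i \<Rightarrow> ('n, 'k) mpoly) \<times> nat) set" where
  "sec_scale M f s j X = (\<Union>(m, k)\<in>X. frac M f (pscale s m) (j + k))"

text \<open>Restriction from \<open>D\<^sub>+(f)\<close> to \<open>D\<^sub>+(f g) = D\<^sub>+(f) \<inter> D\<^sub>+(g)\<close>. If
  \<open>D\<^sub>+(h) \<subseteq> D\<^sub>+(f)\<close>, then \<open>D\<^sub>+(h) = D\<^sub>+(f h)\<close>, so these maps cover all inclusions between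
  distinguished open sets.\<close>

definition sec_restrict ::
  "('i, 'n::finite, 'k::comm_ring_1) grmod \<Rightarrow> ('n, 'k) mpoly \<Rightarrow> ('n, 'k) mpoly
     \<Rightarrow> (('i \<Rightarrow> ('n, 'k) mpoly) \<times> nat) set \<Rightarrow> (('i \<Rightarrow> ('n, 'k) mpoly) \<times> nat) set" where
  "sec_restrict M f g X = (\<Union>(m, k)\<in>X. frac M (f * g) (pscale (g ^ k) m) k)"

text \<open>An isomorphism of sheaves of modules is a family of linear bijections on sections over the
  distinguished open sets that commutes with restriction. If both modules are annihilated by the
  ideal of \<open>L\<close>, the sheaves live on \<open>L\<close>, and isomorphisms over the ambient space and over \<open>L\<close> are the
  same.\<close>

definition sheaf_iso ::
  "('i, 'n::finite, 'k::comm_ring_1) grmod \<Rightarrow> ('j, 'n, 'k) grmod \<Rightarrow> bool" where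
  "sheaf_iso M N \<longleftrightarrow>
     (\<exists>\<phi>. \<forall>f\<in>distinguished.
        bij_betw (\<phi> f) (sections M f) (sections N f) \<and>
        (\<forall>X\<in>sections M f. \<forall>Y\<in>sections M f.
           \<phi> f (sec_add M f X Y) = sec_add N f (\<phi> f X) (\<phi> f Y)) \<and>
        (\<forall>e s j. f \<in> homog e \<longrightarrow> s \<in> homog (int j * e) \<longrightarrow>
           (\<forall>X\<in>sections M f. \<phi> f (sec_scale M f s j X) = sec_scale N f s j (\<phi> f X))) \<and>
        (\<forall>g\<in>distinguished. \<forall>X\<in>sections M f.
           \<phi> (f * g) (sec_restrict M f g X) = sec_restrict N f g (\<phi> f X)))"

definition has_splitting_type ::
  "('i, 'n::finite, 'k::field) grmod \<Rightarrow> nat \<Rightarrow> (nat \<Rightarrow> int) \<Rightarrow> bool" where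
  "has_splitting_type M n a \<longleftrightarrow>
     (\<forall>i\<in>{1..n}. 0 \<le> a i) \<and> (\<forall>i\<in>{1..n}. \<forall>j\<in>{1..n}. i \<le> j \<longrightarrow> a i \<le> a j) \<and>
     for_general_line (\<lambda>L. sheaf_iso (restrict_to L M) (restrict_to L (twisted_free n a)))"

section \<open>Logarithmic derivations\<close>

definition derivations :: "(('n::finite, 'k::field) mpoly \<Rightarrow> ('n, 'k) mpoly) set" where
  "derivations = {\<theta>. (\<forall>p q. \<theta> (p + q) = \<theta> p + \<theta> q) \<and> (\<forall>c p. \<theta> (Const c * p) = Const c * \<theta> p) \<and>
                     (\<forall>p q. \<theta> (p * q) = p * \<theta> q + q * \<theta> p)}"

definition log_derivations ::
  "('k::field ^ 'n) set set \<Rightarrow> (('n::finite, 'k) mpoly \<Rightarrow> ('n, 'k) mpoly) set" where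
  "log_derivations A = {\<theta> \<in> derivations. \<forall>H\<in>A. \<theta> ` vanishing_ideal H \<subseteq> vanishing_ideal H}"

definition euler :: "('n::finite, 'k::field) mpoly \<Rightarrow> ('n, 'k) mpoly" where
  "euler p = (\<Sum>i\<in>UNIV. Var i * partial_deriv i p)"

definition D0 :: "('k::field ^ 'n) set set \<Rightarrow> (('n::finite, 'k) mpoly, 'n, 'k) grmod" where
  "D0 A = \<lparr>upper = log_derivations A, lower = pmod.span {euler},
           grad = (\<lambda>d. {\<theta>. \<forall>l\<in>homog 1. \<theta> l \<in> homog d})\<rparr>"

end

theory Submission
  imports Defs
begin

text \<open>A derivation is a polynomial vector field, logarithmic iff it is tangent to every hyperplane. For
  \<open>H \<in> A\<close> every class modulo the Euler field contains a field with values in \<open>H\<close>. On a general line a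
  nonzero such field \<open>\<theta>\<close> of degree \<open>< a\<^sub>2\<close> lies in the summand \<open>\<O>(-a\<^sub>1)\<close>, and so does every field
  parallel to it. Fix a general point \<open>e\<close>. Among the tangent fields parallel to \<open>\<theta>\<close>, one of least degree
  in the direction \<open>e\<close> can be made monic in that direction by Gauss's lemma, so it is homogeneous and
  does not vanish at \<open>e\<close>. A combination of its coordinates, in every fibre of the module, is a nonzero
  polynomial that is constant in the direction \<open>e\<close>, for otherwise dividing by it would lower the degree.
  So the field vanishes nowhere on a general line through \<open>e\<close>; its restriction is then a nowhere vanishing
  section of a twist of \<open>\<O>(-a\<^sub>1)\<close>, which makes its degree equal to \<open>a\<^sub>1\<close>. If \<open>\<theta>\<close> has the least degree
  of a nonzero element of the module, that degree is \<open>a\<^sub>1\<close>, and a nonzero element of least degree is part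
  of a minimal system of generators.\<close>

section \<open>Polynomial functions\<close>

text \<open>The obstacle is that vanishing must be tested in the fibres of the module and not on
  vectors: at a point of a hyperplane \<open>K\<close> a tangent field can be the zero vector while
  its class in the fibre is nonzero, because the quotient of its component across \<open>K\<close>
  by the equation of \<open>K\<close> survives. The coordinates of a field are therefore its
  components together with these quotients, and a common factor has to be removed from all of them
  at once, so that the result stays tangent. Zeros in codimension one are divided out, those in
  codimension two are avoided by a general line. The direction \<open>e\<close> makes both explicit:
  one component of the primitive field is monic along \<open>e\<close> and the witness
  \<open>h\<close> is constant along \<open>e\<close>, so a line through \<open>e\<close> and a
  point with \<open>h\<close> nonzero meets no zero. Divisibility is reduced to lines and planes,
  that is, to \<open>k[s]\<close> and \<open>k[y][s]\<close>. On the line only the degree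
  \<open>m\<close> of the primitive field is computed; the minimal choice of the degree of \<theta>
  forces the two degrees to agree.\<close>

lemma infinite_UNIV_alg_closed: "infinite (UNIV :: 'k::alg_closed_field set)"
proof
  assume fin: "finite (UNIV :: 'k set)"
  define p :: "'k poly" where "p = (\<Prod>a\<in>UNIV. [:- a, 1:]) + 1"
  have ev: "poly p x = 1" for x
    using fin by (auto simp: p_def poly_prod prod_zero_iff)
  have "degree (\<Prod>a\<in>UNIV. [:- a, 1:] :: 'k poly) = card (UNIV :: 'k set)"
    by (subst degree_prod_eq_sum_degree) auto
  hence "degree p = card (UNIV :: 'k set)"
    unfolding p_def using fin by (subst degree_add_eq_left) (auto simp: card_gt_0_iff)
  hence "degree p > 0"
    using fin by (simp add: card_gt_0_iff)
  from alg_closed_imp_poly_has_root[OF this] show False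
    using ev by auto
qed

lemma poly_eqI_cofinite:
  fixes p q :: "'k::alg_closed_field poly"
  assumes "finite F" and "\<And>s. s \<notin> F \<Longrightarrow> poly p s = poly q s"
  shows "p = q"
proof (rule ccontr)
  assume "p \<noteq> q"
  hence "finite {s. poly (p - q) s = 0}"
    by (intro poly_roots_finite) simp
  moreover have "- F \<subseteq> {s. poly (p - q) s = 0}"
    using assms(2) by auto
  ultimately have "finite (- F)"
    by (rule rev_finite_subset)
  thus False
    using assms(1) infinite_UNIV_alg_closed[where 'k='k] by (metis finite_compl)
qed

lemma poly_eqI_all:
  fixes p q :: "'k::alg_closed_field poly"
  assumes "\<And>s. poly p s = poly q s"
  shows "p = q"
  using poly_eqI_cofinite[of "{}" p q] assms by auto

text \<open>A polynomial over an infinite field is determined by its values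
  (\<open>mp_eval_inject\<close>), so the algebra is done with functions: substitution becomes
  composition, and restriction to lines needs no change of coordinates.\<close>

inductive polyfun :: "('k::comm_ring_1 ^ 'n::finite \<Rightarrow> 'k) \<Rightarrow> bool" where
  polyfun_const: "polyfun (\<lambda>x. c)"
| polyfun_coord: "polyfun (\<lambda>x. x $ i)"
| polyfun_add: "polyfun f \<Longrightarrow> polyfun g \<Longrightarrow> polyfun (\<lambda>x. f x + g x)"
| polyfun_mult: "polyfun f \<Longrightarrow> polyfun g \<Longrightarrow> polyfun (\<lambda>x. f x * g x)"

lemma polyfun_uminus: "polyfun f \<Longrightarrow> polyfun (\<lambda>x. - f x)"
  using polyfun_mult[OF polyfun_const[of "-1"]] by simp

lemma polyfun_diff: "polyfun f \<Longrightarrow> polyfun g \<Longrightarrow> polyfun (\<lambda>x. f x - g x)"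
  using polyfun_add[OF _ polyfun_uminus] by simp

lemma polyfun_sum: "(\<And>i. i \<in> I \<Longrightarrow> polyfun (f i)) \<Longrightarrow> polyfun (\<lambda>x. \<Sum>i\<in>I. f i x)"
  by (induction I rule: infinite_finite_induct) (auto intro: polyfun_const polyfun_add)

lemma polyfun_prod: "(\<And>i. i \<in> I \<Longrightarrow> polyfun (f i)) \<Longrightarrow> polyfun (\<lambda>x. \<Prod>i\<in>I. f i x)"
  by (induction I rule: infinite_finite_induct) (auto intro: polyfun_const polyfun_mult)

lemma polyfun_power: "polyfun f \<Longrightarrow> polyfun (\<lambda>x. f x ^ k)"
  by (induction k) (auto intro: polyfun_const polyfun_mult)

lemmas polyfun_intros =
  polyfun_const polyfun_coord polyfun_add polyfun_mult polyfun_diff polyfun_uminus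
  polyfun_sum polyfun_prod polyfun_power

lemma polyfun_compose:
  assumes "polyfun f" and "\<And>i. polyfun (\<lambda>x. g x $ i)"
  shows "polyfun (\<lambda>x. f (g x))"
  using assms by induction (auto intro: polyfun_intros)

lemma polyfun_affine:
  assumes "polyfun f" and "polyfun l"
  shows "polyfun (\<lambda>x. f (x + l x *s e))"
  by (rule polyfun_compose[OF assms(1)]) (auto intro!: polyfun_intros assms(2))

text \<open>One induction treats a moving base point and a moving direction; taking one of
  \<open>A\<close>, \<open>B\<close> constant and the other the identity gives both halves of
  \<open>polyfun_coeff_line_poly\<close>.\<close>

lemma polyfun_expand:
  assumes "polyfun f" and "\<And>i. polyfun (\<lambda>z. A z $ i)" and "\<And>i. polyfun (\<lambda>z. B z $ i)"
  shows "\<exists>P d. (\<forall>z s. poly (P z) s = f (A z + s *s B z)) \<and>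
               (\<forall>j. polyfun (\<lambda>z. coeff (P z) j)) \<and> (\<forall>z. degree (P z) \<le> d)"
  using assms(1)
proof induction
  case (polyfun_const c)
  have "polyfun (\<lambda>z. coeff [:c:] j)" for j
    by (rule polyfun_intros)
  thus ?case
    by (intro exI[of _ "\<lambda>_. [:c:]"] exI[of _ 0]) auto
next
  case (polyfun_coord i)
  have "polyfun (\<lambda>z. coeff [:A z $ i, B z $ i:] j)" for j
  proof -
    have "(\<lambda>z. coeff [:A z $ i, B z $ i:] j) =
        (\<lambda>z. if j = 0 then A z $ i else if j = 1 then B z $ i else 0)"
      by (auto simp: coeff_pCons fun_eq_iff split: nat.split)
    thus ?thesis
      by (cases "j = 0"; cases "j = 1") (auto intro: polyfun_intros assms)
  qed
  thus ?case
    by (intro exI[of _ "\<lambda>z. [:A z $ i, B z $ i:]"] exI[of _ 1]) auto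
next
  case (polyfun_add f g)
  then obtain P Q d d' where
    "\<forall>z s. poly (P z) s = f (A z + s *s B z)" "\<forall>j. polyfun (\<lambda>z. coeff (P z) j)" "\<forall>z. degree (P z) \<le> d"
    "\<forall>z s. poly (Q z) s = g (A z + s *s B z)" "\<forall>j. polyfun (\<lambda>z. coeff (Q z) j)" "\<forall>z. degree (Q z) \<le> d'"
    by blast
  thus ?case
    by (intro exI[of _ "\<lambda>z. P z + Q z"] exI[of _ "max d d'"])
       (auto intro!: polyfun.polyfun_add order.trans[OF degree_add_le_max] max.mono)
next
  case (polyfun_mult f g)
  then obtain P Q d d' where PQ:
    "\<forall>z s. poly (P z) s = f (A z + s *s B z)" "\<forall>j. polyfun (\<lambda>z. coeff (P z) j)" "\<forall>z. degree (P z) \<le> d"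
    "\<forall>z s. poly (Q z) s = g (A z + s *s B z)" "\<forall>j. polyfun (\<lambda>z. coeff (Q z) j)" "\<forall>z. degree (Q z) \<le> d'"
    by blast
  have "degree (P z * Q z) \<le> d + d'" for z
    by (rule order.trans[OF degree_mult_le]) (use PQ(3,6) in \<open>simp add: add_mono\<close>)
  thus ?case using PQ
    by (intro exI[of _ "\<lambda>z. P z * Q z"] exI[of _ "d + d'"])
       (auto simp: coeff_mult intro!: polyfun_sum polyfun.polyfun_mult)
qed

text \<open>The description by values is unique by \<open>poly_eqI_all\<close>. Degrees in a
  direction \<open>e\<close> are read off from this polynomial without coordinates adapted to
  \<open>e\<close>.\<close>

definition line_poly :: "('k::alg_closed_field ^ 'n::finite \<Rightarrow> 'k) \<Rightarrow> 'k ^ 'n \<Rightarrow> 'k ^ 'n \<Rightarrow> 'k poly" where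
  "line_poly f x e = (THE p. \<forall>s. poly p s = f (x + s *s e))"

lemma line_poly_unique:
  assumes "\<And>s. poly p s = f (x + s *s e)"
  shows "line_poly f x e = p"
  unfolding line_poly_def by (rule the_equality) (simp_all add: assms poly_eqI_all)

lemma poly_line_poly:
  assumes "polyfun f"
  shows "poly (line_poly f x e) s = f (x + s *s e)"
proof -
  obtain P where "\<forall>z s. poly (P z) s = f (z + s *s e)"
    using polyfun_expand[OF assms, of "\<lambda>z. z" "\<lambda>_. e", OF polyfun_coord polyfun_const] by metis
  thus ?thesis
    using line_poly_unique[of "P x" f x e] by simp
qed

lemma polyfun_coeff_line_poly:
  assumes "polyfun f"
  shows "polyfun (\<lambda>x. coeff (line_poly f x e) j)" "polyfun (\<lambda>e. coeff (line_poly f x e) j)"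
proof -
  obtain P where P: "\<forall>z s. poly (P z) s = f (z + s *s e)" "\<forall>j. polyfun (\<lambda>z. coeff (P z) j)"
    using polyfun_expand[OF assms, of "\<lambda>z. z" "\<lambda>_. e", OF polyfun_coord polyfun_const] by metis
  have "line_poly f x e = P x" for x
    using line_poly_unique[of "P x" f x e] P by simp
  thus "polyfun (\<lambda>x. coeff (line_poly f x e) j)"
    using P by simp
  obtain Q where Q: "\<forall>z s. poly (Q z) s = f (x + s *s z)" "\<forall>j. polyfun (\<lambda>z. coeff (Q z) j)"
    using polyfun_expand[OF assms, of "\<lambda>_. x" "\<lambda>z. z", OF polyfun_const polyfun_coord] by metis
  have "line_poly f x e = Q e" for e
    using line_poly_unique[of "Q e" f x e] Q by simp
  thus "polyfun (\<lambda>e. coeff (line_poly f x e) j)"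
    using Q by simp
qed

lemma degree_line_poly_bounded:
  assumes "polyfun f"
  shows "\<exists>d. \<forall>x e. degree (line_poly f x e) \<le> d"
  using assms
proof induction
  case (polyfun_const c)
  have "line_poly (\<lambda>x. c) x e = [:c:]" for x e :: "'a ^ 'b"
    by (rule line_poly_unique) auto
  thus ?case by auto
next
  case (polyfun_coord i)
  have "line_poly (\<lambda>x. x $ i) x e = [:x $ i, e $ i:]" for x e :: "'a ^ 'b"
    by (rule line_poly_unique) auto
  thus ?case by (intro exI[of _ 1]) auto
next
  case (polyfun_add f g)
  then obtain d d' where d: "\<forall>x e. degree (line_poly f x e) \<le> d" "\<forall>x e. degree (line_poly g x e) \<le> d'"
    by blast
  have "line_poly (\<lambda>x. f x + g x) x e = line_poly f x e + line_poly g x e" for x e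
    by (rule line_poly_unique) (simp add: poly_line_poly polyfun_add)
  thus ?case using d
    by (intro exI[of _ "max d d'"])
       (auto intro!: order.trans[OF degree_add_le_max] max.mono)
next
  case (polyfun_mult f g)
  then obtain d d' where d: "\<forall>x e. degree (line_poly f x e) \<le> d" "\<forall>x e. degree (line_poly g x e) \<le> d'"
    by blast
  have "line_poly (\<lambda>x. f x * g x) x e = line_poly f x e * line_poly g x e" for x e
    by (rule line_poly_unique) (simp add: poly_line_poly polyfun_mult)
  thus ?case using d
    by (intro exI[of _ "d + d'"]) (auto intro!: order.trans[OF degree_mult_le] add_mono)
qed

lemma line_poly_const: "line_poly (\<lambda>x. c) x e = [:c:]"
  by (rule line_poly_unique) simp

lemma line_poly_diff:
  "polyfun f \<Longrightarrow> polyfun g \<Longrightarrow> line_poly (\<lambda>x. f x - g x) x e = line_poly f x e - line_poly g x e"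
  by (rule line_poly_unique) (simp add: poly_line_poly)

lemma line_poly_mult:
  "polyfun f \<Longrightarrow> polyfun g \<Longrightarrow> line_poly (\<lambda>x. f x * g x) x e = line_poly f x e * line_poly g x e"
  by (rule line_poly_unique) (simp add: poly_line_poly)

lemma line_poly_power:
  "polyfun f \<Longrightarrow> line_poly (\<lambda>x. f x ^ k) x e = line_poly f x e ^ k"
  by (rule line_poly_unique) (simp add: poly_line_poly)

lemma line_poly_invariant:
  assumes "\<And>s. f (x + s *s e) = f x"
  shows "line_poly f x e = [:f x:]"
  by (rule line_poly_unique) (simp add: assms)

lemma line_poly_translate:
  assumes "polyfun f"
  shows "line_poly f (x + t *s e) e = pcompose (line_poly f x e) [:t, 1:]"
  by (rule line_poly_unique)
     (simp add: poly_pcompose poly_line_poly assms vector_sadd_rdistrib add.assoc)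

lemma coeff_0_line_poly: "polyfun f \<Longrightarrow> coeff (line_poly f x e) 0 = f x"
  by (simp add: poly_line_poly flip: poly_0_coeff_0)

text \<open>Restriction to the line joining \<open>u\<close> and \<open>v\<close> reduces this to
  \<open>k[s]\<close> having no zero divisors. It serves both to cancel factors and to satisfy
  several open conditions at one general point.\<close>

lemma polyfun_mult_nonzero:
  fixes f g :: "'k::alg_closed_field ^ 'n::finite \<Rightarrow> 'k"
  assumes "polyfun f" "polyfun g" "f u \<noteq> 0" "g v \<noteq> 0"
  shows "\<exists>x. f x \<noteq> 0 \<and> g x \<noteq> 0"
proof -
  define p where "p = line_poly f u (v - u)"
  define q where "q = line_poly g u (v - u)"
  have p: "poly p s = f (u + s *s (v - u))" and q: "poly q s = g (u + s *s (v - u))" for s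
    by (simp_all add: p_def q_def poly_line_poly assms)
  have "p \<noteq> 0" "q \<noteq> 0"
    using p[of 0] q[of 1] assms by auto
  hence "p * q \<noteq> 0"
    by simp
  then obtain s where "poly (p * q) s \<noteq> 0"
    using poly_eqI_all[of "p * q" 0] by auto
  thus ?thesis
    using p q by auto
qed

lemma polyfun_mult_eq_0:
  fixes f g :: "'k::alg_closed_field ^ 'n::finite \<Rightarrow> 'k"
  assumes "polyfun f" "polyfun g" "\<And>x. f x * g x = 0" "f u \<noteq> 0"
  shows "g x = 0"
  using polyfun_mult_nonzero[OF assms(1,2,4)] assms(3) by (metis mult_eq_0_iff)

lemma polyfun_mult_cancel:
  fixes f g h :: "'k::alg_closed_field ^ 'n::finite \<Rightarrow> 'k"
  assumes "polyfun f" "polyfun g" "polyfun h" "\<And>x. f x * g x = f x * h x" "f u \<noteq> 0"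
  shows "g x = h x"
  using polyfun_mult_eq_0[of f "\<lambda>x. g x - h x" u x] assms by (simp add: polyfun_diff algebra_simps)

lemma polyfun_finite_nonzero:
  fixes f :: "'i \<Rightarrow> 'k::alg_closed_field ^ 'n::finite \<Rightarrow> 'k"
  assumes "finite I" "\<And>i. i \<in> I \<Longrightarrow> polyfun (f i)" "\<And>i. i \<in> I \<Longrightarrow> \<exists>x. f i x \<noteq> 0"
  shows "\<exists>x. \<forall>i\<in>I. f i x \<noteq> 0"
proof -
  have "\<exists>x. (\<Prod>i\<in>I. f i x) \<noteq> 0"
    using assms
  proof (induction I rule: finite_induct)
    case (insert i I)
    then obtain u v where "f i u \<noteq> 0" "(\<Prod>i\<in>I. f i v) \<noteq> 0"
      by (metis insertCI)
    moreover have "polyfun (f i)" "polyfun (\<lambda>x. \<Prod>i\<in>I. f i x)"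
      using insert by (auto intro: polyfun_prod)
    ultimately obtain x where "f i x \<noteq> 0" "(\<Prod>i\<in>I. f i x) \<noteq> 0"
      using polyfun_mult_nonzero[of "f i" "\<lambda>x. \<Prod>i\<in>I. f i x"] by blast
    thus ?case
      using insert by (intro exI[of _ x]) simp
  qed auto
  thus ?thesis
    using assms(1) by auto
qed

text \<open>Expanding \<open>a / b\<close> as a power series in \<open>w\<close> at the point \<open>z\<close>, every homogeneous part is
  polynomial in \<open>w\<close> because \<open>b z \<noteq> 0\<close>; divisibility on the lines through \<open>z\<close> makes the series finite.\<close>

lemma polyfun_dvd_lines:
  fixes a b :: "'k::alg_closed_field ^ 'n::finite \<Rightarrow> 'k"
  assumes a: "polyfun a" and b: "polyfun b" and nz: "b z \<noteq> 0"
    and dvd: "\<And>w. line_poly b z w dvd line_poly a z w"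
  shows "\<exists>c. polyfun c \<and> (\<forall>x. a x = b x * c x)"
proof -
  define al where "al w = line_poly a z w" for w
  define be where "be w = line_poly b z w" for w
  have be0: "coeff (be w) 0 = b z" for w
    using b by (simp add: be_def coeff_0_line_poly)
  have be_nz: "be w \<noteq> 0" for w
    using be0[of w] nz by auto
  obtain d where d: "degree (al w) \<le> d" for w
    using degree_line_poly_bounded[OF a] by (auto simp: al_def)
  define Q where "Q w = (SOME q. al w = be w * q)" for w
  have "\<exists>q. al w = be w * q" for w
    using dvd[of w] unfolding al_def be_def dvd_def .
  hence Q: "al w = be w * Q w" for w
    unfolding Q_def by (rule someI_ex)
  have degQ: "degree (Q w) \<le> d" for w
  proof (cases "Q w = 0")
    case False
    hence "degree (al w) = degree (be w) + degree (Q w)"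
      using be_nz by (simp add: Q degree_mult_eq)
    thus ?thesis using d[of w] by simp
  qed simp
  have polyQ: "polyfun (\<lambda>w. coeff (Q w) k)" for k
  proof (induction k rule: less_induct)
    case (less k)
    have *: "coeff (Q w) k = inverse (b z) * (coeff (al w) k - (\<Sum>i\<in>{1..k}. coeff (be w) i * coeff (Q w) (k - i)))" for w
    proof -
      have "coeff (al w) k = (\<Sum>i\<le>k. coeff (be w) i * coeff (Q w) (k - i))"
        by (simp add: Q coeff_mult)
      also have "{..k} = insert 0 {1..k}"
        by auto
      finally show ?thesis
        using nz by (simp add: be0 field_simps)
    qed
    show ?case unfolding *
      using less polyfun_coeff_line_poly(2)[OF a] polyfun_coeff_line_poly(2)[OF b]
      by (auto intro!: polyfun_intros simp: al_def be_def)
  qed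
  \<comment> \<open>The point \<open>x\<close> has parameter 1 on the line from \<open>z\<close> in
    the direction \<open>x - z\<close>, and the sum of the coefficients is the value there.\<close>
  define c where "c x = (\<Sum>k\<le>d. coeff (Q (x - z)) k)" for x
  have cQ: "c x = poly (Q (x - z)) 1" for x
    unfolding c_def poly_altdef using degQ
    by (auto intro!: sum.mono_neutral_right le_degree)
  have "a x = b x * c x" for x
  proof -
    have "poly (al (x - z)) 1 = a x" "poly (be (x - z)) 1 = b x"
      using a b by (simp_all add: al_def be_def poly_line_poly)
    thus ?thesis
      by (simp add: Q cQ)
  qed
  moreover have "polyfun c"
    unfolding c_def by (intro polyfun_sum polyfun_compose[OF polyQ]) (auto intro!: polyfun_intros)
  ultimately show ?thesis by blast
qed

section \<open>Evaluation of multivariate polynomials\<close>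

abbreviation lookup :: "('a \<Rightarrow>\<^sub>0 'b::zero) \<Rightarrow> 'a \<Rightarrow> 'b" where
  "lookup \<equiv> Poly_Mapping.lookup"

abbreviation keys :: "('a \<Rightarrow>\<^sub>0 'b::zero) \<Rightarrow> 'a set" where
  "keys \<equiv> Poly_Mapping.keys"

abbreviation single :: "'a \<Rightarrow> 'b \<Rightarrow> 'a \<Rightarrow>\<^sub>0 'b::zero" where
  "single \<equiv> Poly_Mapping.single"

abbreviation mdeg :: "('n::finite \<Rightarrow>\<^sub>0 nat) \<Rightarrow> nat" where
  "mdeg m \<equiv> \<Sum>i\<in>UNIV. lookup m i"

abbreviation mono_eval :: "'k::comm_ring_1 ^ 'n::finite \<Rightarrow> ('n \<Rightarrow>\<^sub>0 nat) \<Rightarrow> 'k" where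
  "mono_eval v m \<equiv> \<Prod>i\<in>UNIV. (v $ i) ^ lookup m i"

lemma mpoly_sum_single:
  fixes p :: "('n, 'k::comm_ring_1) mpoly"
  shows "(\<Sum>m\<in>keys p. single m (lookup p m)) = p"
  by (rule poly_mapping_eqI) (auto simp: lookup_sum lookup_single when_def in_keys_iff)

lemma mpoly_induct [case_names single add]:
  fixes p :: "('n, 'k::comm_ring_1) mpoly"
  assumes "\<And>m c. P (single m c)" and "\<And>p q. P p \<Longrightarrow> P q \<Longrightarrow> P (p + q)"
  shows "P p"
proof -
  have "P (\<Sum>m\<in>M. single m (lookup p m))" for M
  proof (induction M rule: infinite_finite_induct)
    case (insert x F)
    thus ?case using assms by simp
  qed (use assms(1)[of 0 0] in simp_all)
  from this[of "keys p"] show ?thesis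
    by (simp only: mpoly_sum_single)
qed

lemma mp_eval_superset:
  assumes "finite M" and "keys p \<subseteq> M"
  shows "mp_eval v p = (\<Sum>m\<in>M. lookup p m * mono_eval v m)"
  unfolding mp_eval_def using assms
  by (intro sum.mono_neutral_left) (auto simp: in_keys_iff)

lemma mp_eval_single [simp]: "mp_eval v (single m c) = c * mono_eval v m"
  by (subst mp_eval_superset[of "{m}"]) auto

lemma mp_eval_0 [simp]: "mp_eval v 0 = 0"
  by (simp add: mp_eval_def)

lemma mp_eval_add [simp]: "mp_eval v (p + q) = mp_eval v p + mp_eval v q"
proof -
  let ?M = "keys p \<union> keys q"
  have "keys (p + q) \<subseteq> ?M"
    by (rule Poly_Mapping.keys_add)
  thus ?thesis
    by (simp add: mp_eval_superset[of ?M] lookup_add sum.distrib distrib_right)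
qed

lemma mp_eval_uminus [simp]: "mp_eval v (- p) = - mp_eval v p"
  using mp_eval_add[of v p "- p"] by (simp add: eq_neg_iff_add_eq_0 add.commute)

lemma mp_eval_diff [simp]: "mp_eval v (p - q) = mp_eval v p - mp_eval v q"
  using mp_eval_add[of v p "- q"] by simp

lemma mp_eval_sum [simp]: "mp_eval v (sum f I) = (\<Sum>i\<in>I. mp_eval v (f i))"
  by (induction I rule: infinite_finite_induct) auto

lemma mp_eval_mult [simp]: "mp_eval v (p * q) = mp_eval v p * mp_eval v q"
proof (induction p rule: mpoly_induct)
  case (single m c)
  show ?case
  proof (induction q rule: mpoly_induct)
    case (single m' c')
    show ?case
      by (simp add: mult_single lookup_add power_add prod.distrib algebra_simps)
  qed (simp add: algebra_simps)
qed (simp add: algebra_simps)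

lemma mp_eval_1 [simp]: "mp_eval v 1 = 1"
  using mp_eval_single[of v 0 1] by simp

lemma mp_eval_power [simp]: "mp_eval v (p ^ k) = mp_eval v p ^ k"
  by (induction k) auto

lemma mp_eval_Const [simp]: "mp_eval v (Const c) = c"
  by (simp add: Const_def)

lemma mp_eval_Var [simp]: "mp_eval v (Var i) = v $ i"
proof -
  have "mono_eval v (single i 1) = (\<Prod>j\<in>UNIV. if j = i then v $ i else 1)"
    by (intro prod.cong) (auto simp: lookup_single when_def)
  thus ?thesis
    by (simp add: Var_def)
qed

lemma polyfun_mp_eval: "polyfun (\<lambda>v. mp_eval v p)"
  unfolding mp_eval_def by (intro polyfun_intros)

lemma polyfun_imp_mp_eval:
  assumes "polyfun f"
  shows "\<exists>p. \<forall>v. mp_eval v p = f v"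
  using assms
proof induction
  case (polyfun_const c)
  show ?case by (rule exI[of _ "Const c"]) simp
next
  case (polyfun_coord i)
  show ?case by (rule exI[of _ "Var i"]) simp
next
  case (polyfun_add f g)
  thus ?case by (metis mp_eval_add)
next
  case (polyfun_mult f g)
  thus ?case by (metis mp_eval_mult)
qed

definition reweight :: "(('n \<Rightarrow>\<^sub>0 nat) \<Rightarrow> 'k) \<Rightarrow> ('n, 'k::comm_ring_1) mpoly \<Rightarrow> ('n, 'k) mpoly" where
  "reweight g p = (\<Sum>m\<in>keys p. single m (g m * lookup p m))"

lemma lookup_reweight: "lookup (reweight g p) m = g m * lookup p m"
  by (auto simp: reweight_def lookup_sum lookup_single when_def in_keys_iff)

lemma mp_eval_reweight:
  "mp_eval v (reweight g p) = (\<Sum>m\<in>keys p. g m * lookup p m * mono_eval v m)"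
  by (simp add: reweight_def)

lemma ex_power_neq:
  assumes "a \<noteq> b"
  shows "\<exists>c::'k::alg_closed_field. c ^ a \<noteq> c ^ b"
proof (rule ccontr)
  assume "\<not> ?thesis"
  hence "monom (1::'k) a = monom 1 b"
    by (intro poly_eqI_all) (simp add: poly_monom)
  thus False
    using assms by (simp add: monom_eq_iff')
qed

text \<open>Distinct monomials are distinct characters of the multiplicative monoid of vectors; this is
  Artin's argument for their independence.\<close>

lemma mp_eval_eq_0_imp:
  fixes p :: "('n::finite, 'k::alg_closed_field) mpoly"
  assumes "\<And>v. mp_eval v p = 0"
  shows "p = 0"
  using assms
proof (induction "card (keys p)" arbitrary: p rule: less_induct)
  case less
  show ?case
  proof (rule ccontr)
    assume "p \<noteq> 0"
    then obtain m where m: "m \<in> keys p"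
      by (metis in_keys_iff lookup_zero poly_mapping_eqI)
    show False
    proof (cases "keys p = {m}")
      case True
      hence "mp_eval (\<chi> i. 1) p = lookup p m"
        by (simp add: mp_eval_def)
      thus False
        using less.prems m by (simp add: in_keys_iff)
    next
      case False
      then obtain m' where m': "m' \<in> keys p" "m' \<noteq> m"
        using m by auto
      then obtain i where i: "lookup m' i \<noteq> lookup m i"
        by (metis poly_mapping_eqI)
      then obtain c :: 'k where c: "c ^ lookup m' i \<noteq> c ^ lookup m i"
        using ex_power_neq by blast
      \<comment> \<open>The weight is zero at \<open>m\<close> and nonzero at \<open>m'\<close>.
        Since \<open>q\<close> arises from \<open>p\<close> by scaling coordinate \<open>i\<close>
        with \<open>c\<close> and subtracting a multiple of \<open>p\<close>, it still vanishes
        everywhere but has fewer monomials.\<close>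
      define g where "g k = c ^ lookup k i - c ^ lookup m i" for k
      define q where "q = reweight g p"
      have "mp_eval v q = 0" for v
      proof -
        define w where "w = (\<chi> j. (if j = i then c else 1) * v $ j)"
        have w: "mono_eval w k = c ^ lookup k i * mono_eval v k" for k
        proof -
          have "mono_eval w k = (\<Prod>j\<in>UNIV. (if j = i then c else 1) ^ lookup k j) * mono_eval v k"
            by (simp add: w_def power_mult_distrib prod.distrib)
          also have "(\<Prod>j\<in>UNIV. (if j = i then c else 1) ^ lookup k j) =
              (\<Prod>j\<in>UNIV. if j = i then c ^ lookup k i else 1)"
            by (intro prod.cong) auto
          finally show ?thesis by simp
        qed
        have "mp_eval v q = mp_eval w p - c ^ lookup m i * mp_eval v p"
          unfolding q_def mp_eval_reweight unfolding mp_eval_def w g_def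
          by (simp add: sum_distrib_left algebra_simps flip: sum_subtractf)
        thus ?thesis
          by (simp add: less.prems)
      qed
      moreover have "keys q \<subset> keys p"
        using m by (auto simp: q_def in_keys_iff lookup_reweight g_def)
      hence "card (keys q) < card (keys p)"
        by (intro psubset_card_mono) auto
      ultimately have "q = 0"
        using less.hyps by blast
      moreover have "lookup q m' \<noteq> 0"
        using m' c by (simp add: q_def lookup_reweight g_def in_keys_iff)
      ultimately show False
        by simp
    qed
  qed
qed

lemma mp_eval_inject:
  fixes p q :: "('n::finite, 'k::alg_closed_field) mpoly"
  assumes "\<And>v. mp_eval v p = mp_eval v q"
  shows "p = q"
  using mp_eval_eq_0_imp[of "p - q"] assms by simp

lemma homog_iff: "p \<in> homog d \<longleftrightarrow> (\<forall>m. lookup p m \<noteq> 0 \<longrightarrow> int (mdeg m) = d)"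
  by (auto simp: homog_def in_keys_iff)

lemma homog_negative:
  fixes p :: "('n::finite, 'k::comm_ring_1) mpoly"
  assumes "d < 0"
  shows "p \<in> homog d \<longleftrightarrow> p = 0"
proof
  assume p: "p \<in> homog d"
  show "p = 0"
  proof (rule poly_mapping_eqI)
    fix m :: "'n \<Rightarrow>\<^sub>0 nat"
    have "int (mdeg m) \<noteq> d"
      using assms of_nat_0_le_iff[of "mdeg m", where 'a=int] by linarith
    thus "lookup p m = lookup 0 m"
      using p unfolding homog_iff by auto
  qed
qed (simp add: homog_iff)

lemma homog_0 [simp]: "0 \<in> homog d"
  by (simp add: homog_iff)

lemma homog_add: "p \<in> homog d \<Longrightarrow> q \<in> homog d \<Longrightarrow> p + q \<in> homog d"
  unfolding homog_iff lookup_add by (metis add.right_neutral)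

lemma homog_sum: "(\<And>i. i \<in> I \<Longrightarrow> f i \<in> homog d) \<Longrightarrow> sum f I \<in> homog d"
  by (induction I rule: infinite_finite_induct) (auto intro: homog_add)

lemma mono_eval_scale: "mono_eval (c *s v) m = c ^ mdeg m * mono_eval v m"
  by (simp add: power_mult_distrib prod.distrib power_sum)

lemma mp_eval_homog:
  assumes "p \<in> homog (int d)"
  shows "mp_eval (c *s v) p = c ^ d * mp_eval v p"
proof -
  have "mdeg m = d" if "m \<in> keys p" for m
    using that assms unfolding homog_def by (simp flip: of_nat_sum)
  thus ?thesis
    unfolding mp_eval_def mono_eval_scale by (auto simp: sum_distrib_left algebra_simps intro!: sum.cong)
qed

text \<open>The difference of the two sides has coefficients
  \<open>(c ^ mdeg m - c ^ d) * lookup p m\<close>, and over an infinite field some \<open>c\<close>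
  separates two different exponents.\<close>

lemma homogI:
  fixes p :: "('n::finite, 'k::alg_closed_field) mpoly"
  assumes "\<And>c v. mp_eval (c *s v) p = c ^ d * mp_eval v p"
  shows "p \<in> homog (int d)"
  unfolding homog_iff
proof (intro allI impI)
  fix m assume m: "lookup p m \<noteq> 0"
  have "c ^ mdeg m = c ^ d" for c :: 'k
  proof -
    have "mp_eval v (reweight (\<lambda>k. c ^ mdeg k - c ^ d) p) = mp_eval (c *s v) p - c ^ d * mp_eval v p" for v
      unfolding mp_eval_reweight unfolding mp_eval_def mono_eval_scale
      by (simp add: sum_distrib_left algebra_simps flip: sum_subtractf)
    hence "reweight (\<lambda>k. c ^ mdeg k - c ^ d) p = 0"
      by (intro mp_eval_eq_0_imp) (simp add: assms)
    hence "(c ^ mdeg m - c ^ d) * lookup p m = 0"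
      by (metis lookup_reweight lookup_zero)
    thus ?thesis
      using m by simp
  qed
  thus "int (mdeg m) = int d"
    using ex_power_neq[of "mdeg m" d] by metis
qed

lemma homog_mult:
  fixes p q :: "('n::finite, 'k::alg_closed_field) mpoly"
  assumes "p \<in> homog d" "q \<in> homog e"
  shows "p * q \<in> homog (d + e)"
proof (cases "d < 0 \<or> e < 0")
  case True
  hence "p * q = 0"
    using assms homog_negative[of d p] homog_negative[of e q] by auto
  thus ?thesis by simp
next
  case False
  then obtain d' e' where [simp]: "d = int d'" "e = int e'"
    by (metis not_less zero_le_imp_eq_int)
  have "p * q \<in> homog (int (d' + e'))"
    using assms by (intro homogI) (simp add: mp_eval_homog power_add)
  thus ?thesis by simp
qed

lemma Const_homog: "Const c \<in> homog 0"
  by (auto simp: homog_iff Const_def lookup_single when_def split: if_splits)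

lemma one_homog: "1 \<in> homog 0"
  using Const_homog[of 1] by (simp add: Const_def)

lemma Var_homog: "Var i \<in> (homog 1 :: ('n::finite, 'k::alg_closed_field) mpoly set)"
  using homogI[of "Var i :: ('n, 'k) mpoly" 1] by simp

lemma homog_power:
  fixes p :: "('n::finite, 'k::alg_closed_field) mpoly"
  assumes "p \<in> homog d"
  shows "p ^ k \<in> homog (int k * d)"
proof (induction k)
  case 0
  show ?case by (simp add: one_homog)
next
  case (Suc k)
  from homog_mult[OF assms this] show ?case by (simp add: algebra_simps)
qed

lemma homog_degree_unique:
  assumes "p \<in> homog d" "p \<in> homog e" "p \<noteq> 0"
  shows "d = e"
proof -
  obtain m where "lookup p m \<noteq> 0"
    using assms(3) by (metis lookup_zero poly_mapping_eqI)
  thus ?thesis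
    using assms(1,2) unfolding homog_iff by blast
qed

section \<open>Derivations as polynomial vector fields\<close>

lemma lookup_partial_deriv:
  "lookup (partial_deriv i p) m =
     of_nat (lookup m i + 1) * lookup p (m + single i 1)"
proof -
  let ?e = "single i (1::nat)"
  let ?t = "\<lambda>k. lookup (single (k - ?e) (of_nat (lookup k i) * lookup p k)) m"
  have *: "?t k = 0" if "k \<noteq> m + ?e" for k
  proof (cases "lookup k i = 0")
    case False
    have "k = (k - ?e) + ?e"
    proof (rule poly_mapping_eqI)
      fix j
      show "lookup k j = lookup ((k - ?e) + ?e) j"
        using False by (cases "j = i") (auto simp: lookup_add lookup_minus lookup_single)
    qed
    hence "k - ?e \<noteq> m"
      using that by auto
    thus ?thesis by (simp add: lookup_single)
  qed simp
  have "(m + ?e) - ?e = m"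
    by simp
  hence t: "?t (m + ?e) = of_nat (lookup m i + 1) * lookup p (m + ?e)"
    by (simp add: lookup_add)
  have "lookup (partial_deriv i p) m = (\<Sum>k\<in>keys p. ?t k)"
    by (simp add: partial_deriv_def lookup_sum)
  also have "\<dots> = (\<Sum>k\<in>keys p. if k = m + ?e then ?t k else 0)"
    using * by (intro sum.cong) auto
  also have "\<dots> = ?t (m + ?e)"
    by (auto simp: in_keys_iff)
  finally show ?thesis
    using t by simp
qed

lemma partial_deriv_add: "partial_deriv i (p + q) = partial_deriv i p + partial_deriv i q"
  by (rule poly_mapping_eqI) (simp add: lookup_partial_deriv lookup_add distrib_left)

lemma partial_deriv_single:
  "partial_deriv i (single m c) =
     single (m - single i 1) (of_nat (lookup m i) * c)"
  by (cases "c = 0") (simp_all add: partial_deriv_def)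

lemma partial_deriv_mult:
  "partial_deriv i (p * q) = p * partial_deriv i q + q * partial_deriv i p"
proof (induction p rule: mpoly_induct)
  case (single m c)
  show ?case
  proof (induction q rule: mpoly_induct)
    case (single m' c')
    let ?e = "single i (1::nat)"
    have shift: "a + (b - ?e) = (a + b) - ?e" if "lookup b i \<noteq> 0" for a b :: "'a \<Rightarrow>\<^sub>0 nat"
    proof (rule poly_mapping_eqI)
      fix j
      show "lookup (a + (b - ?e)) j = lookup ((a + b) - ?e) j"
        using that by (cases "j = i") (auto simp: lookup_add lookup_minus lookup_single)
    qed
    have 1: "single (m + (m' - ?e)) (of_nat (lookup m' i) * c) =
             single (m + m' - ?e) (of_nat (lookup m' i) * c)" for c :: 'b
      using shift[of m' m] by (cases "lookup m' i = 0") auto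
    have 2: "single (m' + (m - ?e)) (of_nat (lookup m i) * c) =
             single (m + m' - ?e) (of_nat (lookup m i) * c)" for c :: 'b
      using shift[of m m'] by (cases "lookup m i = 0") (auto simp: add.commute)
    show ?case
      using 1[of "c * c'"] 2[of "c * c'"]
      by (simp add: mult_single partial_deriv_single lookup_add algebra_simps flip: single_add)
  qed (simp add: partial_deriv_add algebra_simps)
qed (simp add: partial_deriv_add algebra_simps)

lemma partial_deriv_Const: "partial_deriv i (Const c) = 0"
  by (simp add: Const_def partial_deriv_single)

lemma partial_deriv_Var: "partial_deriv i (Var j) = (if i = j then 1 else 0)"
  by (auto simp: Var_def partial_deriv_single lookup_single)

lemma partial_deriv_homog:
  assumes "p \<in> homog d"
  shows "partial_deriv i p \<in> homog (d - 1)"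
  unfolding homog_iff
proof (intro allI impI)
  fix m assume "lookup (partial_deriv i p) m \<noteq> 0"
  hence "lookup p (m + single i 1) \<noteq> 0"
    by (auto simp: lookup_partial_deriv)
  hence "int (mdeg (m + single i 1)) = d"
    using assms by (auto simp: homog_iff)
  moreover have "mdeg (single i (1::nat)) = 1"
    by (simp add: lookup_single when_def)
  ultimately show "int (mdeg m) = d - 1"
    by (simp add: lookup_add sum.distrib del: of_nat_sum)
qed

text \<open>The induction rule of \<open>polyfun\<close> transported along the injective evaluation
  map; it makes a derivation determined by its values on the variables.\<close>

lemma mpoly_generated_induct [case_names Const Var add mult]:
  fixes p :: "('n::finite, 'k::alg_closed_field) mpoly"
  assumes "\<And>c. P (Const c)" "\<And>i. P (Var i)"
    "\<And>p q. P p \<Longrightarrow> P q \<Longrightarrow> P (p + q)" "\<And>p q. P p \<Longrightarrow> P q \<Longrightarrow> P (p * q)"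
  shows "P p"
proof -
  have "\<exists>q. P q \<and> (\<forall>v. mp_eval v q = f v)" if "polyfun f" for f
    using that
  proof induction
    case (polyfun_const c)
    show ?case by (rule exI[of _ "Const c"]) (simp add: assms)
  next
    case (polyfun_coord i)
    show ?case by (rule exI[of _ "Var i"]) (simp add: assms)
  next
    case (polyfun_add f g)
    thus ?case by (metis assms(3) mp_eval_add)
  next
    case (polyfun_mult f g)
    thus ?case by (metis assms(4) mp_eval_mult)
  qed
  from this[OF polyfun_mp_eval[of p]] obtain q where "P q" "\<And>v. mp_eval v q = mp_eval v p"
    by auto
  thus ?thesis
    using mp_eval_inject[of q p] by simp
qed

lemma derivations_add: "\<theta> \<in> derivations \<Longrightarrow> \<theta> (p + q) = \<theta> p + \<theta> q"
  and derivations_mult: "\<theta> \<in> derivations \<Longrightarrow> \<theta> (p * q) = p * \<theta> q + q * \<theta> p"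
  and derivations_Const_mult: "\<theta> \<in> derivations \<Longrightarrow> \<theta> (Const c * p) = Const c * \<theta> p"
  by (auto simp: derivations_def)

lemma derivations_Const:
  assumes "\<theta> \<in> derivations"
  shows "\<theta> (Const c) = 0"
proof -
  have "\<theta> 1 = 0"
    using derivations_mult[OF assms, of 1 1] by simp
  thus ?thesis
    using derivations_Const_mult[OF assms, of c 1] by simp
qed

lemma derivations_sum: "\<theta> \<in> derivations \<Longrightarrow> \<theta> (sum f I) = (\<Sum>i\<in>I. \<theta> (f i))"
  using derivations_add[of \<theta> 0 0]
  by (induction I rule: infinite_finite_induct) (auto simp: derivations_add)

lemma derivations_eqI:
  fixes \<theta> \<theta>' :: "('n::finite, 'k::alg_closed_field) mpoly \<Rightarrow> ('n, 'k) mpoly"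
  assumes "\<theta> \<in> derivations" "\<theta>' \<in> derivations" "\<And>i. \<theta> (Var i) = \<theta>' (Var i)"
  shows "\<theta> = \<theta>'"
proof
  fix p show "\<theta> p = \<theta>' p"
    by (induction p rule: mpoly_generated_induct)
       (simp_all add: assms derivations_add derivations_mult derivations_Const)
qed

definition der_of :: "('n \<Rightarrow> ('n::finite, 'k::field) mpoly) \<Rightarrow> ('n, 'k) mpoly \<Rightarrow> ('n, 'k) mpoly" where
  "der_of X p = (\<Sum>i\<in>UNIV. X i * partial_deriv i p)"

lemma der_of_derivation: "der_of X \<in> derivations"
  unfolding derivations_def der_of_def
  by (auto simp: partial_deriv_add partial_deriv_mult partial_deriv_Const sum.distrib sum_distrib_left algebra_simps)

lemma der_of_Var [simp]: "der_of X (Var i) = X i"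
  by (simp add: der_of_def partial_deriv_Var if_distrib cong: if_cong)

lemma derivations_eq_der_of:
  fixes \<theta> :: "('n::finite, 'k::alg_closed_field) mpoly \<Rightarrow> ('n, 'k) mpoly"
  assumes "\<theta> \<in> derivations"
  shows "\<theta> = der_of (\<lambda>i. \<theta> (Var i))"
  by (rule derivations_eqI[OF assms der_of_derivation]) simp

lemma euler_eq_der_of: "euler = der_of Var"
  by (auto simp: euler_def der_of_def)

lemma derivations_homog:
  fixes \<theta> :: "('n::finite, 'k::alg_closed_field) mpoly \<Rightarrow> ('n, 'k) mpoly"
  assumes "\<theta> \<in> derivations" "\<And>i. \<theta> (Var i) \<in> homog d" "l \<in> homog 1"
  shows "\<theta> l \<in> homog d"
proof -
  have "\<theta> (Var i) * partial_deriv i l \<in> homog (d + (1 - 1))" for i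
    by (intro homog_mult assms partial_deriv_homog)
  thus ?thesis
    by (subst derivations_eq_der_of[OF assms(1)]) (auto simp: der_of_def intro: homog_sum)
qed

definition vfield :: "(('n::finite, 'k::field) mpoly \<Rightarrow> ('n, 'k) mpoly) \<Rightarrow> 'k ^ 'n \<Rightarrow> 'k ^ 'n" where
  "vfield \<theta> x = (\<chi> i. mp_eval x (\<theta> (Var i)))"

definition dot :: "'k::comm_ring_1 ^ 'n::finite \<Rightarrow> 'k ^ 'n \<Rightarrow> 'k" where
  "dot \<alpha> x = (\<Sum>i\<in>UNIV. \<alpha> $ i * x $ i)"

definition linform :: "'k::comm_ring_1 ^ 'n::finite \<Rightarrow> ('n, 'k) mpoly" where
  "linform \<alpha> = (\<Sum>i\<in>UNIV. Const (\<alpha> $ i) * Var i)"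

lemma mp_eval_linform [simp]: "mp_eval x (linform \<alpha>) = dot \<alpha> x"
  by (simp add: linform_def dot_def)

lemma linform_homog: "linform \<alpha> \<in> (homog 1 :: ('n::finite, 'k::alg_closed_field) mpoly set)"
  using homog_mult[OF Const_homog Var_homog] by (auto simp: linform_def intro: homog_sum)

lemma dot_add: "dot \<alpha> (x + y) = dot \<alpha> x + dot \<alpha> y"
  and dot_diff: "dot \<alpha> (x - y) = dot \<alpha> x - dot \<alpha> y"
  and dot_scale: "dot \<alpha> (c *s x) = c * dot \<alpha> x"
  and dot_0: "dot \<alpha> 0 = 0"
  by (simp_all add: dot_def algebra_simps sum.distrib sum_subtractf sum_distrib_left)

lemma dot_axis: "dot \<alpha> (axis i c) = \<alpha> $ i * c"
  by (simp add: dot_def axis_def if_distrib cong: if_cong)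

lemma ex_dot_eq_1:
  fixes \<alpha> :: "'k::field ^ 'n::finite"
  assumes "\<alpha> \<noteq> 0"
  shows "\<exists>e. dot \<alpha> e = 1"
proof -
  obtain i where "\<alpha> $ i \<noteq> 0"
    using assms by (auto simp: vec_eq_iff)
  thus ?thesis
    by (intro exI[of _ "axis i (inverse (\<alpha> $ i))"]) (simp add: dot_axis)
qed

lemma polyfun_dot: "(\<And>i. polyfun (\<lambda>x. X x $ i)) \<Longrightarrow> polyfun (\<lambda>x. dot \<alpha> (X x))"
  unfolding dot_def by (intro polyfun_intros)

lemma linear_functional_eq_dot:
  fixes g :: "'k::field ^ 'n::finite \<Rightarrow> 'k"
  assumes "Vector_Spaces.linear (*s) (*) g"
  shows "g x = dot (\<chi> i. g (axis i 1)) x"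
proof -
  interpret g: Vector_Spaces.linear "(*s)" "(*)" g by fact
  have "x = (\<Sum>i\<in>UNIV. x $ i *s axis i 1)"
    by (simp add: basis_expansion)
  hence "g x = g (\<Sum>i\<in>UNIV. x $ i *s axis i 1)"
    by simp
  also have "\<dots> = (\<Sum>i\<in>UNIV. x $ i * g (axis i 1))"
    by (simp add: g.sum g.scale)
  finally show ?thesis
    by (simp add: dot_def mult.commute)
qed

lemma hyperplane_eq_kernel:
  fixes H :: "('k::field ^ 'n::finite) set"
  assumes "hyperplane H"
  shows "\<exists>\<alpha>. \<alpha> \<noteq> 0 \<and> H = {x. dot \<alpha> x = 0}"
proof -
  have H: "vec.subspace H" "vec.dim H + 1 = CARD('n)"
    using assms by (auto simp: hyperplane_def)
  obtain B where B: "B \<subseteq> H" "vec.independent B" "H \<subseteq> vec.span B" "card B = vec.dim H"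
    using vec.basis_exists by blast
  have spanB: "vec.span B = H"
    using B H by (metis vec.span_eq_iff vec.span_mono subset_antisym)
  obtain C where C: "B \<subseteq> C" "vec.independent C" "UNIV \<subseteq> vec.span C"
    using vec.maximal_independent_subset_extend[of B UNIV] B by auto
  have "card C = CARD('n)"
    using C vec.dim_eq_card[of C UNIV]
    by (simp add: vec.dim_UNIV card_cart_basis top.extremum_uniqueI)
  moreover have fin: "finite C"
    using C vec.finiteI_independent by blast
  ultimately have "card (C - B) = 1"
    using C B H by (subst card_Diff_subset) (auto intro: finite_subset)
  then obtain w where w: "C - B = {w}"
    by (auto simp: card_1_singleton_iff)
  hence Cw: "C = insert w B" "w \<notin> B"
    using C by auto
  interpret pr: vector_space_pair "(*s) :: 'k \<Rightarrow> 'k ^ 'n \<Rightarrow> 'k ^ 'n" "(*) :: 'k \<Rightarrow> 'k \<Rightarrow> 'k"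
    by unfold_locales
  define g where "g = pr.construct C (\<lambda>b. if b = w then 1 else 0)"
  have lin: "Vector_Spaces.linear (*s) (*) g"
    unfolding g_def by (rule pr.linear_construct) (rule C)
  interpret g: Vector_Spaces.linear "(*s)" "(*)" g by (rule lin)
  have gC: "g b = (if b = w then 1 else 0)" if "b \<in> C" for b
    unfolding g_def using that by (rule pr.construct_basis[OF C(2)])
  have g0: "g x = 0" if "x \<in> H" for x
  proof -
    have "x \<in> vec.span B"
      using that spanB by simp
    thus ?thesis
      by (induction rule: vec.span_induct_alt) (use Cw gC in \<open>auto simp: g.add g.scale g.zero\<close>)
  qed
  have "x \<in> H" if "g x = 0" for x
  proof -
    have "x \<in> vec.span (insert w B)"
      using C Cw by auto
    then obtain k where k: "x - k *s w \<in> H"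
      using spanB by (auto simp: vec.span_insert)
    have "g (x - k *s w) = - k"
      using that gC[of w] Cw by (simp add: g.diff g.scale)
    hence "k = 0"
      using g0[OF k] by simp
    thus ?thesis using k by simp
  qed
  hence Hg: "H = {x. g x = 0}"
    using g0 by auto
  define \<alpha> where "\<alpha> = (\<chi> i. g (axis i 1))"
  have g\<alpha>: "g x = dot \<alpha> x" for x
    unfolding \<alpha>_def by (rule linear_functional_eq_dot[OF lin])
  have "\<alpha> \<noteq> 0"
    using gC[of w] Cw g\<alpha>[of w] by (auto simp: dot_def)
  thus ?thesis
    using Hg g\<alpha> by auto
qed

text \<open>If \<open>dot \<alpha> e = 1\<close>, every point is
  \<open>\<pi> x + dot \<alpha> x *s e\<close> with \<open>\<pi> x\<close> on the hyperplane. In the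
  expansion in powers of \<open>dot \<alpha> x\<close> the constant term \<open>f (\<pi> x)\<close>
  vanishes and one factor comes out.\<close>

lemma polyfun_factor_linear:
  fixes f :: "'k::alg_closed_field ^ 'n::finite \<Rightarrow> 'k"
  assumes f: "polyfun f" and "\<alpha> \<noteq> 0" and van: "\<And>x. dot \<alpha> x = 0 \<Longrightarrow> f x = 0"
  shows "\<exists>g. polyfun g \<and> (\<forall>x. f x = dot \<alpha> x * g x)"
proof -
  obtain e where e: "dot \<alpha> e = 1"
    using ex_dot_eq_1 assms by blast
  define \<pi> where "\<pi> x = x - dot \<alpha> x *s e" for x
  have pf\<pi>: "polyfun (\<lambda>x. \<pi> x $ i)" for i
    unfolding \<pi>_def using polyfun_dot[of "\<lambda>x. x" \<alpha>] by (auto intro!: polyfun_intros)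
  obtain d where d: "\<And>x. degree (line_poly f x e) \<le> d"
    using degree_line_poly_bounded[OF f] by auto
  define g where "g x = (\<Sum>j<d. dot \<alpha> x ^ j * coeff (line_poly f (\<pi> x) e) (Suc j))" for x
  have "f x = dot \<alpha> x * g x" for x
  proof -
    have "f x = poly (line_poly f (\<pi> x) e) (dot \<alpha> x)"
      by (simp add: poly_line_poly f \<pi>_def)
    also have "\<dots> = (\<Sum>j\<le>d. coeff (line_poly f (\<pi> x) e) j * dot \<alpha> x ^ j)"
      unfolding poly_altdef using d by (intro sum.mono_neutral_left) (auto simp: coeff_eq_0)
    also have "\<dots> = coeff (line_poly f (\<pi> x) e) 0 + dot \<alpha> x * g x"
      by (subst sum.atMost_shift) (simp add: g_def sum_distrib_left algebra_simps)
    also have "coeff (line_poly f (\<pi> x) e) 0 = 0"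
      using e by (simp add: coeff_0_line_poly f van \<pi>_def dot_diff dot_scale)
    finally show ?thesis by simp
  qed
  moreover have "polyfun g"
    unfolding g_def
    by (intro polyfun_intros polyfun_dot polyfun_compose[OF polyfun_coeff_line_poly(1)[OF f]] pf\<pi>)
  ultimately show ?thesis by blast
qed

lemma polyfun_vfield: "polyfun (\<lambda>x. vfield \<theta> x $ i)"
  by (simp add: vfield_def polyfun_mp_eval)

lemma mp_eval_derivation_linform:
  fixes \<theta> :: "('n::finite, 'k::alg_closed_field) mpoly \<Rightarrow> ('n, 'k) mpoly"
  assumes "\<theta> \<in> derivations"
  shows "mp_eval x (\<theta> (linform \<alpha>)) = dot \<alpha> (vfield \<theta> x)"
  using assms by (simp add: linform_def derivations_sum derivations_Const_mult dot_def vfield_def)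

text \<open>The ideal of a hyperplane is generated by its equation
  (\<open>polyfun_factor_linear\<close>), so by the product rule only the value of \<theta> on that
  linear form matters.\<close>

lemma log_derivations_iff:
  fixes A :: "('k::alg_closed_field ^ 'n::finite) set set"
  assumes A: "hyperplane_arrangement A"
  shows "\<theta> \<in> log_derivations A \<longleftrightarrow> \<theta> \<in> derivations \<and> (\<forall>H\<in>A. \<forall>x\<in>H. vfield \<theta> x \<in> H)"
proof (intro iffI conjI ballI)
  assume "\<theta> \<in> log_derivations A"
  thus th: "\<theta> \<in> derivations"
    by (simp add: log_derivations_def)
  fix H x assume H: "H \<in> A" "x \<in> H"
  obtain \<alpha> where \<alpha>: "\<alpha> \<noteq> 0" "H = {x. dot \<alpha> x = 0}"
    using A H hyperplane_eq_kernel by (auto simp: hyperplane_arrangement_def)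
  have "linform \<alpha> \<in> vanishing_ideal H"
    by (simp add: vanishing_ideal_def \<alpha>)
  hence "\<theta> (linform \<alpha>) \<in> vanishing_ideal H"
    using \<open>\<theta> \<in> log_derivations A\<close> H by (auto simp: log_derivations_def)
  thus "vfield \<theta> x \<in> H"
    using H(2) th by (simp add: vanishing_ideal_def \<alpha> mp_eval_derivation_linform)
next
  assume *: "\<theta> \<in> derivations \<and> (\<forall>H\<in>A. \<forall>x\<in>H. vfield \<theta> x \<in> H)"
  have "\<theta> p \<in> vanishing_ideal H" if H: "H \<in> A" and p: "p \<in> vanishing_ideal H" for H p
  proof -
    obtain \<alpha> where \<alpha>: "\<alpha> \<noteq> 0" "H = {x. dot \<alpha> x = 0}"
      using A H hyperplane_eq_kernel by (auto simp: hyperplane_arrangement_def)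
    obtain g where g: "polyfun g" "\<And>x. mp_eval x p = dot \<alpha> x * g x"
      using polyfun_factor_linear[OF polyfun_mp_eval \<alpha>(1), of p] p by (auto simp: vanishing_ideal_def \<alpha>(2))
    obtain q where q: "\<And>x. mp_eval x q = g x"
      using polyfun_imp_mp_eval[OF g(1)] by auto
    have "p = linform \<alpha> * q"
      by (rule mp_eval_inject) (simp add: g q)
    hence "\<theta> p = linform \<alpha> * \<theta> q + q * \<theta> (linform \<alpha>)"
      using * by (simp add: derivations_mult)
    thus ?thesis
      using * H unfolding vanishing_ideal_def \<alpha>(2) by (auto simp: mp_eval_derivation_linform)
  qed
  thus "\<theta> \<in> log_derivations A"
    using * by (auto simp: log_derivations_def)
qed

lemma vfield_der_of: "vfield (der_of X) x = (\<chi> i. mp_eval x (X i))"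
  by (simp add: vfield_def)

lemma vfield_euler: "vfield euler x = x"
  by (simp add: euler_eq_der_of vfield_der_of vec_eq_iff)

lemma vfield_add: "vfield (\<theta> + \<theta>') x = vfield \<theta> x + vfield \<theta>' x"
  and vfield_diff: "vfield (\<theta> - \<theta>') x = vfield \<theta> x - vfield \<theta>' x"
  and vfield_0: "vfield 0 x = 0"
  and vfield_pscale: "vfield (pscale p \<theta>) x = mp_eval x p *s vfield \<theta> x"
  by (simp_all add: vfield_def vec_eq_iff pscale_def)

lemma vfield_inject:
  fixes \<theta> \<theta>' :: "('n::finite, 'k::alg_closed_field) mpoly \<Rightarrow> ('n, 'k) mpoly"
  assumes "\<theta> \<in> derivations" "\<theta>' \<in> derivations" "\<And>x. vfield \<theta> x = vfield \<theta>' x"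
  shows "\<theta> = \<theta>'"
  using assms by (intro derivations_eqI mp_eval_inject) (auto simp: vfield_def vec_eq_iff)

lemma polyfun_imp_vfield:
  fixes X :: "'k::alg_closed_field ^ 'n::finite \<Rightarrow> 'k ^ 'n"
  assumes "\<And>i. polyfun (\<lambda>x. X x $ i)"
  shows "\<exists>\<theta>\<in>derivations. vfield \<theta> = X"
proof -
  have "\<exists>P. \<forall>i v. mp_eval v (P i) = X v $ i"
    using polyfun_imp_mp_eval[OF assms] by metis
  then obtain P where "\<And>i v. mp_eval v (P i) = X v $ i"
    by blast
  hence "vfield (der_of P) = X"
    by (auto simp: vfield_der_of vec_eq_iff)
  thus ?thesis
    using der_of_derivation by blast
qed

lemma derivations_subspace: "pmod.subspace derivations"
  by (auto simp: pmod.subspace_def derivations_def pscale_def algebra_simps)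

lemma log_derivations_subspace:
  fixes A :: "('k::field ^ 'n::finite) set set"
  shows "pmod.subspace (log_derivations A)"
proof -
  have I: "0 \<in> vanishing_ideal H" "p \<in> vanishing_ideal H \<Longrightarrow> q \<in> vanishing_ideal H \<Longrightarrow> p + q \<in> vanishing_ideal H"
    "p \<in> vanishing_ideal H \<Longrightarrow> r * p \<in> vanishing_ideal H"
    for H :: "('k ^ 'n) set" and p q r
    by (auto simp: vanishing_ideal_def)
  show ?thesis
    using derivations_subspace unfolding pmod.subspace_def log_derivations_def
    by (auto simp: pscale_def image_subset_iff intro!: I)
qed

lemma euler_log_derivation:
  fixes A :: "('k::alg_closed_field ^ 'n::finite) set set"
  shows "hyperplane_arrangement A \<Longrightarrow> euler \<in> log_derivations A"
  by (simp add: log_derivations_iff vfield_euler) (simp add: euler_eq_der_of der_of_derivation)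

section \<open>Degrees in a fixed direction\<close>

text \<open>The bound is strict so that the bound 0 means that \<open>f\<close> vanishes
  (\<open>edeg_less_0\<close>); arguments by minimal degree then include the zero function, whose
  \<open>degree\<close> is 0 by convention.\<close>

definition edeg_less :: "'k::alg_closed_field ^ 'n::finite \<Rightarrow> ('k ^ 'n \<Rightarrow> 'k) \<Rightarrow> nat \<Rightarrow> bool" where
  "edeg_less e f m \<longleftrightarrow> (\<forall>x. \<forall>j\<ge>m. coeff (line_poly f x e) j = 0)"

lemma edeg_less_degree: "edeg_less e f (Suc m) \<longleftrightarrow> (\<forall>x. degree (line_poly f x e) \<le> m)"
proof
  assume "edeg_less e f (Suc m)"
  thus "\<forall>x. degree (line_poly f x e) \<le> m"
    by (auto simp: edeg_less_def intro!: degree_le)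
next
  assume *: "\<forall>x. degree (line_poly f x e) \<le> m"
  show "edeg_less e f (Suc m)"
    unfolding edeg_less_def
  proof (intro allI impI)
    fix x j assume "Suc m \<le> j"
    hence "degree (line_poly f x e) < j"
      using *[rule_format, of x] by simp
    thus "coeff (line_poly f x e) j = 0"
      by (rule coeff_eq_0)
  qed
qed

lemma edeg_less_mono: "edeg_less e f m \<Longrightarrow> m \<le> k \<Longrightarrow> edeg_less e f k"
  by (auto simp: edeg_less_def)

lemma edeg_less_0: "polyfun f \<Longrightarrow> edeg_less e f 0 \<Longrightarrow> f x = 0"
  using coeff_0_line_poly[of f x e] by (simp add: edeg_less_def)

lemma ex_edeg_less: "polyfun f \<Longrightarrow> \<exists>m. edeg_less e f (Suc m)"
  using degree_line_poly_bounded[of f] by (auto simp: edeg_less_degree)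

text \<open>Moving the base point along \<open>e\<close> substitutes \<open>s + t\<close> for
  \<open>s\<close>, which leaves the coefficient in the top degree unchanged. Leading coefficients
  are thus constant along \<open>e\<close> and act as scalars in division.\<close>

lemma coeff_line_poly_translate:
  assumes "polyfun f" "edeg_less e f (Suc m)"
  shows "coeff (line_poly f (x + t *s e) e) m = coeff (line_poly f x e) m"
proof -
  let ?P = "line_poly f x e"
  have deg: "degree ?P \<le> m"
    using assms(2) by (simp add: edeg_less_degree)
  have *: "line_poly f (x + t *s e) e = pcompose ?P [:t, 1:]"
    by (rule line_poly_translate[OF assms(1)])
  have d: "degree (pcompose ?P [:t, 1:]) = degree ?P"
    by (simp add: degree_pcompose)
  show ?thesis
  proof (cases "degree ?P = m")
    case True
    have "lead_coeff (pcompose ?P [:t, 1:]) = lead_coeff ?P"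
      by (subst lead_coeff_comp) auto
    thus ?thesis using * d True by simp
  next
    case False
    thus ?thesis using * d deg by (simp add: coeff_eq_0)
  qed
qed

lemma coeff_mult_top:
  fixes P Q :: "'a::comm_semiring_0 poly"
  assumes "degree P \<le> r" "degree Q \<le> m"
  shows "coeff (P * Q) (r + m) = coeff P r * coeff Q m"
proof -
  have "coeff P i * coeff Q (r + m - i) = 0" if "i \<le> r + m" "i \<noteq> r" for i
  proof (cases "i < r")
    case True
    hence "coeff Q (r + m - i) = 0" using assms by (intro coeff_eq_0) simp
    thus ?thesis by simp
  next
    case False
    hence "coeff P i = 0" using that assms by (intro coeff_eq_0) simp
    thus ?thesis by simp
  qed
  hence "coeff (P * Q) (r + m) = (\<Sum>i\<in>{r}. coeff P i * coeff Q (r + m - i))"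
    unfolding coeff_mult by (intro sum.mono_neutral_right) auto
  thus ?thesis by simp
qed

text \<open>Division with remainder by \<open>g\<close> in the variable of direction
  \<open>e\<close>, a role played by \<open>l\<close>. The leading coefficient \<open>b\<close> need
  not be invertible, so \<open>f\<close> is multiplied by \<open>b\<close> whenever a top term is
  removed.\<close>

lemma pseudo_division:
  fixes f g l :: "'k::alg_closed_field ^ 'n::finite \<Rightarrow> 'k"
  assumes f: "polyfun f" and g: "polyfun g" and gm: "edeg_less e g (Suc m)"
    and l: "polyfun l" "\<And>x t. l (x + t *s e) = l x + t"
  defines "b \<equiv> \<lambda>x. coeff (line_poly g x e) m"
  shows "\<exists>k q. polyfun q \<and> edeg_less e (\<lambda>x. b x ^ k * f x - q x * g x) m"
proof -
  have b: "polyfun b"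
    unfolding b_def by (rule polyfun_coeff_line_poly[OF g])
  have b_inv: "b (x + t *s e) = b x" for x t
    unfolding b_def by (rule coeff_line_poly_translate[OF g gm])
  have l_line: "line_poly l x e = [:l x, 1:]" for x
    by (rule line_poly_unique) (simp add: l)
  obtain p where "edeg_less e f p"
    using ex_edeg_less[OF f] by blast
  with f show ?thesis
  proof (induction p arbitrary: f)
    case 0
    thus ?case
      by (intro exI[of _ 0] exI[of _ "\<lambda>_. 0"]) (auto intro: polyfun_const edeg_less_mono)
  next
    case (Suc p)
    show ?case
    proof (cases "Suc p \<le> m")
      case True
      thus ?thesis using Suc.prems
        by (intro exI[of _ 0] exI[of _ "\<lambda>_. 0"]) (auto intro: polyfun_const edeg_less_mono)
    next
      case False
      hence pm: "m \<le> p" by simp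
      define \<beta> where "\<beta> x = coeff (line_poly f x e) p" for x
      have \<beta>: "polyfun \<beta>"
        unfolding \<beta>_def by (rule polyfun_coeff_line_poly[OF Suc.prems(1)])
      have \<beta>_inv: "\<beta> (x + t *s e) = \<beta> x" for x t
        unfolding \<beta>_def by (rule coeff_line_poly_translate[OF Suc.prems])
      define u where "u x = \<beta> x * l x ^ (p - m)" for x
      have u: "polyfun u"
        unfolding u_def by (intro polyfun_intros \<beta> l)
      define f' where "f' x = b x * f x - u x * g x" for x
      have f': "polyfun f'"
        unfolding f'_def by (intro polyfun_intros b u g Suc.prems)
      have "edeg_less e f' p"
        unfolding edeg_less_def
      proof (intro allI impI)
        fix x j assume j: "p \<le> j"
        define R where "R = [:l x, 1:] ^ (p - m) * line_poly g x e"
        have deg: "degree ([:l x, 1:] ^ (p - m)) = p - m" "degree (line_poly g x e) \<le> m"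
          using gm by (simp_all add: degree_linear_power edeg_less_degree)
        have degR: "degree R \<le> p"
          unfolding R_def using deg pm by (intro order.trans[OF degree_mult_le]) simp
        have topR: "coeff R p = b x"
          using coeff_mult_top[of "[:l x, 1:] ^ (p - m)" "p - m" "line_poly g x e" m] deg pm
          by (simp add: R_def b_def coeff_linear_power)
        have line: "line_poly f' x e = smult (b x) (line_poly f x e) - smult (\<beta> x) R"
          unfolding f'_def u_def R_def
          using Suc.prems(1) b \<beta> l g
          by (simp add: line_poly_diff line_poly_mult line_poly_power line_poly_invariant b_inv \<beta>_inv
              l_line polyfun_intros)
        show "coeff (line_poly f' x e) j = 0"
        proof (cases "j = p")
          case True
          thus ?thesis by (simp add: line topR \<beta>_def)
        next
          case False
          hence "coeff (line_poly f x e) j = 0" "coeff R j = 0"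
            using j Suc.prems(2) degR by (auto simp: edeg_less_def intro: coeff_eq_0)
          thus ?thesis by (simp add: line)
        qed
      qed
      from Suc.IH[OF f' this] obtain k q where kq:
        "polyfun q" "edeg_less e (\<lambda>x. b x ^ k * f' x - q x * g x) m"
        by blast
      have "(\<lambda>x. b x ^ k * f' x - q x * g x) = (\<lambda>x. b x ^ Suc k * f x - (q x + b x ^ k * u x) * g x)"
        by (auto simp: f'_def algebra_simps)
      moreover have "polyfun (\<lambda>x. q x + b x ^ k * u x)"
        by (intro polyfun_intros kq b u)
      ultimately show ?thesis
        using kq by (intro exI[of _ "Suc k"] exI[of _ "\<lambda>x. q x + b x ^ k * u x"]) auto
    qed
  qed
qed

text \<open>Since \<open>x + s *s e = s *s (e + inverse s *s x)\<close>, the polynomial from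
  \<open>x\<close> along \<open>e\<close> is, up to powers of \<open>s\<close>, the reversal of the
  one from \<open>e\<close> along \<open>x\<close>; its coefficient in degree \<open>d\<close> is
  the constant term of the latter.\<close>

lemma line_poly_homogeneous:
  fixes f :: "'k::alg_closed_field ^ 'n::finite \<Rightarrow> 'k"
  assumes f: "polyfun f" and hom: "\<And>c x. f (c *s x) = c ^ d * f x"
  shows "degree (line_poly f x e) \<le> d" "coeff (line_poly f x e) d = f e"
proof -
  let ?P = "line_poly f x e" and ?Q = "line_poly f e x"
  have eq: "monom 1 (degree ?Q) * ?P = monom 1 d * reflect_poly ?Q"
  proof (rule poly_eqI_cofinite[of "{0}"])
    fix s :: 'k assume "s \<notin> {0}"
    hence s: "s \<noteq> 0" by simp
    have "x + s *s e = s *s (e + inverse s *s x)"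
      using s by (simp add: vec_eq_iff algebra_simps)
    hence "poly ?P s = s ^ d * poly ?Q (inverse s)"
      by (simp add: poly_line_poly f hom)
    thus "poly (monom 1 (degree ?Q) * ?P) s = poly (monom 1 d * reflect_poly ?Q) s"
      using s by (simp add: poly_monom poly_reflect_poly_nz)
  qed simp
  show "coeff ?P d = f e"
  proof -
    have "coeff (monom 1 (degree ?Q) * ?P) (degree ?Q + d) = coeff ?P d"
      by (simp add: coeff_monom_mult)
    moreover have "coeff (monom 1 d * reflect_poly ?Q) (degree ?Q + d) = coeff ?Q 0"
      by (simp add: coeff_monom_mult coeff_reflect_poly)
    ultimately show ?thesis
      using f by (simp add: eq coeff_0_line_poly)
  qed
  show "degree ?P \<le> d"
  proof (rule degree_le, intro allI impI)
    fix i assume "d < i"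
    have "coeff ?P i = coeff (monom 1 (degree ?Q) * ?P) (degree ?Q + i)"
      by (simp add: coeff_monom_mult)
    also have "\<dots> = 0"
      using \<open>d < i\<close> by (simp add: eq coeff_monom_mult coeff_reflect_poly)
    finally show "coeff ?P i = 0" .
  qed
qed

section \<open>Gauss's lemma on planes\<close>

lemma prime_elem_linear: "prime_elem ([:- t, 1:] :: 'k::field poly)"
  by (rule prime_elemI) (auto simp: is_unit_iff_degree simp flip: poly_eq_0_iff_dvd)

text \<open>Gauss's lemma, by peeling off the roots of \<open>B\<close>: the linear polynomial of a
  root is prime in \<open>k[y][s]\<close>, so it divides \<open>q\<close>, or else every
  \<open>X i\<close> with all its coefficients, and can be cancelled. Once \<open>B\<close> is
  constant, the leading coefficient of \<open>X i1\<close> divides a nonzero constant and is a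
  unit.\<close>

lemma lead_coeff_dvd_of_factor:
  fixes B :: "'k::alg_closed_field poly" and \<Psi> X :: "'i \<Rightarrow> 'k poly poly"
  assumes "B \<noteq> 0" "\<And>i. smult B (\<Psi> i) = q * X i" "lead_coeff (\<Psi> i1) = [:\<kappa>:]" "\<kappa> \<noteq> 0"
  shows "lead_coeff (X i1) dvd coeff (X i) j"
  using assms(1,2)
proof (induction "degree B" arbitrary: B q X i j rule: less_induct)
  case less
  have lc: "lead_coeff q * lead_coeff (X i1) = B * [:\<kappa>:]"
    using less.prems(2)[of i1] by (metis assms(3) lead_coeff_mult lead_coeff_smult)
  show ?case
  proof (cases "degree B = 0")
    case True
    then obtain c where c: "B = [:c:]" "c \<noteq> 0"
      using less.prems(1) degree_eq_zeroE by (metis pCons_0_0)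
    have "is_unit (B * [:\<kappa>:])"
      using c assms(4) by (simp add: is_unit_iff_degree)
    hence "is_unit (lead_coeff (X i1))"
      unfolding lc[symmetric] by (simp add: is_unit_mult_iff)
    thus ?thesis by (rule unit_imp_dvd)
  next
    case False
    then obtain t where "poly B t = 0"
      using alg_closed_imp_poly_has_root[of B] by auto
    then obtain B' where B': "B = [:- t, 1:] * B'"
      by (metis dvdE poly_eq_0_iff_dvd)
    have B'0: "B' \<noteq> 0"
      using less.prems(1) B' by auto
    have degB': "degree B' < degree B"
      using B'0 unfolding B' by (subst degree_mult_eq) auto
    define \<pi> where "\<pi> = [:[:- t, 1:]:]"
    have \<pi>0: "\<pi> \<noteq> 0"
      by (simp add: \<pi>_def)
    have \<pi>: "prime_elem \<pi>"
      unfolding \<pi>_def by (intro lift_prime_elem_poly prime_elem_linear)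
    have smB: "smult B (\<Psi> i) = \<pi> * smult B' (\<Psi> i)" for i
      by (simp add: B' \<pi>_def)
    have dvd: "\<pi> dvd q * X i" for i
      using less.prems(2)[of i] smB[of i] by (metis dvd_triv_left)
    show ?thesis
    proof (cases "\<pi> dvd q")
      case True
      then obtain q' where q': "q = \<pi> * q'" ..
      have "smult B' (\<Psi> i) = q' * X i" for i
      proof -
        have "\<pi> * smult B' (\<Psi> i) = \<pi> * (q' * X i)"
          using less.prems(2)[of i] smB[of i] by (simp add: q' mult.assoc)
        thus ?thesis by (rule mult_left_cancel[OF \<pi>0, THEN iffD1])
      qed
      thus ?thesis
        using less.hyps[OF degB' B'0] by blast
    next
      case False
      hence "\<pi> dvd X i" for i
        using dvd[of i] \<pi> by (simp add: prime_elem_dvd_mult_iff)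
      then obtain X' where X': "\<And>i. X i = \<pi> * X' i"
        unfolding dvd_def by metis
      have "smult B' (\<Psi> i) = q * X' i" for i
      proof -
        have "\<pi> * smult B' (\<Psi> i) = \<pi> * (q * X' i)"
          using less.prems(2)[of i] smB[of i] by (simp add: X' mult_ac)
        thus ?thesis by (rule mult_left_cancel[OF \<pi>0, THEN iffD1])
      qed
      hence "lead_coeff (X' i1) dvd coeff (X' i) j"
        using less.hyps[OF degB' B'0] by blast
      moreover have X'': "X i = smult [:- t, 1:] (X' i)" for i
        by (simp add: X' \<pi>_def)
      ultimately show ?thesis
        unfolding X'' coeff_smult lead_coeff_smult by (intro mult_dvd_mono) auto
    qed
  qed
qed

text \<open>This is \<open>f\<close> on the plane \<open>z + y *s w + s *s e\<close>, with
  \<open>s\<close> as outer and \<open>y\<close> as inner variable, so that leading coefficients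
  along \<open>e\<close> become elements of \<open>k[y]\<close>.\<close>

definition plane_poly ::
  "('k::alg_closed_field ^ 'n::finite \<Rightarrow> 'k) \<Rightarrow> 'k ^ 'n \<Rightarrow> 'k ^ 'n \<Rightarrow> 'k ^ 'n \<Rightarrow> 'k poly poly" where
  "plane_poly f z w e = Abs_poly (\<lambda>j. line_poly (\<lambda>x. coeff (line_poly f x e) j) z w)"

lemma coeff_plane_poly:
  assumes "polyfun f"
  shows "coeff (plane_poly f z w e) j = line_poly (\<lambda>x. coeff (line_poly f x e) j) z w"
proof -
  obtain d where d: "\<And>x e. degree (line_poly f x e) \<le> d"
    using degree_line_poly_bounded[OF assms] by blast
  have "line_poly (\<lambda>x. coeff (line_poly f x e) j) z w = 0" if "j > d" for j
  proof -
    have "coeff (line_poly f x e) j = 0" for x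
      using d[of x e] that by (intro coeff_eq_0) simp
    hence "(\<lambda>x. coeff (line_poly f x e) j) = (\<lambda>x. 0)"
      by auto
    thus ?thesis by (simp add: line_poly_const)
  qed
  hence "\<forall>\<^sub>\<infinity>j. line_poly (\<lambda>x. coeff (line_poly f x e) j) z w = 0"
    unfolding MOST_nat by blast
  thus ?thesis
    by (simp add: plane_poly_def Abs_poly_inverse)
qed

lemma line_poly_sum:
  "(\<And>i. i \<in> I \<Longrightarrow> polyfun (f i)) \<Longrightarrow> line_poly (\<lambda>x. \<Sum>i\<in>I. f i x) z w = (\<Sum>i\<in>I. line_poly (f i) z w)"
  by (rule line_poly_unique) (simp add: poly_sum poly_line_poly)

lemma plane_poly_mult:
  assumes "polyfun f" "polyfun g"
  shows "plane_poly (\<lambda>x. f x * g x) z w e = plane_poly f z w e * plane_poly g z w e"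
proof (rule poly_eqI)
  fix j
  have "coeff (plane_poly (\<lambda>x. f x * g x) z w e) j =
      line_poly (\<lambda>x. \<Sum>i\<le>j. coeff (line_poly f x e) i * coeff (line_poly g x e) (j - i)) z w"
    using assms by (simp add: coeff_plane_poly polyfun_mult line_poly_mult coeff_mult)
  also have "\<dots> = (\<Sum>i\<le>j. line_poly (\<lambda>x. coeff (line_poly f x e) i) z w *
                         line_poly (\<lambda>x. coeff (line_poly g x e) (j - i)) z w)"
    using assms by (simp add: line_poly_sum line_poly_mult polyfun_mult polyfun_coeff_line_poly)
  finally show "coeff (plane_poly (\<lambda>x. f x * g x) z w e) j = coeff (plane_poly f z w e * plane_poly g z w e) j"
    using assms by (simp add: coeff_plane_poly coeff_mult)
qed

lemma plane_poly_invariant: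
  assumes "polyfun b" "\<And>x s. b (x + s *s e) = b x"
  shows "plane_poly b z w e = [:line_poly b z w:]"
proof (rule poly_eqI)
  fix j
  have "line_poly b x e = [:b x:]" for x
    by (rule line_poly_invariant) (rule assms)
  thus "coeff (plane_poly b z w e) j = coeff [:line_poly b z w:] j"
    using assms(1) by (cases j) (simp_all add: coeff_plane_poly line_poly_const)
qed

text \<open>The direction \<open>e\<close> is chosen so that \<open>\<theta> i1\<close> is monic in it up to a constant, which is what
  allows the leading coefficient \<open>b\<close> of \<open>X i1\<close> to be cancelled.\<close>

lemma lead_coeff_divides:
  fixes \<theta> X :: "'i \<Rightarrow> 'k::alg_closed_field ^ 'n::finite \<Rightarrow> 'k"
  assumes \<theta>: "\<And>i. polyfun (\<theta> i)" and X: "\<And>i. polyfun (X i)" and q: "polyfun q"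
    and Xm: "edeg_less e (X i1) (Suc m)"
    and th: "edeg_less e (\<theta> i1) (Suc d)" "\<And>x. coeff (line_poly (\<theta> i1) x e) d = \<kappa>" "\<kappa> \<noteq> 0"
  defines "b \<equiv> \<lambda>x. coeff (line_poly (X i1) x e) m"
  assumes eq: "\<And>i x. b x ^ k * \<theta> i x = q x * X i x" and nz: "b z \<noteq> 0"
  shows "\<exists>c. polyfun c \<and> (\<forall>x. X i x = b x * c x)"
proof (rule polyfun_dvd_lines[of "X i" b z])
  show "polyfun (X i)" and "b z \<noteq> 0"
    by (fact X, fact nz)
  show b: "polyfun b"
    unfolding b_def by (rule polyfun_coeff_line_poly[OF X])
  have b_inv: "b (x + t *s e) = b x" for x t
    unfolding b_def by (rule coeff_line_poly_translate[OF X Xm])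
  \<comment> \<open>By \<open>polyfun_dvd_lines\<close> it is enough to divide on the lines through
    \<open>z\<close>. Gauss's lemma is applied on the plane that \<open>e\<close> spans with such a
    line; the constant coefficient in \<open>s\<close> gives back \<open>X i\<close> on the
    line.\<close>
  fix w
  let ?pp = "\<lambda>f. plane_poly f z w e"
  define B where "B = line_poly b z w ^ k"
  have lb0: "line_poly b z w \<noteq> 0"
    using nz coeff_0_line_poly[OF b, of z w] by auto
  have "smult B (?pp (\<theta> i)) = ?pp q * ?pp (X i)" for i
  proof -
    have "?pp (\<lambda>x. b x ^ k * \<theta> i x) = ?pp (\<lambda>x. q x * X i x)"
      by (simp only: eq)
    moreover have "?pp (\<lambda>x. b x ^ k) = [:B:]"
      using b by (subst plane_poly_invariant) (simp_all add: polyfun_power b_inv B_def line_poly_power)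
    ultimately show ?thesis
      using b \<theta> q X by (simp add: plane_poly_mult polyfun_power)
  qed
  moreover have "lead_coeff (?pp (\<theta> i1)) = [:\<kappa>:]"
  proof -
    have c0: "coeff (?pp (\<theta> i1)) j = 0" if "d < j" for j
    proof -
      have "(\<lambda>x. coeff (line_poly (\<theta> i1) x e) j) = (\<lambda>x. 0)"
        using th(1) that by (auto simp: edeg_less_def)
      thus ?thesis
        using \<theta> by (simp add: coeff_plane_poly line_poly_const)
    qed
    have c: "coeff (?pp (\<theta> i1)) d = [:\<kappa>:]"
      using \<theta> by (simp add: coeff_plane_poly th(2) line_poly_const)
    have "degree (?pp (\<theta> i1)) \<le> d"
      using c0 by (intro degree_le) blast
    moreover have "degree (?pp (\<theta> i1)) \<ge> d"
      by (rule le_degree) (use c th(3) in auto)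
    ultimately show ?thesis
      using c by (metis le_antisym)
  qed
  ultimately have dvd: "lead_coeff (?pp (X i1)) dvd coeff (?pp (X i)) 0"
    using lead_coeff_dvd_of_factor[of B "\<lambda>i. ?pp (\<theta> i)" "?pp q" "\<lambda>i. ?pp (X i)" i1 \<kappa> i 0] lb0 th(3)
    by (simp add: B_def)
  have cX: "coeff (?pp (X i1)) m = line_poly b z w"
    by (simp add: coeff_plane_poly X b_def)
  have "degree (?pp (X i1)) \<le> m"
  proof (rule degree_le, intro allI impI)
    fix j assume "m < j"
    hence "(\<lambda>x. coeff (line_poly (X i1) x e) j) = (\<lambda>x. 0)"
      using Xm by (auto simp: edeg_less_def)
    thus "coeff (?pp (X i1)) j = 0"
      by (simp add: coeff_plane_poly X line_poly_const)
  qed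
  moreover have "degree (?pp (X i1)) \<ge> m"
    by (rule le_degree) (simp add: cX lb0)
  ultimately have "lead_coeff (?pp (X i1)) = line_poly b z w"
    using cX by (metis le_antisym)
  moreover have "coeff (?pp (X i)) 0 = line_poly (X i) z w"
    by (simp add: coeff_plane_poly X coeff_0_line_poly)
  ultimately show "line_poly b z w dvd line_poly (X i) z w"
    using dvd by simp
qed

text \<open>The witness \<open>h\<close> is a nonzero element of least degree in the direction \<open>e\<close> of the ideal
  generated by \<open>G\<close>.\<close>

lemma ex_ideal_min_degree:
  fixes G :: "('k::alg_closed_field ^ 'n::finite \<Rightarrow> 'k) set" and l :: "'k ^ 'n \<Rightarrow> 'k"
  assumes fin: "finite G" and G: "\<And>g. g \<in> G \<Longrightarrow> polyfun g" and nz: "g0 \<in> G" "g0 x0 \<noteq> 0"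
    and l: "polyfun l" "\<And>x t. l (x + t *s e) = l x + t"
  shows "\<exists>h m k. polyfun h \<and> (\<exists>x. coeff (line_poly h x e) m \<noteq> 0) \<and> edeg_less e h (Suc m) \<and>
    (\<forall>w. h w \<noteq> 0 \<longrightarrow> (\<exists>g\<in>G. g w \<noteq> 0)) \<and>
    (\<forall>g\<in>G. \<exists>q. polyfun q \<and> (\<forall>x. coeff (line_poly h x e) m ^ k * g x = q x * h x))"
proof -
  define I where "I = {h. \<exists>p. (\<forall>g\<in>G. polyfun (p g)) \<and> h = (\<lambda>x. \<Sum>g\<in>G. p g x * g x)}"
  have I_poly: "polyfun h" if "h \<in> I" for h
    using that G unfolding I_def by (auto intro!: polyfun_intros)
  have I_gen: "g \<in> I" if "g \<in> G" for g
    unfolding I_def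
  proof (rule CollectI, intro exI conjI ballI)
    show "g = (\<lambda>x. \<Sum>g'\<in>G. (if g' = g then 1 else 0) * g' x)"
      using that fin by (auto simp: if_distrib[of "\<lambda>c. c * _"] cong: if_cong)
    show "polyfun (\<lambda>x. if g' = g then 1 else 0)" for g' :: "'k ^ 'n \<Rightarrow> 'k"
      by (rule polyfun_const)
  qed
  have I_comb: "(\<lambda>x. u x * h x - v x * h' x) \<in> I"
    if h: "h \<in> I" "h' \<in> I" and uv: "polyfun u" "polyfun v" for u v h h'
  proof -
    obtain p p' where p: "\<forall>g\<in>G. polyfun (p g)" "h = (\<lambda>x. \<Sum>g\<in>G. p g x * g x)"
      "\<forall>g\<in>G. polyfun (p' g)" "h' = (\<lambda>x. \<Sum>g\<in>G. p' g x * g x)"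
      using h by (auto simp: I_def)
    have "(\<lambda>x. u x * h x - v x * h' x) = (\<lambda>x. \<Sum>g\<in>G. (u x * p g x - v x * p' g x) * g x)"
      by (simp add: p sum_distrib_left sum_subtractf algebra_simps)
    moreover have "\<forall>g\<in>G. polyfun (\<lambda>x. u x * p g x - v x * p' g x)"
      using p uv by (auto intro!: polyfun_intros)
    ultimately show ?thesis
      unfolding I_def by (intro CollectI exI[of _ "\<lambda>g x. u x * p g x - v x * p' g x"]) auto
  qed
  define Q where "Q m \<longleftrightarrow> (\<exists>h\<in>I. (\<exists>x. h x \<noteq> 0) \<and> edeg_less e h (Suc m))" for m
  define m where "m = (LEAST m. Q m)"
  have "\<exists>m. Q m"
    using ex_edeg_less[OF G[OF nz(1)], of e] I_gen[OF nz(1)] nz(2) unfolding Q_def by blast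
  hence "Q m"
    unfolding m_def by (rule LeastI_ex)
  then obtain h xh where h: "h \<in> I" "h xh \<noteq> 0" "edeg_less e h (Suc m)"
    by (auto simp: Q_def)
  have min: "f x = 0" if "f \<in> I" "edeg_less e f m" for f x
  proof (cases m)
    case 0
    thus ?thesis using that edeg_less_0 I_poly by metis
  next
    case (Suc m')
    hence "\<not> Q m'"
      using not_less_Least[of m' Q] by (simp add: m_def)
    thus ?thesis
      using that Suc by (auto simp: Q_def)
  qed
  define \<beta> where "\<beta> x = coeff (line_poly h x e) m" for x
  have \<beta>: "polyfun \<beta>"
    unfolding \<beta>_def by (rule polyfun_coeff_line_poly[OF I_poly[OF h(1)]])
  have \<beta>nz: "\<exists>x. \<beta> x \<noteq> 0"
  proof (rule ccontr)
    assume "\<not> ?thesis"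
    hence "edeg_less e h m"
      using h(3) unfolding edeg_less_def \<beta>_def by (metis Suc_leI le_neq_implies_less)
    thus False
      using min h by blast
  qed
  have "\<exists>k q. polyfun q \<and> (\<forall>x. \<beta> x ^ k * g x = q x * h x)" if g: "g \<in> G" for g
  proof -
    obtain k q where kq: "polyfun q" "edeg_less e (\<lambda>x. \<beta> x ^ k * g x - q x * h x) m"
      using pseudo_division[OF G[OF g] I_poly[OF h(1)] h(3) l] unfolding \<beta>_def by blast
    \<comment> \<open>The remainder stays in the ideal and has smaller degree than \<open>h\<close>,
      so it is zero.\<close>
    have "(\<lambda>x. \<beta> x ^ k * g x - q x * h x) \<in> I"
      by (intro I_comb I_gen g h polyfun_power \<beta> kq)
    from min[OF this kq(2)] show ?thesis
      using kq(1) by auto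
  qed
  then obtain K where K: "\<And>g. g \<in> G \<Longrightarrow> \<exists>q. polyfun q \<and> (\<forall>x. \<beta> x ^ K g * g x = q x * h x)"
    by metis
  define k where "k = (\<Sum>g\<in>G. K g)"
  have "\<exists>q. polyfun q \<and> (\<forall>x. \<beta> x ^ k * g x = q x * h x)" if g: "g \<in> G" for g
  proof -
    obtain q where q: "polyfun q" "\<And>x. \<beta> x ^ K g * g x = q x * h x"
      using K[OF g] by blast
    have "K g \<le> k"
      unfolding k_def using g fin by (intro member_le_sum) auto
    hence "\<beta> x ^ k * g x = (\<beta> x ^ (k - K g) * q x) * h x" for x
    proof -
      have "\<beta> x ^ k = \<beta> x ^ (k - K g) * \<beta> x ^ K g"
        using \<open>K g \<le> k\<close> by (simp flip: power_add)
      thus ?thesis using q(2)[of x] by (simp add: mult.assoc)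
    qed
    moreover have "polyfun (\<lambda>x. \<beta> x ^ (k - K g) * q x)"
      by (intro polyfun_intros \<beta> q)
    ultimately show ?thesis by blast
  qed
  hence dvd: "\<forall>g\<in>G. \<exists>q. polyfun q \<and> (\<forall>x. coeff (line_poly h x e) m ^ k * g x = q x * h x)"
    unfolding \<beta>_def by blast
  have gen: "\<forall>w. h w \<noteq> 0 \<longrightarrow> (\<exists>g\<in>G. g w \<noteq> 0)"
  proof (intro allI impI)
    fix w assume "h w \<noteq> 0"
    then obtain p where "(\<Sum>g\<in>G. p g w * g w) \<noteq> (0 :: 'k)"
      using h(1) unfolding I_def by auto
    then obtain g where "g \<in> G" "p g w * g w \<noteq> 0"
      by (rule sum.not_neutral_contains_not_neutral)
    thus "\<exists>g\<in>G. g w \<noteq> 0"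
      by auto
  qed
  show ?thesis
    by (rule exI[of _ h], rule exI[of _ m], rule exI[of _ k])
       (intro conjI I_poly[OF h(1)] \<beta>nz[unfolded \<beta>_def] h(3) gen dvd)
qed

section \<open>The primitive field parallel to a given one\<close>

definition polyvec :: "('k::comm_ring_1 ^ 'n::finite \<Rightarrow> 'k ^ 'n) \<Rightarrow> bool" where
  "polyvec X \<longleftrightarrow> (\<forall>i. polyfun (\<lambda>x. X x $ i))"

definition tangent :: "('k ^ 'n) set set \<Rightarrow> ('k ^ 'n \<Rightarrow> 'k ^ 'n) \<Rightarrow> bool" where
  "tangent A X \<longleftrightarrow> (\<forall>K\<in>A. \<forall>x\<in>K. X x \<in> K)"

text \<open>The field \<open>X\<close> is what remains of \<theta> when the zeros of codimension one
  are divided out, a zero being a point where the components and all quotients \<open>g\<close>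
  vanish. The remaining zeros satisfy \<open>h = 0\<close> and \<open>X x $ i0 = 0\<close>; the
  first polynomial is constant and the second monic along \<open>e\<close>, so they have codimension
  at least two.\<close>

lemma ex_primitive_parallel:
  fixes A :: "('k::alg_closed_field ^ 'n::finite) set set" and \<theta> :: "'k ^ 'n \<Rightarrow> 'k ^ 'n"
  assumes fin: "finite A" and al: "\<And>K. K \<in> A \<Longrightarrow> K = {x. dot (al K) x = 0}" and H: "H \<in> A"
    and \<theta>: "polyvec \<theta>" "tangent A \<theta>" "\<And>x. \<theta> x \<in> H" "\<And>c x. \<theta> (c *s x) = c ^ d *s \<theta> x"
    and e: "\<theta> e $ i0 \<noteq> 0" "\<And>K. K \<in> A \<Longrightarrow> e \<notin> K"
  shows "\<exists>X m h. polyvec X \<and> tangent A X \<and> (\<forall>x. X x \<in> H) \<and> (\<forall>c x. X (c *s x) = c ^ m *s X x) \<and>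
    m \<le> d \<and> (\<forall>x. \<theta> x $ i0 *s X x = X x $ i0 *s \<theta> x) \<and> X e $ i0 \<noteq> 0 \<and>
    polyfun h \<and> (\<exists>x. h x \<noteq> 0) \<and> (\<forall>x s. h (x + s *s e) = h x) \<and>
    (\<forall>w. h w \<noteq> 0 \<longrightarrow> X w \<noteq> 0 \<or>
       (\<exists>K\<in>A. \<exists>g. polyfun g \<and> (\<forall>x. dot (al K) (X x) = dot (al K) x * g x) \<and> g w \<noteq> 0))"
proof -

  \<comment> \<open>Tangent fields parallel to \<theta>\<close>
  have ale: "dot (al K) e \<noteq> 0" if "K \<in> A" for K
    using e(2)[OF that] al[OF that] by blast
  have memA: "x \<in> K \<longleftrightarrow> dot (al K) x = 0" if "K \<in> A" for x K
    using al[OF that] by blast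
  \<comment> \<open>The coordinate in the direction \<open>e\<close>: as \<open>e\<close> is not on
    \<open>H\<close>, the equation of \<open>H\<close> can be normalised to 1 at
    \<open>e\<close>.\<close>
  define l where "l x = dot (al H) x * inverse (dot (al H) e)" for x
  have l: "polyfun l" "l (x + t *s e) = l x + t" for x t
    using ale[OF H] polyfun_dot[of "\<lambda>x. x" "al H"]
    by (auto simp: l_def[abs_def] dot_add dot_scale algebra_simps intro!: polyfun_intros)

  \<comment> \<open>Parallelism is tested against the component \<open>i0\<close> of \<theta>, which
    is not identically zero, so that all conditions are linear over the polynomial functions.
    Homogeneity is not part of \<open>J\<close>; minimality restores it.\<close>
  define J where "J X \<longleftrightarrow> polyvec X \<and> tangent A X \<and> (\<forall>x. X x \<in> H) \<and>
    (\<forall>x. \<theta> x $ i0 *s X x = X x $ i0 *s \<theta> x)" for X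
  have J_comb: "J (\<lambda>x. u x *s X x - v x *s Y x)" if "J X" "J Y" "polyfun u" "polyfun v" for X Y u v
  proof -
    have "polyvec (\<lambda>x. u x *s X x - v x *s Y x)"
      using that by (auto simp: J_def polyvec_def intro!: polyfun_intros)
    moreover have "tangent A (\<lambda>x. u x *s X x - v x *s Y x)"
      using that by (auto simp: J_def tangent_def memA dot_diff dot_scale)
    moreover have "\<forall>x. u x *s X x - v x *s Y x \<in> H"
      using that H by (auto simp: J_def memA dot_diff dot_scale)
    moreover have "\<theta> x $ i0 *s (u x *s X x - v x *s Y x) = (u x *s X x - v x *s Y x) $ i0 *s \<theta> x" for x
    proof -
      have "\<theta> x $ i0 *s (u x *s X x - v x *s Y x) = u x *s (\<theta> x $ i0 *s X x) - v x *s (\<theta> x $ i0 *s Y x)"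
        by (simp add: vec_eq_iff algebra_simps)
      also have "\<dots> = u x *s (X x $ i0 *s \<theta> x) - v x *s (Y x $ i0 *s \<theta> x)"
        using that by (simp add: J_def)
      also have "\<dots> = (u x *s X x - v x *s Y x) $ i0 *s \<theta> x"
        by (simp add: vec_eq_iff algebra_simps)
      finally show ?thesis .
    qed
    ultimately show ?thesis
      by (simp add: J_def)
  qed
  have J_poly: "polyfun (\<lambda>x. X x $ i)" if "J X" for X i
    using that by (simp add: J_def polyvec_def)
  \<comment> \<open>A parallel field is determined by its component \<open>i0\<close>, so its degree
    along \<open>e\<close> can be measured on that component alone.\<close>
  have J_zero: "X x = 0" if J: "J X" and z: "\<And>x. X x $ i0 = 0" for X x
  proof -
    have "\<theta> x $ i0 * X x $ j = 0" for x j
    proof -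
      have "\<theta> x $ i0 *s X x = 0 *s \<theta> x"
        using J z by (simp add: J_def)
      thus ?thesis by (metis vector_smult_component mult_zero_left)
    qed
    hence "X x $ j = 0" for j
      using polyfun_mult_eq_0[of "\<lambda>x. \<theta> x $ i0" "\<lambda>x. X x $ j" e x] J_poly[OF J] \<theta>(1) e(1)
      by (simp add: polyvec_def)
    thus ?thesis by (simp add: vec_eq_iff)
  qed
  have J\<theta>: "J \<theta>"
    using \<theta> by (simp add: J_def)

  have hom\<theta>: "\<theta> (c *s x) $ i0 = c ^ d * \<theta> x $ i0" for c x
    by (simp add: \<theta>(4))
  \<comment> \<open>By homogeneity the coefficient of degree \<open>d\<close> along \<open>e\<close>
    is the constant \<open>\<theta> e $ i0\<close>, so the component \<open>i0\<close> of \<theta>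
    is monic up to a scalar.\<close>
  note th_line = line_poly_homogeneous[of "\<lambda>x. \<theta> x $ i0", OF J_poly[OF J\<theta>] hom\<theta>]
  have th_less: "edeg_less e (\<lambda>x. \<theta> x $ i0) (Suc d)"
    using th_line(1) by (simp add: edeg_less_degree)

  \<comment> \<open>A parallel field of least degree along \<open>e\<close>\<close>
  define Q where "Q m \<longleftrightarrow> (\<exists>X. J X \<and> (\<exists>x. X x \<noteq> 0) \<and> edeg_less e (\<lambda>x. X x $ i0) (Suc m))" for m
  define m where "m = (LEAST m. Q m)"
  have Qd: "Q d"
    using J\<theta> e(1) th_less unfolding Q_def by (metis zero_index)
  hence md: "m \<le> d"
    unfolding m_def by (rule Least_le)
  from Qd have "Q m"
    unfolding m_def by (rule LeastI)
  then obtain Y y0 where Y: "J Y" "Y y0 \<noteq> 0" "edeg_less e (\<lambda>x. Y x $ i0) (Suc m)"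
    by (auto simp: Q_def)
  have min: "X x = 0" if X: "J X" "edeg_less e (\<lambda>x. X x $ i0) m" for X x
  proof (cases m)
    case 0
    have "X x $ i0 = 0" for x
      using edeg_less_0[OF J_poly[OF X(1)]] X(2) 0 by blast
    thus ?thesis by (rule J_zero[OF X(1)])
  next
    case (Suc m')
    hence "\<not> Q m'"
      using not_less_Least[of m' Q] by (simp add: m_def)
    thus ?thesis
      using X Suc by (auto simp: Q_def)
  qed

  \<comment> \<open>Division by the leading coefficient\<close>
  define b where "b x = coeff (line_poly (\<lambda>x. Y x $ i0) x e) m" for x
  have b: "polyfun b"
    unfolding b_def by (rule polyfun_coeff_line_poly[OF J_poly[OF Y(1)]])
  have b_inv: "b (x + t *s e) = b x" for x t
    unfolding b_def by (rule coeff_line_poly_translate[OF J_poly[OF Y(1)] Y(3)])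
  have "\<exists>z. b z \<noteq> 0"
  proof (rule ccontr)
    assume "\<not> ?thesis"
    hence "edeg_less e (\<lambda>x. Y x $ i0) m"
      using Y(3) unfolding edeg_less_def b_def by (metis Suc_leI le_neq_implies_less)
    thus False
      using min Y by blast
  qed
  then obtain z where z: "b z \<noteq> 0" ..
  \<comment> \<open>The remainder of \<theta> on division by \<open>Y\<close> lies in
    \<open>J\<close> and has too small a degree, so a power of \<open>b\<close> times \<theta> is a
    multiple of \<open>Y\<close>.\<close>
  obtain k q where kq: "polyfun q" "edeg_less e (\<lambda>x. b x ^ k * \<theta> x $ i0 - q x * Y x $ i0) m"
    using pseudo_division[OF J_poly[OF J\<theta>] J_poly[OF Y(1)] Y(3) l, of i0] unfolding b_def by blast
  have "b x ^ k *s \<theta> x - q x *s Y x = 0" for x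
    using kq b by (intro min J_comb J\<theta> Y polyfun_power) auto
  hence bq: "b x ^ k * \<theta> x $ i = q x * Y x $ i" for i x
    by (simp add: vec_eq_iff)
  \<comment> \<open>Gauss's lemma applies because \<theta> is monic up to a scalar; the quotient of
    \<open>Y\<close> by \<open>b\<close> then has a monic component \<open>i0\<close>
    (\<open>Xcoeff\<close>).\<close>
  have "\<exists>c. polyfun c \<and> (\<forall>x. Y x $ i = b x * c x)" for i
    unfolding b_def
    by (rule lead_coeff_divides[of "\<lambda>i x. \<theta> x $ i" "\<lambda>i x. Y x $ i" q e i0 m d "\<theta> e $ i0" k z i])
       (use J_poly[OF J\<theta>] J_poly[OF Y(1)] kq(1) Y(3) th_less th_line(2) e(1) bq z in \<open>auto simp: b_def\<close>)
  then obtain c where c: "\<And>i. polyfun (c i)" "\<And>i x. Y x $ i = b x * c i x"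
    by metis
  define X where "X x = (\<chi> i. c i x)" for x
  have YX: "Y x = b x *s X x" for x
    by (simp add: X_def vec_eq_iff c(2))
  have Xpoly: "polyvec X"
    by (simp add: polyvec_def X_def c(1))
  have XH: "X x \<in> H" for x
  proof -
    have "b x * dot (al H) (X x) = 0" for x
      using Y(1) H by (simp add: J_def YX memA dot_scale)
    from polyfun_mult_eq_0[where g = "\<lambda>x. dot (al H) (X x)", OF b _ this z] Xpoly show ?thesis
      using H by (simp add: memA polyvec_def polyfun_dot)
  qed
  text \<open>Projecting along \<open>e\<close> onto \<open>K\<close> does not change \<open>b\<close>, so \<open>b\<close> does not vanish on \<open>K\<close>.\<close>
  have Xtan: "tangent A X"
    unfolding tangent_def
  proof (intro ballI)
    fix K x assume K: "K \<in> A" "x \<in> K"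
    define \<pi> where "\<pi> y = y + (- dot (al K) y * inverse (dot (al K) e)) *s e" for y
    have \<pi>K: "\<pi> y \<in> K" for y
      using K ale by (simp add: memA \<pi>_def dot_add dot_diff dot_scale)
    have "b y * dot (al K) (X (\<pi> y)) = 0" for y
    proof -
      have "dot (al K) (Y (\<pi> y)) = 0"
        using Y(1) K \<pi>K[of y] by (auto simp: J_def tangent_def memA)
      moreover have "b (\<pi> y) = b y"
        unfolding \<pi>_def by (rule b_inv)
      ultimately show ?thesis
        by (simp add: YX dot_scale)
    qed
    moreover have "polyfun (\<lambda>y. dot (al K) (X (\<pi> y)))"
      using Xpoly polyfun_dot[of "\<lambda>x. x" "al K"] unfolding \<pi>_def polyvec_def
      by (intro polyfun_dot polyfun_affine) (auto intro!: polyfun_intros)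
    ultimately have "dot (al K) (X (\<pi> x)) = 0"
      using polyfun_mult_eq_0[OF b, of "\<lambda>y. dot (al K) (X (\<pi> y))" z x] z by blast
    moreover have "\<pi> x = x"
      using K by (simp add: memA \<pi>_def)
    ultimately show "X x \<in> K"
      using K by (simp add: memA)
  qed
  have JX: "J X"
  proof -
    have "\<theta> x $ i0 * X x $ j = X x $ i0 * \<theta> x $ j" for x j
    proof (rule polyfun_mult_cancel[where g = "\<lambda>x. \<theta> x $ i0 * X x $ j"
          and h = "\<lambda>x. X x $ i0 * \<theta> x $ j", OF b _ _ _ z])
      show "polyfun (\<lambda>x. \<theta> x $ i0 * X x $ j)" "polyfun (\<lambda>x. X x $ i0 * \<theta> x $ j)"
        using Xpoly \<theta>(1) by (auto simp: polyvec_def intro!: polyfun_intros)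
      fix x
      have "\<theta> x $ i0 *s Y x = Y x $ i0 *s \<theta> x"
        using Y(1) by (simp add: J_def)
      hence "\<theta> x $ i0 * (b x * X x $ j) = b x * X x $ i0 * \<theta> x $ j"
        unfolding YX by (metis vector_smult_component)
      thus "b x * (\<theta> x $ i0 * X x $ j) = b x * (X x $ i0 * \<theta> x $ j)"
        by (simp add: mult_ac)
    qed
    thus ?thesis
      using Xpoly Xtan XH by (simp add: J_def vec_eq_iff)
  qed
  have line_b: "line_poly b x e = [:b x:]" for x
    by (rule line_poly_invariant) (rule b_inv)
  have line_Y: "line_poly (\<lambda>x. Y x $ i0) x e = smult (b x) (line_poly (\<lambda>x. X x $ i0) x e)" for x
    using J_poly[OF JX] b by (simp add: YX line_poly_mult line_b)
  have Xcoeff: "coeff (line_poly (\<lambda>x. X x $ i0) x e) j = (if j = m then 1 else 0)" if "j \<ge> m" for x j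
  proof (rule polyfun_mult_cancel[where g = "\<lambda>x. coeff (line_poly (\<lambda>x. X x $ i0) x e) j"
        and h = "\<lambda>x. if j = m then 1 else 0", OF b _ _ _ z])
    show "polyfun (\<lambda>x. coeff (line_poly (\<lambda>x. X x $ i0) x e) j)"
      by (rule polyfun_coeff_line_poly[OF J_poly[OF JX]])
    show "polyfun (\<lambda>x. if j = m then 1 else 0)"
      by (rule polyfun_const)
    fix x
    have "b x * coeff (line_poly (\<lambda>x. X x $ i0) x e) j = coeff (line_poly (\<lambda>x. Y x $ i0) x e) j"
      by (simp add: line_Y)
    also have "\<dots> = b x * (if j = m then 1 else 0)"
      using that Y(3) by (auto simp: b_def edeg_less_def)
    finally show "b x * coeff (line_poly (\<lambda>x. X x $ i0) x e) j = b x * (if j = m then 1 else 0)" .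
  qed

  text \<open>Homogeneity comes from minimality: \<open>X (c x) - c\<^sup>m X x\<close> has smaller degree.\<close>
  have hom_nz: "X (c *s x) = c ^ m *s X x" if c: "c \<noteq> 0" for c x
  proof -
    have pX: "polyfun (\<lambda>x. X (c *s x) $ i)" for i
      by (rule polyfun_compose[of "\<lambda>x. X x $ i" "\<lambda>x. c *s x"])
         (use Xpoly in \<open>auto simp: polyvec_def intro!: polyfun_intros\<close>)
    have JXc: "J (\<lambda>x. X (c *s x))"
    proof -
      have "tangent A (\<lambda>x. X (c *s x))"
        using Xtan by (auto simp: tangent_def memA dot_scale)
      moreover have "\<theta> x $ i0 *s X (c *s x) = X (c *s x) $ i0 *s \<theta> x" for x
      proof -
        have "\<theta> (c *s x) $ i0 *s X (c *s x) = X (c *s x) $ i0 *s \<theta> (c *s x)"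
          using JX by (simp add: J_def)
        hence "c ^ d *s (\<theta> x $ i0 *s X (c *s x)) = c ^ d *s (X (c *s x) $ i0 *s \<theta> x)"
          by (simp add: \<theta>(4) vec_eq_iff mult_ac)
        thus ?thesis
          using c by (simp add: vec_eq_iff)
      qed
      ultimately show ?thesis
        using pX XH by (simp add: J_def polyvec_def)
    qed
    have J2: "J (\<lambda>x. 1 *s X (c *s x) - c ^ m *s X x)"
      by (rule J_comb[OF JXc JX polyfun_const polyfun_const])
    have linec: "line_poly (\<lambda>x. X (c *s x) $ i0) x e = pcompose (line_poly (\<lambda>x. X x $ i0) (c *s x) e) [:0, c:]" for x
      by (rule line_poly_unique)
         (simp add: poly_pcompose poly_line_poly J_poly[OF JX] vector_smult_assoc vector_add_ldistrib mult.commute)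
    have "edeg_less e (\<lambda>x. (1 *s X (c *s x) - c ^ m *s X x) $ i0) m"
      unfolding edeg_less_def
    proof (intro allI impI)
      fix x j assume j: "m \<le> j"
      have "line_poly (\<lambda>x. (1 *s X (c *s x) - c ^ m *s X x) $ i0) x e =
          line_poly (\<lambda>x. X (c *s x) $ i0) x e - smult (c ^ m) (line_poly (\<lambda>x. X x $ i0) x e)"
        using pX J_poly[OF JX]
        by (simp add: line_poly_diff line_poly_mult line_poly_const polyfun_const polyfun_mult)
      thus "coeff (line_poly (\<lambda>x. (1 *s X (c *s x) - c ^ m *s X x) $ i0) x e) j = 0"
        using Xcoeff[OF j] by (simp add: linec coeff_pcompose_linear)
    qed
    from min[OF J2 this, of x] show ?thesis by simp
  qed
  \<comment> \<open>The case \<open>c = 0\<close> follows because both sides are polynomial in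
    \<open>c\<close>; for \<open>m = 0\<close> it says that \<open>X\<close> is constant.\<close>
  have hom: "X (c *s x) = c ^ m *s X x" for c x
  proof -
    have "line_poly (\<lambda>x. X x $ i) 0 x = monom (X x $ i) m" for i
    proof (rule poly_eqI_cofinite[of "{0}"])
      fix s :: 'k assume "s \<notin> {0}"
      thus "poly (line_poly (\<lambda>x. X x $ i) 0 x) s = poly (monom (X x $ i) m) s"
        using hom_nz[of s x] by (simp add: poly_line_poly J_poly[OF JX] poly_monom)
    qed simp
    hence "poly (line_poly (\<lambda>x. X x $ i) 0 x) c = poly (monom (X x $ i) m) c" for i
      by simp
    thus ?thesis
      by (simp add: poly_line_poly J_poly[OF JX] poly_monom vec_eq_iff mult.commute)
  qed
  have Xe: "X e $ i0 \<noteq> 0"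
    using line_poly_homogeneous(2)[of "\<lambda>x. X x $ i0" m 0 e] J_poly[OF JX] Xcoeff[of m 0] by (simp add: hom)

  \<comment> \<open>A polynomial constant along \<open>e\<close> in the ideal of the
    coordinates\<close>
  have "\<exists>g. polyfun g \<and> (\<forall>x. dot (al K) (X x) = dot (al K) x * g x)" if K: "K \<in> A" for K
  proof (rule polyfun_factor_linear)
    show "polyfun (\<lambda>x. dot (al K) (X x))"
      using J_poly[OF JX] by (rule polyfun_dot)
    show "al K \<noteq> 0"
      using ale[OF K] by (auto simp: dot_def)
    show "dot (al K) (X x) = 0" if "dot (al K) x = 0" for x
      using that Xtan K by (auto simp: tangent_def memA)
  qed
  then obtain g where g: "\<And>K. K \<in> A \<Longrightarrow> polyfun (g K)"
    "\<And>K x. K \<in> A \<Longrightarrow> dot (al K) (X x) = dot (al K) x * g K x"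
    by metis
  \<comment> \<open>The coordinates in the fibres: the components see \<open>X\<close> as a vector,
    the quotients see it along the hyperplanes, where the vector may vanish.\<close>
  define G where "G = (\<lambda>i x. X x $ i) ` UNIV \<union> g ` A"
  have "finite G"
    using fin by (simp add: G_def)
  moreover have "polyfun f" if "f \<in> G" for f
    using that g(1) J_poly[OF JX] by (auto simp: G_def)
  moreover have "(\<lambda>x. X x $ i0) \<in> G"
    by (simp add: G_def)
  ultimately obtain h m' k where h: "polyfun h" "\<exists>x. coeff (line_poly h x e) m' \<noteq> 0" "edeg_less e h (Suc m')"
    and hw: "\<forall>w. h w \<noteq> 0 \<longrightarrow> (\<exists>f\<in>G. f w \<noteq> 0)"
    and hG: "\<forall>f\<in>G. \<exists>q. polyfun q \<and> (\<forall>x. coeff (line_poly h x e) m' ^ k * f x = q x * h x)"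
    using ex_ideal_min_degree[of G "\<lambda>x. X x $ i0" e l e] Xe l by blast
  define \<beta> where "\<beta> x = coeff (line_poly h x e) m'" for x
  have \<beta>: "polyfun \<beta>"
    unfolding \<beta>_def by (rule polyfun_coeff_line_poly[OF h(1)])
  have \<beta>_inv: "\<beta> (x + t *s e) = \<beta> x" for x t
    unfolding \<beta>_def by (rule coeff_line_poly_translate[OF h(1,3)])
  obtain z' where z': "\<beta> z' \<noteq> 0"
    using h(2) by (auto simp: \<beta>_def)
  have hnz: "\<exists>x. h x \<noteq> 0"
  proof (rule ccontr)
    assume "\<not> ?thesis"
    hence "line_poly h z' e = 0"
      by (intro line_poly_unique) simp
    thus False using z' by (simp add: \<beta>_def)
  qed
  then obtain xh where xh: "h xh \<noteq> 0" ..
  \<comment> \<open>If \<open>h\<close> depended on the direction \<open>e\<close>, then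
    \<open>\<beta> ^ k\<close> times \<open>X\<close> divided by \<open>h\<close> would be tangent,
    parallel to \<theta> and of smaller degree than \<open>X\<close>.\<close>
  have "m' = 0"
  proof (rule ccontr)
    assume m': "m' \<noteq> 0"
    have "\<forall>i. \<exists>q. polyfun q \<and> (\<forall>x. \<beta> x ^ k * X x $ i = q x * h x)"
      using hG by (simp add: G_def \<beta>_def)
    then obtain q where q: "\<And>i. polyfun (q i)" "\<And>i x. \<beta> x ^ k * X x $ i = q i x * h x"
      by metis
    define Z where "Z x = (\<chi> i. q i x)" for x
    have ZX: "h x *s Z x = \<beta> x ^ k *s X x" for x
      by (simp add: Z_def vec_eq_iff q(2))
    have Zpoly: "polyfun (\<lambda>x. Z x $ i)" for i
      by (simp add: Z_def q(1))
    \<comment> \<open>This is why the quotients belong to \<open>G\<close>: \<open>h\<close> divides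
      \<open>\<beta> ^ k\<close> times the quotient at \<open>K\<close>, so the equation of
      \<open>K\<close> remains a factor after division by \<open>h\<close>.\<close>
    have Ztan: "dot (al K) (Z x) = 0" if K: "K \<in> A" "x \<in> K" for K x
    proof -
      obtain r where r: "polyfun r" "\<And>x. \<beta> x ^ k * g K x = r x * h x"
        using hG K by (auto simp: G_def \<beta>_def)
      have "dot (al K) (Z x) = dot (al K) x * r x" for x
      proof (rule polyfun_mult_cancel[where g = "\<lambda>x. dot (al K) (Z x)"
            and h = "\<lambda>x. dot (al K) x * r x", OF h(1) _ _ _ xh])
        show "polyfun (\<lambda>x. dot (al K) (Z x))"
          using Zpoly by (rule polyfun_dot)
        show "polyfun (\<lambda>x. dot (al K) x * r x)"
          using r(1) polyfun_dot[of "\<lambda>x. x" "al K"] by (auto intro!: polyfun_intros)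
        fix x
        have "h x * dot (al K) (Z x) = \<beta> x ^ k * (dot (al K) x * g K x)"
          using K(1) by (metis ZX dot_scale g(2))
        also have "\<dots> = dot (al K) x * (\<beta> x ^ k * g K x)"
          by (simp only: mult_ac)
        also have "\<dots> = dot (al K) x * (r x * h x)"
          by (simp only: r(2))
        finally show "h x * dot (al K) (Z x) = h x * (dot (al K) x * r x)"
          by (simp only: mult_ac)
      qed
      thus ?thesis
        using K by (simp add: memA)
    qed
    have "dot (al H) (Z x) = 0" for x
    proof (rule polyfun_mult_eq_0[where g = "\<lambda>x. dot (al H) (Z x)", OF h(1) _ _ xh])
      show "polyfun (\<lambda>x. dot (al H) (Z x))"
        using Zpoly by (rule polyfun_dot)
      show "h x * dot (al H) (Z x) = 0" for x
        using XH[of x] H by (metis ZX dot_scale memA mult_zero_right)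
    qed
    moreover have "\<theta> x $ i0 * Z x $ j = Z x $ i0 * \<theta> x $ j" for x j
    proof (rule polyfun_mult_cancel[where g = "\<lambda>x. \<theta> x $ i0 * Z x $ j"
          and h = "\<lambda>x. Z x $ i0 * \<theta> x $ j", OF h(1) _ _ _ xh])
      show "polyfun (\<lambda>x. \<theta> x $ i0 * Z x $ j)" "polyfun (\<lambda>x. Z x $ i0 * \<theta> x $ j)"
        using Zpoly \<theta>(1) by (auto simp: polyvec_def intro!: polyfun_intros)
      fix x
      have c: "h x * Z x $ j = \<beta> x ^ k * X x $ j" for j
        using ZX[of x] by (metis vector_smult_component)
      have "\<theta> x $ i0 * X x $ j = X x $ i0 * \<theta> x $ j"
        using JX unfolding J_def by (metis vector_smult_component)
      thus "h x * (\<theta> x $ i0 * Z x $ j) = h x * (Z x $ i0 * \<theta> x $ j)"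
        using c[of j] c[of i0] by (metis (no_types, opaque_lifting) mult.assoc mult.commute)
    qed
    ultimately have JZ: "J Z"
      using Ztan Zpoly H by (simp add: J_def polyvec_def tangent_def memA vec_eq_iff)
    have "edeg_less e (\<lambda>x. Z x $ i0) m"
      unfolding edeg_less_def
    proof (intro allI impI)
      fix x j assume j: "m \<le> j"
      show "coeff (line_poly (\<lambda>x. Z x $ i0) x e) j = 0"
      proof (rule polyfun_mult_eq_0[where g = "\<lambda>x. coeff (line_poly (\<lambda>x. Z x $ i0) x e) j", OF \<beta> _ _ z'])
        show "polyfun (\<lambda>x. coeff (line_poly (\<lambda>x. Z x $ i0) x e) j)"
          by (rule polyfun_coeff_line_poly[OF Zpoly])
        fix x
        let ?Z = "line_poly (\<lambda>x. Z x $ i0) x e" and ?X = "line_poly (\<lambda>x. X x $ i0) x e"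
          and ?h = "line_poly h x e"
        \<comment> \<open>Where \<beta> is nonzero it is a coefficient of \<open>?h\<close> in the
          positive degree \<open>m'\<close>, so degrees add and \<open>?Z\<close> has smaller degree
          than \<open>?X\<close>. The points with \<open>\<beta> x = 0\<close> are covered by
          cancelling the factor \<beta>.\<close>
        show "\<beta> x * coeff ?Z j = 0"
        proof (cases "\<beta> x = 0 \<or> ?Z = 0")
          case False
          have "line_poly \<beta> x e = [:\<beta> x:]"
            by (rule line_poly_invariant) (rule \<beta>_inv)
          moreover have "line_poly (\<lambda>x. h x * Z x $ i0) x e = line_poly (\<lambda>x. \<beta> x ^ k * X x $ i0) x e"
            by (simp only: ZX flip: vector_smult_component)
          ultimately have eq: "?h * ?Z = smult (\<beta> x ^ k) ?X"
            using h(1) \<beta> Zpoly J_poly[OF JX]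
            by (simp add: line_poly_mult line_poly_power polyfun_power) (simp add: poly_const_pow)
          have "coeff ?h m' \<noteq> 0"
            using False by (simp add: \<beta>_def)
          hence "?h \<noteq> 0" "m' \<le> degree ?h"
            by (auto intro: le_degree)
          moreover from this(1) have "degree (?h * ?Z) = degree ?h + degree ?Z"
            using False by (intro degree_mult_eq) auto
          moreover have "degree (smult (\<beta> x ^ k) ?X) \<le> m"
            using Xcoeff by (intro order.trans[OF degree_smult_le] degree_le) auto
          ultimately have "degree ?Z < m"
            using m' eq by simp
          thus ?thesis
            using j by (simp add: coeff_eq_0)
        qed auto
      qed
    qed
    from min[OF JZ this] have "\<beta> x ^ k *s X x = 0" for x
      using ZX[of x] by simp
    hence "\<beta> x ^ k * X x $ i0 = 0" for x
      by (metis vector_smult_component zero_index)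
    from polyfun_mult_nonzero[OF polyfun_power[OF \<beta>, of k] J_poly[OF JX] _ Xe, of z'] this z'
    show False by auto
  qed
  \<comment> \<open>With \<open>m' = 0\<close> the leading coefficient along \<open>e\<close> is
    \<open>h\<close> itself.\<close>
  have h_inv: "h (x + s *s e) = h x" for x s
    using coeff_line_poly_translate[OF h(1,3), of x s] h(1) \<open>m' = 0\<close> by (simp add: coeff_0_line_poly)
  have nonvan: "X w \<noteq> 0 \<or>
      (\<exists>K\<in>A. \<exists>g. polyfun g \<and> (\<forall>x. dot (al K) (X x) = dot (al K) x * g x) \<and> g w \<noteq> 0)"
    if hwn: "h w \<noteq> 0" for w
  proof -
    obtain f where f: "f \<in> G" "f w \<noteq> 0"
      using hw hwn by blast
    then consider i where "f = (\<lambda>x. X x $ i)" | K where "K \<in> A" "f = g K"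
      by (auto simp: G_def)
    thus ?thesis
    proof cases
      case 1
      thus ?thesis using f by (auto simp: vec_eq_iff)
    next
      case 2
      thus ?thesis using f g by blast
    qed
  qed
  show ?thesis
    by (rule exI[of _ X], rule exI[of _ m], rule exI[of _ h])
       (use Xpoly Xtan XH hom md JX Xe h(1) hnz h_inv nonvan in \<open>auto simp: J_def\<close>)
qed

section \<open>Sections of the sheaf of a graded module\<close>

definition graded_module :: "('i, 'n::finite, 'k::comm_ring_1) grmod \<Rightarrow> bool" where
  "graded_module M \<longleftrightarrow> pmod.subspace (upper M) \<and> pmod.subspace (lower M) \<and>
     (\<forall>d e s x. s \<in> homog d \<longrightarrow> x \<in> grad M e \<longrightarrow> pscale s x \<in> grad M (d + e))"

lemma mpoly_no_zero_divisors:
  fixes f g :: "('n::finite, 'k::alg_closed_field) mpoly"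
  assumes "f \<noteq> 0" "g \<noteq> 0"
  shows "f * g \<noteq> 0"
proof -
  obtain u v where "mp_eval u f \<noteq> 0" "mp_eval v g \<noteq> 0"
    using assms mp_eval_eq_0_imp by metis
  from polyfun_mult_nonzero[OF polyfun_mp_eval polyfun_mp_eval this]
  obtain x where "mp_eval x (f * g) \<noteq> 0"
    by auto
  thus ?thesis
    using mp_eval_0 by metis
qed

lemma graded_module_lower_scale: "graded_module M \<Longrightarrow> x \<in> lower M \<Longrightarrow> pscale s x \<in> lower M"
  and graded_module_lower_add: "graded_module M \<Longrightarrow> x \<in> lower M \<Longrightarrow> y \<in> lower M \<Longrightarrow> x + y \<in> lower M"
  by (auto simp: graded_module_def pmod.subspace_def)

lemma fractions_iff:
  assumes "f \<in> homog e" "f \<noteq> 0"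
  shows "(m, k) \<in> fractions M f \<longleftrightarrow> m \<in> upper M \<and> m \<in> grad M (int k * e)"
  using assms homog_degree_unique unfolding fractions_def by blast

lemma fraction_rel_refl:
  assumes "graded_module M" "(m, k) \<in> fractions M f"
  shows "((m, k), (m, k)) \<in> fraction_rel M f"
  using assms by (auto simp: fraction_rel_def graded_module_def pmod.subspace_def)

lemma fraction_rel_sym:
  assumes "graded_module M" "((m, k), (m', k')) \<in> fraction_rel M f"
  shows "((m', k'), (m, k)) \<in> fraction_rel M f"
proof -
  obtain j where j: "pscale (f ^ j) (pscale (f ^ k') m - pscale (f ^ k) m') \<in> lower M"
    using assms(2) by (auto simp: fraction_rel_def)
  have "pscale (- 1) (pscale (f ^ j) (pscale (f ^ k') m - pscale (f ^ k) m')) \<in> lower M"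
    by (rule graded_module_lower_scale[OF assms(1) j])
  also have "pscale (- 1) (pscale (f ^ j) (pscale (f ^ k') m - pscale (f ^ k) m')) =
      pscale (f ^ j) (pscale (f ^ k) m' - pscale (f ^ k') m)"
    by (auto simp: pscale_def algebra_simps)
  finally show ?thesis
    using assms(2) by (auto simp: fraction_rel_def)
qed

lemma fraction_rel_trans:
  assumes "graded_module M" "((m, k), (m', k')) \<in> fraction_rel M f" "((m', k'), (m'', k'')) \<in> fraction_rel M f"
  shows "((m, k), (m'', k'')) \<in> fraction_rel M f"
proof -
  obtain i j where ij: "pscale (f ^ i) (pscale (f ^ k') m - pscale (f ^ k) m') \<in> lower M"
    "pscale (f ^ j) (pscale (f ^ k'') m' - pscale (f ^ k') m'') \<in> lower M"
    using assms(2,3) by (auto simp: fraction_rel_def)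
  have "pscale (f ^ (k'' + j)) (pscale (f ^ i) (pscale (f ^ k') m - pscale (f ^ k) m')) +
        pscale (f ^ (k + i)) (pscale (f ^ j) (pscale (f ^ k'') m' - pscale (f ^ k') m'')) \<in> lower M"
    by (intro graded_module_lower_add[OF assms(1)] graded_module_lower_scale[OF assms(1)] ij)
  also have "pscale (f ^ (k'' + j)) (pscale (f ^ i) (pscale (f ^ k') m - pscale (f ^ k) m')) +
        pscale (f ^ (k + i)) (pscale (f ^ j) (pscale (f ^ k'') m' - pscale (f ^ k') m'')) =
        pscale (f ^ (i + j + k')) (pscale (f ^ k'') m - pscale (f ^ k) m'')"
    by (auto simp: pscale_def algebra_simps power_add)
  finally show ?thesis
    using assms(2,3) by (auto simp: fraction_rel_def)
qed

lemma frac_eq_iff: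
  assumes "graded_module M" "(m, k) \<in> fractions M f" "(m', k') \<in> fractions M f"
  shows "frac M f m k = frac M f m' k' \<longleftrightarrow>
    (\<exists>j. pscale (f ^ j) (pscale (f ^ k') m - pscale (f ^ k) m') \<in> lower M)"
proof
  assume "frac M f m k = frac M f m' k'"
  hence "((m, k), (m', k')) \<in> fraction_rel M f"
    using fraction_rel_refl[OF assms(1,3)] by (auto simp: frac_def)
  thus "\<exists>j. pscale (f ^ j) (pscale (f ^ k') m - pscale (f ^ k) m') \<in> lower M"
    by (auto simp: fraction_rel_def)
next
  assume "\<exists>j. pscale (f ^ j) (pscale (f ^ k') m - pscale (f ^ k) m') \<in> lower M"
  hence rel: "((m, k), (m', k')) \<in> fraction_rel M f"
    using assms by (auto simp: fraction_rel_def)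
  show "frac M f m k = frac M f m' k'"
    unfolding frac_def
    using fraction_rel_trans[OF assms(1) rel] fraction_rel_trans[OF assms(1) fraction_rel_sym[OF assms(1) rel]]
    by auto
qed

lemma sections_iff:
  "X \<in> sections M f \<longleftrightarrow> (\<exists>m k. (m, k) \<in> fractions M f \<and> X = frac M f m k)"
  unfolding sections_def frac_def quotient_def by auto

text \<open>A union over all representatives collapses once the value does not depend on the
  representative; this turns \<open>sec_scale\<close> and \<open>sec_restrict\<close> into formulas
  on a single fraction.\<close>

lemma UN_frac:
  assumes "graded_module M" "(m, k) \<in> fractions M f"
    and "\<And>m' k'. (m', k') \<in> fractions M f \<Longrightarrow> frac M f m k = frac M f m' k' \<Longrightarrow> F m' k' = F m k"
  shows "(\<Union>(m', k')\<in>frac M f m k. F m' k') = F m k"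
proof -
  have "(m, k) \<in> frac M f m k"
    using fraction_rel_refl[OF assms(1,2)] by (simp add: frac_def)
  moreover have "F m' k' = F m k" if "(m', k') \<in> frac M f m k" for m' k'
  proof -
    have rel: "((m, k), (m', k')) \<in> fraction_rel M f"
      using that by (simp add: frac_def)
    hence fr: "(m', k') \<in> fractions M f"
      by (auto simp: fraction_rel_def)
    moreover have "frac M f m k = frac M f m' k'"
      using rel frac_eq_iff[OF assms(1,2) fr] by (auto simp: fraction_rel_def)
    ultimately show ?thesis
      by (rule assms(3))
  qed
  ultimately show ?thesis
    by blast
qed

lemma fractions_scale:
  assumes "graded_module M" "f \<in> homog e" "f \<noteq> 0" "s \<in> homog (int j * e)" "(m, k) \<in> fractions M f"
  shows "(pscale s m, j + k) \<in> fractions M f"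
proof -
  have m: "m \<in> upper M" "m \<in> grad M (int k * e)"
    using assms(5) fractions_iff[OF assms(2,3)] by auto
  have "pscale s m \<in> grad M (int j * e + int k * e)"
    using assms(1,4) m unfolding graded_module_def by blast
  moreover have "pscale s m \<in> upper M"
    using assms(1) m by (auto simp: graded_module_def pmod.subspace_scale)
  ultimately show ?thesis
    by (simp add: fractions_iff[OF assms(2,3)] distrib_right)
qed

lemma sec_scale_frac:
  assumes M: "graded_module M" and f: "f \<in> homog e" "f \<noteq> 0" "s \<in> homog (int j * e)"
    and m: "(m, k) \<in> fractions M f"
  shows "sec_scale M f s j (frac M f m k) = frac M f (pscale s m) (j + k)"
  unfolding sec_scale_def
proof (rule UN_frac[OF M m])
  fix m' k' assume m': "(m', k') \<in> fractions M f" and "frac M f m k = frac M f m' k'"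
  then obtain i where i: "pscale (f ^ i) (pscale (f ^ k) m' - pscale (f ^ k') m) \<in> lower M"
    using frac_eq_iff[OF M m' m] by auto
  have "pscale (s * f ^ j) (pscale (f ^ i) (pscale (f ^ k) m' - pscale (f ^ k') m)) \<in> lower M"
    by (rule graded_module_lower_scale[OF M i])
  also have "pscale (s * f ^ j) (pscale (f ^ i) (pscale (f ^ k) m' - pscale (f ^ k') m)) =
      pscale (f ^ i) (pscale (f ^ (j + k)) (pscale s m') - pscale (f ^ (j + k')) (pscale s m))"
    by (auto simp: pscale_def algebra_simps power_add)
  finally show "frac M f (pscale s m') (j + k') = frac M f (pscale s m) (j + k)"
    using frac_eq_iff[OF M fractions_scale[OF M f m'] fractions_scale[OF M f m]] by blast
qed

lemma fractions_restrict:
  fixes f g :: "('n::finite, 'k::alg_closed_field) mpoly"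
  assumes "graded_module M" "f \<in> homog e" "f \<noteq> 0" "g \<in> homog e'" "g \<noteq> 0" "(m, k) \<in> fractions M f"
  shows "(pscale (g ^ k) m, k) \<in> fractions M (f * g)"
proof -
  have m: "m \<in> upper M" "m \<in> grad M (int k * e)"
    using assms(6) fractions_iff[OF assms(2,3)] by auto
  have "pscale (g ^ k) m \<in> grad M (int k * e' + int k * e)"
    using assms(1) m homog_power[OF assms(4)] unfolding graded_module_def by blast
  moreover have "pscale (g ^ k) m \<in> upper M"
    using assms(1) m by (auto simp: graded_module_def pmod.subspace_scale)
  ultimately show ?thesis
    by (simp add: fractions_iff[OF homog_mult[OF assms(2,4)] mpoly_no_zero_divisors[OF assms(3,5)]]
        distrib_left add.commute)
qed

lemma sec_restrict_frac:
  fixes f g :: "('n::finite, 'k::alg_closed_field) mpoly"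
  assumes M: "graded_module M" and f: "f \<in> homog e" "f \<noteq> 0" and g: "g \<in> homog e'" "g \<noteq> 0"
    and m: "(m, k) \<in> fractions M f"
  shows "sec_restrict M f g (frac M f m k) = frac M (f * g) (pscale (g ^ k) m) k"
  unfolding sec_restrict_def
proof (rule UN_frac[OF M m])
  fix m' k' assume m': "(m', k') \<in> fractions M f" and "frac M f m k = frac M f m' k'"
  then obtain i where i: "pscale (f ^ i) (pscale (f ^ k) m' - pscale (f ^ k') m) \<in> lower M"
    using frac_eq_iff[OF M m' m] by auto
  have "pscale (g ^ (i + k + k')) (pscale (f ^ i) (pscale (f ^ k) m' - pscale (f ^ k') m)) \<in> lower M"
    by (rule graded_module_lower_scale[OF M i])
  also have "pscale (g ^ (i + k + k')) (pscale (f ^ i) (pscale (f ^ k) m' - pscale (f ^ k') m)) =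
      pscale ((f * g) ^ i) (pscale ((f * g) ^ k) (pscale (g ^ k') m') - pscale ((f * g) ^ k') (pscale (g ^ k) m))"
    by (auto simp: pscale_def algebra_simps power_add power_mult_distrib)
  finally show "frac M (f * g) (pscale (g ^ k') m') k' = frac M (f * g) (pscale (g ^ k) m) k"
    using frac_eq_iff[OF M fractions_restrict[OF M f g m'] fractions_restrict[OF M f g m]] by blast
qed

section \<open>Splitting on a line\<close>

definition is_sheaf_iso ::
  "('i, 'n::finite, 'k::comm_ring_1) grmod \<Rightarrow> ('j, 'n, 'k) grmod \<Rightarrow>
   (('n, 'k) mpoly \<Rightarrow> (('i \<Rightarrow> ('n, 'k) mpoly) \<times> nat) set \<Rightarrow> (('j \<Rightarrow> ('n, 'k) mpoly) \<times> nat) set) \<Rightarrow> bool" where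
  "is_sheaf_iso M N \<phi> \<longleftrightarrow> (\<forall>f\<in>distinguished.
        bij_betw (\<phi> f) (sections M f) (sections N f) \<and>
        (\<forall>X\<in>sections M f. \<forall>Y\<in>sections M f.
           \<phi> f (sec_add M f X Y) = sec_add N f (\<phi> f X) (\<phi> f Y)) \<and>
        (\<forall>e s j. f \<in> homog e \<longrightarrow> s \<in> homog (int j * e) \<longrightarrow>
           (\<forall>X\<in>sections M f. \<phi> f (sec_scale M f s j X) = sec_scale N f s j (\<phi> f X))) \<and>
        (\<forall>g\<in>distinguished. \<forall>X\<in>sections M f.
           \<phi> (f * g) (sec_restrict M f g X) = sec_restrict N f g (\<phi> f X)))"

lemma sheaf_iso_iff: "sheaf_iso M N \<longleftrightarrow> (\<exists>\<phi>. is_sheaf_iso M N \<phi>)"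
  by (simp add: sheaf_iso_def is_sheaf_iso_def)

lemma distinguishedI: "f \<in> homog e \<Longrightarrow> e > 0 \<Longrightarrow> f \<noteq> 0 \<Longrightarrow> f \<in> distinguished"
  by (auto simp: distinguished_def)

lemma graded_module_restrict_D0:
  fixes A :: "('k::alg_closed_field ^ 'n::finite) set set"
  shows "graded_module (restrict_to L (D0 A))"
  using log_derivations_subspace[of A]
  by (auto simp: graded_module_def restrict_to_def D0_def pmod.subspace_span pscale_def intro: homog_mult)

lemma graded_module_restrict_twisted:
  fixes L :: "('k::alg_closed_field ^ 'n::finite) set"
  shows "graded_module (restrict_to L (twisted_free n a))"
proof -
  have "s * x \<in> homog (d + e - b)" if "s \<in> homog d" "x \<in> homog (e - b)"
    for s x :: "('n, 'k) mpoly" and d e b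
    using homog_mult[OF that] by (simp add: algebra_simps)
  hence "\<forall>d e s x. s \<in> homog d \<longrightarrow> x \<in> grad (restrict_to L (twisted_free n a)) e \<longrightarrow>
      pscale s x \<in> grad (restrict_to L (twisted_free n a)) (d + e)"
    by (simp add: restrict_to_def twisted_free_def pscale_def)
  moreover have "pmod.subspace (upper (restrict_to L (twisted_free n a)))"
    by (simp add: restrict_to_def twisted_free_def pmod.subspace_def pscale_def)
  moreover have "pmod.subspace (lower (restrict_to L (twisted_free n a)))"
    by (simp add: restrict_to_def pmod.subspace_span)
  ultimately show ?thesis
    unfolding graded_module_def by blast
qed

lemma restrict_twisted_lower_eval:
  fixes L :: "('k::alg_closed_field ^ 'n::finite) set"
  assumes "x \<in> lower (restrict_to L (twisted_free n a))" "w \<in> L"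
  shows "mp_eval w (x i) = 0"
proof -
  let ?T = "{x :: nat \<Rightarrow> ('n, 'k) mpoly. \<forall>i. mp_eval w (x i) = 0}"
  have "x \<in> pmod.span ({0} \<union> {pscale p x | p x. p \<in> vanishing_ideal L \<and> x \<in> upper (twisted_free n a)})"
    using assms(1) by (simp add: restrict_to_def twisted_free_def)
  also have "\<dots> \<subseteq> ?T"
    by (rule pmod.span_minimal)
       (use assms(2) in \<open>auto simp: pmod.subspace_def pscale_def vanishing_ideal_def\<close>)
  finally show ?thesis by simp
qed

lemma sum_fun_apply: "(\<Sum>i\<in>I. f i) x = (\<Sum>i\<in>I. f i x)"
  by (induction I rule: infinite_finite_induct) auto

text \<open>With \<open>restrict_twisted_lower_eval\<close>, equality in the restricted free module
  becomes equality of coordinates as functions on \<open>L\<close>.\<close>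

lemma restrict_twisted_lowerI:
  fixes L :: "('k::alg_closed_field ^ 'n::finite) set"
  assumes "\<And>i. i \<notin> {1..n} \<Longrightarrow> x i = 0" "\<And>i w. i \<in> {1..n} \<Longrightarrow> w \<in> L \<Longrightarrow> mp_eval w (x i) = 0"
  shows "x \<in> lower (restrict_to L (twisted_free n a))"
proof -
  let ?U = "\<lambda>i j. if j = i then 1 else 0 :: ('n, 'k) mpoly"
  have "x = (\<Sum>i\<in>{1..n}. pscale (x i) (?U i))"
  proof
    fix j
    have "(\<Sum>i\<in>{1..n}. pscale (x i) (?U i)) j = (\<Sum>i\<in>{1..n}. if j = i then x i else 0)"
      unfolding sum_fun_apply pscale_def by (intro sum.cong refl) simp
    also have "\<dots> = x j"
      using assms(1)[of j] by auto
    finally show "x j = (\<Sum>i\<in>{1..n}. pscale (x i) (?U i)) j" ..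
  qed
  also have "\<dots> \<in> pmod.span ({0} \<union> {pscale p x | p x. p \<in> vanishing_ideal L \<and> x \<in> upper (twisted_free n a)})"
  proof (intro pmod.span_sum pmod.span_base UnI2 CollectI)
    fix i assume "i \<in> {1..n}"
    thus "\<exists>p y. pscale (x i) (?U i) = pscale p y \<and> p \<in> vanishing_ideal L \<and> y \<in> upper (twisted_free n a)"
      using assms(2) by (intro exI[of _ "x i"] exI[of _ "?U i"]) (auto simp: vanishing_ideal_def twisted_free_def)
  qed
  finally show ?thesis
    by (simp add: restrict_to_def twisted_free_def)
qed

text \<open>The values at \<open>w\<close> of the homomorphisms from the module of logarithmic derivations to the
  coordinate ring that kill the Euler derivation; they factor through the fibre at \<open>w\<close>.\<close>

definition fibre_functional ::
  "('k::field ^ 'n::finite) set set \<Rightarrow> 'k ^ 'n \<Rightarrow> ((('n, 'k) mpoly \<Rightarrow> ('n, 'k) mpoly) \<Rightarrow> 'k) \<Rightarrow> bool" where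
  "fibre_functional A w \<Lambda> \<longleftrightarrow>
     (\<forall>x\<in>log_derivations A. \<forall>y\<in>log_derivations A. \<Lambda> (x + y) = \<Lambda> x + \<Lambda> y) \<and>
     (\<forall>p. \<forall>x\<in>log_derivations A. \<Lambda> (pscale p x) = mp_eval w p * \<Lambda> x) \<and> \<Lambda> euler = 0"

lemma fibre_functional_lower:
  fixes A :: "('k::alg_closed_field ^ 'n::finite) set set"
  assumes A: "hyperplane_arrangement A" and \<Lambda>: "fibre_functional A w \<Lambda>" and w: "w \<in> L"
    and x: "x \<in> lower (restrict_to L (D0 A))"
  shows "\<Lambda> x = 0"
proof -
  note sub = log_derivations_subspace[of A]
  have zero: "\<Lambda> 0 = 0"
  proof -
    have "\<Lambda> (pscale 0 euler) = mp_eval w 0 * \<Lambda> euler"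
      using \<Lambda> euler_log_derivation[OF A] unfolding fibre_functional_def by blast
    thus ?thesis
      by (simp only: pmod.scale_zero_left mp_eval_0 mult_zero_left)
  qed
  let ?T = "{x \<in> log_derivations A. \<Lambda> x = 0}"
  have T: "pmod.subspace ?T"
    using \<Lambda> sub zero by (auto simp: pmod.subspace_def fibre_functional_def)
  have "x \<in> pmod.span (pmod.span {euler} \<union> {pscale p x | p x. p \<in> vanishing_ideal L \<and> x \<in> log_derivations A})"
    using x by (simp add: restrict_to_def D0_def)
  also have "\<dots> \<subseteq> ?T"
  proof (rule pmod.span_minimal[OF _ T], rule Un_least)
    show "pmod.span {euler} \<subseteq> ?T"
      using \<Lambda> euler_log_derivation[OF A]
      by (intro pmod.span_minimal[OF _ T]) (auto simp: fibre_functional_def)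
    show "{pscale p x | p x. p \<in> vanishing_ideal L \<and> x \<in> log_derivations A} \<subseteq> ?T"
      using \<Lambda> w sub by (auto simp: fibre_functional_def vanishing_ideal_def pmod.subspace_def)
  qed
  finally show ?thesis by simp
qed

text \<open>The image of the section \<open>m / f ^ d\<close> is written as
  \<open>c / f ^ k\<close>. It is used with linear forms \<open>f\<close>, where dividing by
  \<open>f ^ d\<close> brings an element of degree \<open>d\<close> to degree zero, as sections
  require.\<close>

definition represents where
  "represents M N \<phi> f m d c k \<longleftrightarrow> c \<in> upper N \<and> c \<in> grad N (int k) \<and> \<phi> f (frac M f m d) = frac N f c k"

lemma ex_represents:
  assumes iso: "is_sheaf_iso M N \<phi>" and f: "f \<in> homog 1" "f \<noteq> 0" and m: "m \<in> upper M" "m \<in> grad M (int d)"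
  shows "\<exists>c k. represents M N \<phi> f m d c k"
proof -
  have "frac M f m d \<in> sections M f"
    unfolding sections_iff fractions_iff[OF f] using m by (intro exI[of _ m] exI[of _ d]) simp
  moreover have "bij_betw (\<phi> f) (sections M f) (sections N f)"
    using iso distinguishedI[OF f(1) _ f(2)] by (simp add: is_sheaf_iso_def)
  ultimately have "\<phi> f (frac M f m d) \<in> sections N f"
    by (auto simp: bij_betw_def)
  thus ?thesis
    unfolding sections_iff fractions_iff[OF f] represents_def by auto
qed

lemma represents_fractions:
  assumes "represents M N \<phi> f m d c k" "f \<in> homog 1" "f \<noteq> 0"
  shows "(c, k) \<in> fractions N f"
  using assms(1) by (simp add: fractions_iff[OF assms(2,3)] represents_def)

text \<open>If the section lies in the first summand and its coordinate vanishes at \<open>w\<close>, then it is a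
  regular function vanishing at \<open>w\<close> times a section, hence zero in the fibre at \<open>w\<close>.\<close>

lemma represents_zero:
  fixes A :: "('k::alg_closed_field ^ 'n::finite) set set"
  assumes A: "hyperplane_arrangement A"
    and iso: "is_sheaf_iso (restrict_to L (D0 A)) (restrict_to L (twisted_free n a)) \<phi>"
    and f: "f \<in> homog 1" "f \<noteq> 0" and m: "m \<in> log_derivations A" "m \<in> grad (D0 A) (int d)"
    and rep: "represents (restrict_to L (D0 A)) (restrict_to L (twisted_free n a)) \<phi> f m d c k"
    and n: "1 \<le> n" and a: "0 \<le> a 1"
    and van: "\<And>i w. i \<in> {2..n} \<Longrightarrow> w \<in> L \<Longrightarrow> mp_eval w f * mp_eval w (c i) = 0"
    and w: "w \<in> L" "mp_eval w f = 1" "mp_eval w (c 1) = 0"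
    and \<Lambda>: "fibre_functional A w \<Lambda>"
  shows "\<Lambda> m = 0"
proof -
  let ?M = "restrict_to L (D0 A)" and ?N = "restrict_to L (twisted_free n a)"
  note M = graded_module_restrict_D0[of L A] and N = graded_module_restrict_twisted[of L n a]
  have up: "upper ?M = log_derivations A" "grad ?M = grad (D0 A)"
    by (simp_all add: restrict_to_def D0_def)
  obtain b where b: "a 1 = int b"
    using a by (metis zero_le_imp_eq_int)
  have fm: "(m, d) \<in> fractions ?M f"
    using m by (simp add: fractions_iff[OF f] up)
  have fc: "(c, k) \<in> fractions ?N f"
    by (rule represents_fractions[OF rep f])
  have c: "c i = 0" if "i \<notin> {1..n}" for i
    using rep that by (simp add: represents_def restrict_to_def twisted_free_def)
  have c1: "c 1 \<in> homog (int k - a 1)"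
    using rep n by (simp add: represents_def restrict_to_def twisted_free_def)
  \<comment> \<open>The factor \<open>f ^ b\<close> with \<open>b = a 1\<close> raises the degree of
    \<open>c 1\<close> to \<open>k\<close>, so that \<open>s / f ^ k\<close> is a regular function;
    \<open>u / f ^ b\<close> below generates the first summand.\<close>
  define s where "s = c 1 * f ^ b"
  have s: "s \<in> homog (int k)"
    using homog_mult[OF c1 homog_power[OF f(1), of b]] unfolding s_def b by simp
  hence s1: "s \<in> homog (int k * 1)"
    by simp
  define u :: "nat \<Rightarrow> ('n, 'k) mpoly" where "u j = (if j = 1 then 1 else 0)" for j
  have fu: "(u, b) \<in> fractions ?N f"
    unfolding fractions_iff[OF f] using n one_homog by (auto simp: restrict_to_def twisted_free_def u_def b[unfolded One_nat_def])
  have eqN: "frac ?N f c k = frac ?N f (pscale s u) (k + b)"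
  proof -
    \<comment> \<open>The extra factor \<open>f\<close> is there because the other coordinates are
      known to vanish only where \<open>f\<close> does not.\<close>
    have "pscale (f ^ 1) (pscale (f ^ (k + b)) c - pscale (f ^ k) (pscale s u)) \<in> lower ?N"
    proof (rule restrict_twisted_lowerI)
      fix i assume "i \<notin> {1..n}"
      thus "pscale (f ^ 1) (pscale (f ^ (k + b)) c - pscale (f ^ k) (pscale s u)) i = 0"
        using c n by (auto simp: pscale_def u_def)
    next
      fix i w assume iw: "i \<in> {1..n}" "w \<in> L"
      show "mp_eval w (pscale (f ^ 1) (pscale (f ^ (k + b)) c - pscale (f ^ k) (pscale s u)) i) = 0"
      proof (cases "i = 1")
        case True
        thus ?thesis
          by (simp add: pscale_def u_def s_def power_add algebra_simps)
      next
        case False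
        hence "mp_eval w f * mp_eval w (c i) = 0"
          using van iw by auto
        thus ?thesis
          using False by (auto simp: pscale_def u_def)
      qed
    qed
    thus ?thesis
      using frac_eq_iff[OF N fc fractions_scale[OF N f s1 fu]] by blast
  qed
  have dist: "f \<in> distinguished"
    by (rule distinguishedI[OF f(1) _ f(2)]) simp
  have bij: "bij_betw (\<phi> f) (sections ?M f) (sections ?N f)"
    using iso dist by (simp add: is_sheaf_iso_def)
  have "frac ?N f u b \<in> sections ?N f"
    unfolding sections_iff using fu by blast
  hence "frac ?N f u b \<in> \<phi> f ` sections ?M f"
    using bij by (simp only: bij_betw_def)
  then obtain Z where Z: "Z \<in> sections ?M f" "\<phi> f Z = frac ?N f u b"
    by (metis imageE)
  then obtain m1 k1 where m1: "(m1, k1) \<in> fractions ?M f" "Z = frac ?M f m1 k1"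
    by (auto simp: sections_iff)
  \<comment> \<open>As \<open>Z\<close> is the preimage of the generator, linearity and injectivity
    make \<open>m / f ^ d\<close> equal to \<open>s / f ^ k\<close> times \<open>Z\<close>. Applying
    \<Lambda> then evaluates \<open>f\<close> to 1 and \<open>s\<close> to 0.\<close>
  have "\<phi> f (frac ?M f m d) = frac ?N f (pscale s u) (k + b)"
    using rep eqN by (simp add: represents_def)
  also have "\<dots> = sec_scale ?N f s k (\<phi> f Z)"
    by (simp add: Z(2) sec_scale_frac[OF N f s1 fu])
  also have "\<dots> = \<phi> f (sec_scale ?M f s k Z)"
    using iso[unfolded is_sheaf_iso_def, rule_format, OF dist] f(1) s1 Z(1) by simp
  also have "sec_scale ?M f s k Z = frac ?M f (pscale s m1) (k + k1)"
    by (simp add: m1(2) sec_scale_frac[OF M f s1 m1(1)])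
  finally have "\<phi> f (frac ?M f m d) = \<phi> f (frac ?M f (pscale s m1) (k + k1))" .
  moreover have fsm: "(pscale s m1, k + k1) \<in> fractions ?M f"
    by (rule fractions_scale[OF M f s1 m1(1)])
  moreover have "inj_on (\<phi> f) (sections ?M f)"
    using bij by (simp only: bij_betw_def)
  moreover have "frac ?M f m d \<in> sections ?M f" "frac ?M f (pscale s m1) (k + k1) \<in> sections ?M f"
    unfolding sections_iff using fm fsm by blast+
  ultimately have "frac ?M f m d = frac ?M f (pscale s m1) (k + k1)"
    by (simp only: inj_on_eq_iff)
  then obtain j where j: "pscale (f ^ j) (pscale (f ^ (k + k1)) m - pscale (f ^ d) (pscale s m1)) \<in> lower ?M"
    using frac_eq_iff[OF M fm fsm] by blast
  have m1u: "m1 \<in> log_derivations A"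
    using m1(1) by (simp add: fractions_iff[OF f] up)
  have "pscale (f ^ j) (pscale (f ^ (k + k1)) m - pscale (f ^ d) (pscale s m1)) =
      pscale (f ^ (j + k + k1)) m + pscale (- (f ^ (j + d) * s)) m1"
    by (auto simp: pscale_def power_add algebra_simps)
  hence "\<Lambda> (pscale (f ^ (j + k + k1)) m + pscale (- (f ^ (j + d) * s)) m1) = 0"
    using fibre_functional_lower[OF A \<Lambda> w(1) j] by simp
  moreover have "\<Lambda> (pscale (f ^ (j + k + k1)) m + pscale (- (f ^ (j + d) * s)) m1) =
      mp_eval w (f ^ (j + k + k1)) * \<Lambda> m + mp_eval w (- (f ^ (j + d) * s)) * \<Lambda> m1"
  proof -
    have "\<Lambda> (x + y) = \<Lambda> x + \<Lambda> y" if "x \<in> log_derivations A" "y \<in> log_derivations A" for x y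
      using \<Lambda> that unfolding fibre_functional_def by blast
    moreover have "\<Lambda> (pscale p x) = mp_eval w p * \<Lambda> x" if "x \<in> log_derivations A" for x p
      using \<Lambda> that unfolding fibre_functional_def by blast
    ultimately show ?thesis
      by (simp only: m(1) m1u pmod.subspace_scale[OF log_derivations_subspace[of A]])
  qed
  ultimately show ?thesis
    using w by (simp add: s_def)
qed

text \<open>On the overlap \<open>m / g ^ d\<close> is \<open>(f / g) ^ d\<close> times
  \<open>m / f ^ d\<close>. The isomorphism commutes with restriction and with this scaling, which
  yields the transition rule between the numerators in two charts.\<close>

lemma represents_glue:
  fixes f g :: "('n::finite, 'k::alg_closed_field) mpoly" and L :: "('k ^ 'n) set"
    and a :: "nat \<Rightarrow> int" and n :: nat
  defines "N \<equiv> restrict_to L (twisted_free n a)"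
  assumes M: "graded_module M" and iso: "is_sheaf_iso M N \<phi>"
    and f: "f \<in> homog 1" "f \<noteq> 0" and g: "g \<in> homog 1" "g \<noteq> 0"
    and m: "m \<in> upper M" "m \<in> grad M (int d)"
    and rep: "represents M N \<phi> f m d c k" "represents M N \<phi> g m d c' k'"
    and w: "w \<in> L" "mp_eval w f \<noteq> 0" "mp_eval w g \<noteq> 0"
  shows "mp_eval w f ^ d * mp_eval w g ^ k' * mp_eval w (c i) = mp_eval w f ^ k * mp_eval w g ^ d * mp_eval w (c' i)"
proof -
  note N = graded_module_restrict_twisted[of L n a, folded N_def]
  have fg: "f * g \<in> homog 2" "f * g \<noteq> 0"
    using homog_mult[OF f(1) g(1)] mpoly_no_zero_divisors[OF f(2) g(2)] by simp_all
  have fm: "(m, d) \<in> fractions M f" "(m, d) \<in> fractions M g"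
    using m by (simp_all add: fractions_iff[OF f] fractions_iff[OF g])
  have fc: "(c, k) \<in> fractions N f" "(c', k') \<in> fractions N g"
    using represents_fractions rep f g by blast+
  have dist: "f \<in> distinguished" "g \<in> distinguished" "f * g \<in> distinguished"
    using distinguishedI[OF f(1) _ f(2)] distinguishedI[OF g(1) _ g(2)] distinguishedI[OF fg(1) _ fg(2)] by simp_all
  have res: "\<phi> (f * g) (sec_restrict M f g X) = sec_restrict N f g (\<phi> f X)"
    if "f \<in> distinguished" "g \<in> distinguished" "X \<in> sections M f" for f g X
    using iso that by (simp add: is_sheaf_iso_def)
  have scal: "\<phi> f (sec_scale M f s j X) = sec_scale N f s j (\<phi> f X)"
    if "f \<in> distinguished" "f \<in> homog e" "s \<in> homog (int j * e)" "X \<in> sections M f" for f e s j X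
    using iso that by (simp add: is_sheaf_iso_def)
  \<comment> \<open>The function \<open>(f / g) ^ d\<close> has numerator \<open>f ^ (d + d)\<close>
    over the denominator \<open>(f * g) ^ d\<close>.\<close>
  have s: "f ^ (d + d) \<in> homog (int d * 2)"
    using homog_power[OF f(1), of "d + d"] by (simp add: mult.commute)
  let ?m1 = "frac M (f * g) (pscale (g ^ d) m) d" and ?m2 = "frac M (f * g) (pscale (f ^ d) m) d"
  have fr1: "(pscale (g ^ d) m, d) \<in> fractions M (f * g)"
    by (rule fractions_restrict[OF M f g fm(1)])
  have fr2: "(pscale (f ^ d) m, d) \<in> fractions M (f * g)"
    using fractions_restrict[OF M g f fm(2)] by (simp add: mult.commute)
  have "sec_scale M (f * g) (f ^ (d + d)) d ?m1 = frac M (f * g) (pscale (f ^ (d + d)) (pscale (g ^ d) m)) (d + d)"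
    by (rule sec_scale_frac[OF M fg s fr1])
  also have "\<dots> = ?m2"
  proof -
    have "pscale ((f * g) ^ d) (pscale (f ^ (d + d)) (pscale (g ^ d) m)) -
        pscale ((f * g) ^ (d + d)) (pscale (f ^ d) m) = 0"
      by (auto simp: pscale_def power_add power_mult_distrib mult_2 algebra_simps)
    hence "pscale ((f * g) ^ 0) (pscale ((f * g) ^ d) (pscale (f ^ (d + d)) (pscale (g ^ d) m)) -
        pscale ((f * g) ^ (d + d)) (pscale (f ^ d) m)) \<in> lower M"
      using M by (simp add: graded_module_def pmod.subspace_0)
    thus ?thesis
      using frac_eq_iff[OF M fractions_scale[OF M fg s fr1] fr2] by blast
  qed
  finally have eqM: "sec_scale M (f * g) (f ^ (d + d)) d ?m1 = ?m2" .
  have \<phi>1: "\<phi> (f * g) ?m1 = frac N (f * g) (pscale (g ^ k) c) k"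
  proof -
    have "\<phi> (f * g) (sec_restrict M f g (frac M f m d)) = sec_restrict N f g (\<phi> f (frac M f m d))"
      using fm by (intro res dist) (auto simp: sections_iff)
    thus ?thesis
      using rep(1) sec_restrict_frac[OF M f g fm(1)] sec_restrict_frac[OF N f g fc(1)]
      by (simp add: represents_def)
  qed
  have \<phi>2: "\<phi> (f * g) ?m2 = frac N (f * g) (pscale (f ^ k') c') k'"
  proof -
    have "\<phi> (g * f) (sec_restrict M g f (frac M g m d)) = sec_restrict N g f (\<phi> g (frac M g m d))"
      using fm by (intro res dist) (auto simp: sections_iff)
    thus ?thesis
      using rep(2) sec_restrict_frac[OF M g f fm(2)] sec_restrict_frac[OF N g f fc(2)]
      by (simp add: represents_def mult.commute)
  qed
  have fn1: "(pscale (g ^ k) c, k) \<in> fractions N (f * g)"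
    by (rule fractions_restrict[OF N f g fc(1)])
  have fn2: "(pscale (f ^ k') c', k') \<in> fractions N (f * g)"
    using fractions_restrict[OF N g f fc(2)] by (simp add: mult.commute)
  have "frac N (f * g) (pscale (f ^ k') c') k' = sec_scale N (f * g) (f ^ (d + d)) d (\<phi> (f * g) ?m1)"
    using scal[OF dist(3) fg(1) s, of ?m1] fr1 \<phi>2 eqM by (auto simp: sections_iff)
  also have "\<dots> = frac N (f * g) (pscale (f ^ (d + d)) (pscale (g ^ k) c)) (d + k)"
    unfolding \<phi>1 by (rule sec_scale_frac[OF N fg s fn1])
  finally obtain j where j: "pscale ((f * g) ^ j) (pscale ((f * g) ^ (d + k)) (pscale (f ^ k') c') -
      pscale ((f * g) ^ k') (pscale (f ^ (d + d)) (pscale (g ^ k) c))) \<in> lower N"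
    using frac_eq_iff[OF N fn2 fractions_scale[OF N fg s fn1]] by blast
  let ?F = "mp_eval w f" and ?G = "mp_eval w g" and ?C = "mp_eval w (c i)" and ?C' = "mp_eval w (c' i)"
  from restrict_twisted_lower_eval[OF j[unfolded N_def] w(1), of i]
  have "(?F * ?G) ^ (d + k) * (?F ^ k' * ?C') = (?F * ?G) ^ k' * (?F ^ (d + d) * (?G ^ k * ?C))"
    using w by (simp add: pscale_def)
  hence "(?F ^ (d + k') * ?G ^ k) * (?F ^ k * ?G ^ d * ?C') = (?F ^ (d + k') * ?G ^ k) * (?F ^ d * ?G ^ k' * ?C)"
    by (simp add: power_mult_distrib power_add mult_2 mult_ac)
  thus ?thesis
    using w by simp
qed

text \<open>Both sides come from the one element \<open>s * m' = r * m\<close>, by linearity over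
  regular functions. In this way the vanishing of coordinates passes from \<open>m\<close> to a
  field parallel to it.\<close>

lemma represents_parallel:
  fixes f :: "('n::finite, 'k::alg_closed_field) mpoly" and L :: "('k ^ 'n) set"
    and a :: "nat \<Rightarrow> int" and n :: nat
  defines "N \<equiv> restrict_to L (twisted_free n a)"
  assumes M: "graded_module M" and iso: "is_sheaf_iso M N \<phi>"
    and f: "f \<in> homog 1" "f \<noteq> 0"
    and m: "m \<in> upper M" "m \<in> grad M (int d)" and m': "m' \<in> upper M" "m' \<in> grad M (int d')"
    and rep: "represents M N \<phi> f m d c k" "represents M N \<phi> f m' d' c' k'"
    and s: "s \<in> homog (int d)" "r \<in> homog (int d')" "pscale s m' = pscale r m"
    and w: "w \<in> L" "mp_eval w f = 1"
  shows "mp_eval w s * mp_eval w (c' i) = mp_eval w r * mp_eval w (c i)"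
proof -
  note N = graded_module_restrict_twisted[of L n a, folded N_def]
  have s1: "s \<in> homog (int d * 1)" "r \<in> homog (int d' * 1)"
    using s by simp_all
  have dist: "f \<in> distinguished"
    using distinguishedI[OF f(1) _ f(2)] by simp
  have scal: "\<phi> f (sec_scale M f s j X) = sec_scale N f s j (\<phi> f X)"
    if "s \<in> homog (int j * 1)" "X \<in> sections M f" for s j X
    using iso dist f that unfolding is_sheaf_iso_def by blast
  have fm: "(m, d) \<in> fractions M f" "(m', d') \<in> fractions M f"
    using m m' by (simp_all add: fractions_iff[OF f])
  have fc: "(c, k) \<in> fractions N f" "(c', k') \<in> fractions N f"
    using represents_fractions rep f by blast+
  have "frac N f (pscale s c') (d + k') = sec_scale N f s d (\<phi> f (frac M f m' d'))"
    using rep(2) sec_scale_frac[OF N f s1(1) fc(2)] by (simp add: represents_def)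
  also have "\<dots> = \<phi> f (sec_scale M f s d (frac M f m' d'))"
    using scal[OF s1(1), of "frac M f m' d'"] fm by (auto simp: sections_iff)
  also have "sec_scale M f s d (frac M f m' d') = frac M f (pscale s m') (d + d')"
    by (rule sec_scale_frac[OF M f s1(1) fm(2)])
  also have "\<dots> = frac M f (pscale r m) (d' + d)"
    by (simp add: s(3) add.commute)
  also have "\<dots> = sec_scale M f r d' (frac M f m d)"
    by (rule sec_scale_frac[OF M f s1(2) fm(1), symmetric])
  also have "\<phi> f \<dots> = sec_scale N f r d' (\<phi> f (frac M f m d))"
    using scal[OF s1(2), of "frac M f m d"] fm by (auto simp: sections_iff)
  also have "\<dots> = frac N f (pscale r c) (d' + k)"
    using rep(1) sec_scale_frac[OF N f s1(2) fc(1)] by (simp add: represents_def)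
  finally obtain j where j: "pscale (f ^ j) (pscale (f ^ (d' + k)) (pscale s c') - pscale (f ^ (d + k')) (pscale r c)) \<in> lower N"
    using frac_eq_iff[OF N fractions_scale[OF N f s1(1) fc(2)] fractions_scale[OF N f s1(2) fc(1)]] by blast
  from restrict_twisted_lower_eval[OF j[unfolded N_def] w(1), of i] show ?thesis
    using w by (simp add: pscale_def)
qed

lemma homog_line_vanish:
  fixes p :: "('n::finite, 'k::alg_closed_field) mpoly"
  assumes p: "p \<in> homog e" and z: "\<And>t. mp_eval (t *s u + v) p = 0" and y: "y \<noteq> 0"
  shows "mp_eval (x *s u + y *s v) p = 0"
proof (cases "e < 0")
  case True
  thus ?thesis using p homog_negative[of e p] by simp
next
  case False
  then obtain e' where [simp]: "e = int e'"
    by (metis not_less zero_le_imp_eq_int)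
  have "x *s u + y *s v = y *s ((x / y) *s u + v)"
    using y by (simp add: vec_eq_iff field_simps)
  thus ?thesis
    using mp_eval_homog[of p e' y "(x / y) *s u + v"] p z by simp
qed

lemma line_poly_mp_eval: "poly (line_poly (\<lambda>w. mp_eval w p) v u) t = mp_eval (t *s u + v) p"
  by (simp add: poly_line_poly polyfun_mp_eval add.commute)

text \<open>A global section of \<open>\<O>(d - b)\<close> on the line is a form of degree \<open>d - b\<close>, so it vanishes if
  \<open>d < b\<close>; here \<open>p\<close> and \<open>p'\<close> are its numerators in the two charts.\<close>

lemma global_section_vanish:
  fixes p p' :: "('n::finite, 'k::alg_closed_field) mpoly"
  assumes p: "p \<in> homog (int k - b)" and d: "int d < b"
    and glue: "\<And>t. t \<noteq> 0 \<Longrightarrow> t ^ d * mp_eval (t *s u + v) p = t ^ k * mp_eval (t *s u + v) p'"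
  shows "mp_eval (t *s u + v) p' = 0"
proof -
  let ?P = "line_poly (\<lambda>w. mp_eval w p) v u" and ?P' = "line_poly (\<lambda>w. mp_eval w p') v u"
  have eq: "monom 1 d * ?P = monom 1 k * ?P'"
    by (rule poly_eqI_cofinite[of "{0}"]) (use glue in \<open>auto simp: poly_monom line_poly_mp_eval\<close>)
  have "?P' = 0"
  proof (rule ccontr)
    assume nz: "?P' \<noteq> 0"
    have nz': "?P \<noteq> 0"
    proof
      assume "?P = 0"
      hence "monom 1 k * ?P' = 0"
        using eq by simp
      thus False using nz by simp
    qed
    hence "p \<noteq> 0"
      by (auto simp: line_poly_const)
    hence "int k - b \<ge> 0"
      using p homog_negative[of "int k - b" p] by force
    then obtain r where r: "int k - b = int r"
      by (metis zero_le_imp_eq_int)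
    have "degree ?P \<le> r"
      by (rule line_poly_homogeneous(1)[OF polyfun_mp_eval]) (use p r mp_eval_homog in auto)
    moreover have "d + degree ?P = k + degree ?P'"
      using arg_cong[OF eq, of degree] nz nz' by (simp add: degree_mult_eq degree_monom_eq)
    ultimately show False
      using r d by linarith
  qed
  thus ?thesis
    using line_poly_mp_eval[of p' v u t] by simp
qed

lemma vanish_of_mult:
  fixes p s :: "('n::finite, 'k::alg_closed_field) mpoly"
  assumes "\<And>t. mp_eval (t *s u + v) s * mp_eval (t *s u + v) p = 0"
    and "line_poly (\<lambda>w. mp_eval w s) v u \<noteq> 0"
  shows "mp_eval (t *s u + v) p = 0"
proof -
  have "line_poly (\<lambda>w. mp_eval w s) v u * line_poly (\<lambda>w. mp_eval w p) v u = 0"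
    by (rule poly_eqI_all) (simp add: line_poly_mp_eval assms(1))
  hence "line_poly (\<lambda>w. mp_eval w p) v u = 0"
    using assms(2) by simp
  thus ?thesis
    using line_poly_mp_eval[of p v u t] by simp
qed

text \<open>The restriction of \<open>m\<close> to the line lies in the first summand because it is parallel to
  \<open>\<theta>\<close>, and as it vanishes nowhere its coordinate there is a nonzero constant.\<close>

lemma degree_of_parallel:
  fixes A :: "('k::alg_closed_field ^ 'n::finite) set set" and L :: "('k ^ 'n) set"
    and a :: "nat \<Rightarrow> int"
  defines "M \<equiv> restrict_to L (D0 A)"
  assumes A: "hyperplane_arrangement A"
    and L: "L = vec.span {u, v}"
    and dual: "dot \<alpha> u = 1" "dot \<alpha> v = 0" "dot \<beta> u = 0" "dot \<beta> v = 1"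
    and iso: "is_sheaf_iso M (restrict_to L (twisted_free n a)) \<phi>"
    and n: "2 \<le> n" and a: "0 \<le> a 1" "\<And>i. i \<in> {2..n} \<Longrightarrow> int d < a i"
    and \<theta>: "\<theta> \<in> log_derivations A" "\<theta> \<in> grad (D0 A) (int d)"
    and m: "m \<in> log_derivations A" "m \<in> grad (D0 A) (int d')"
    and s: "s \<in> homog (int d)" "r \<in> homog (int d')" "pscale s m = pscale r \<theta>" "mp_eval u s \<noteq> 0"
    and nonvan: "\<And>t. \<exists>\<Lambda>. fibre_functional A (t *s u + v) \<Lambda> \<and> \<Lambda> m \<noteq> 0"
      "\<exists>\<Lambda>. fibre_functional A u \<Lambda> \<and> \<Lambda> m \<noteq> 0"
  shows "int d' = a 1"
proof -
  let ?N = "restrict_to L (twisted_free n a)"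
  note gM = graded_module_restrict_D0[of L A, folded M_def]
  have up: "upper M = log_derivations A" "grad M = grad (D0 A)"
    by (simp_all add: M_def restrict_to_def D0_def)
  \<comment> \<open>Homogeneous coordinates on the line: the chart of \<open>g\<close> contains the
    points \<open>t *s u + v\<close>, that of \<open>f\<close> the points \<open>u + t *s v\<close>,
    and together they cover it.\<close>
  define f where "f = linform \<alpha>"
  define g where "g = linform \<beta>"
  have fe: "mp_eval (x *s u + y *s v) f = x" "mp_eval (x *s u + y *s v) g = y" for x y
    by (simp_all add: f_def g_def dot_add dot_scale dual)
  have fe1: "mp_eval (x *s u + v) f = x" "mp_eval (x *s u + v) g = 1"
    "mp_eval (u + x *s v) f = 1" "mp_eval (u + x *s v) g = x" "mp_eval u f = 1" for x
    by (simp_all add: f_def g_def dot_add dot_scale dual)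
  have f: "f \<in> homog 1" "f \<noteq> 0" and g: "g \<in> homog 1" "g \<noteq> 0"
    using linform_homog fe[of 1 1] mp_eval_0[of "1 *s u + 1 *s v"] unfolding f_def g_def by force+
  have inL: "x *s u + y *s v \<in> L" for x y
    unfolding L by (intro vec.span_add vec.span_scale vec.span_base) auto
  have inL1: "x *s u + v \<in> L" "u + x *s v \<in> L" "x *s v + u \<in> L" "u \<in> L" for x
    using inL[of x 1] inL[of 1 x] inL[of 1 0] by (simp_all add: add.commute)
  have Lxy: "\<exists>x y. w = x *s u + y *s v" if w: "w \<in> L" for w
  proof -
    obtain x y where "w - x *s u - y *s v = 0"
      using w unfolding L vec.span_insert vec.span_empty by blast
    thus ?thesis
      by (intro exI[of _ x] exI[of _ y]) (simp add: algebra_simps)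
  qed
  obtain c k where rc: "represents M ?N \<phi> f \<theta> d c k"
    using ex_represents[OF iso f, of \<theta> d] \<theta> by (auto simp: up)
  obtain c' k' where rc': "represents M ?N \<phi> g \<theta> d c' k'"
    using ex_represents[OF iso g, of \<theta> d] \<theta> by (auto simp: up)
  obtain e l where re: "represents M ?N \<phi> f m d' e l"
    using ex_represents[OF iso f, of m d'] m by (auto simp: up)
  obtain e' l' where re': "represents M ?N \<phi> g m d' e' l'"
    using ex_represents[OF iso g, of m d'] m by (auto simp: up)
  have hom: "c i \<in> homog (int k - a i)" if "i \<in> {1..n}" "represents M ?N \<phi> h x j c k" for i h x j c k
    using that by (simp add: represents_def restrict_to_def twisted_free_def)
  note glue = represents_glue[OF gM iso f g]
  \<comment> \<open>A coordinate of index at least 2 is a section of a line bundle of negative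
    degree \<open>d - a i\<close>; the two charts exchange roles in \<open>van\<close>.\<close>
  have van': "mp_eval (t *s u + v) (c' i) = 0" if i: "i \<in> {2..n}" for t i
  proof (rule global_section_vanish)
    show "c i \<in> homog (int k - a i)"
      using hom[OF _ rc, of i] i by simp
    show "int d < a i"
      by (rule a) (rule i)
    fix t :: 'k assume "t \<noteq> 0"
    thus "t ^ d * mp_eval (t *s u + v) (c i) = t ^ k * mp_eval (t *s u + v) (c' i)"
      using glue[of \<theta> d c k c' k' "t *s u + v" i] \<theta> rc rc' inL1 by (simp add: up fe1)
  qed
  have van: "mp_eval (t *s v + u) (c i) = 0" if i: "i \<in> {2..n}" for t i
  proof (rule global_section_vanish)
    show "c' i \<in> homog (int k' - a i)"
      using hom[OF _ rc', of i] i by simp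
    show "int d < a i"
      by (rule a) (rule i)
    fix t :: 'k assume "t \<noteq> 0"
    thus "t ^ d * mp_eval (t *s v + u) (c' i) = t ^ k' * mp_eval (t *s v + u) (c i)"
      using glue[of \<theta> d c k c' k' "u + t *s v" i] \<theta> rc rc' inL1 by (simp add: up fe1 add.commute)
  qed
  have ls: "line_poly (\<lambda>w. mp_eval w s) v u \<noteq> 0"
  proof -
    have "coeff (line_poly (\<lambda>w. mp_eval w s) v u) d = mp_eval u s"
      by (rule line_poly_homogeneous(2)[OF polyfun_mp_eval]) (rule mp_eval_homog[OF s(1)])
    thus ?thesis using s(4) by auto
  qed
  have ls': "line_poly (\<lambda>w. mp_eval w s) u v \<noteq> 0"
    using line_poly_mp_eval[of s u v 0] s(4) by auto
  \<comment> \<open>On the line \<open>s\<close> times a coordinate of \<open>m\<close> is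
    \<open>r\<close> times the one of \<theta>, hence zero, and the nonzero polynomial
    \<open>s\<close> cancels.\<close>
  have evan': "mp_eval (t *s u + v) (e' i) = 0" if i: "i \<in> {2..n}" for t i
  proof (rule vanish_of_mult[OF _ ls])
    fix t
    have "mp_eval (t *s u + v) s * mp_eval (t *s u + v) (e' i) = mp_eval (t *s u + v) r * mp_eval (t *s u + v) (c' i)"
      by (rule represents_parallel[OF gM iso g _ _ _ _ rc' re' s(1-3)])
         (use \<theta> m inL1 in \<open>auto simp: up fe1\<close>)
    thus "mp_eval (t *s u + v) s * mp_eval (t *s u + v) (e' i) = 0"
      using van'[OF i] by simp
  qed
  have evan: "mp_eval (t *s v + u) (e i) = 0" if i: "i \<in> {2..n}" for t i
  proof (rule vanish_of_mult[OF _ ls'])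
    fix t
    have "mp_eval (t *s v + u) s * mp_eval (t *s v + u) (e i) = mp_eval (t *s v + u) r * mp_eval (t *s v + u) (c i)"
      by (rule represents_parallel[OF gM iso f _ _ _ _ rc re s(1-3)])
         (use \<theta> m inL1 fe1 in \<open>auto simp: up add.commute\<close>)
    thus "mp_eval (t *s v + u) s * mp_eval (t *s v + u) (e i) = 0"
      using van[OF i] by simp
  qed
  \<comment> \<open>The factor \<open>g\<close> disposes of the points outside its chart; any other
    point is rescaled to have \<open>v\<close>-coordinate 1.\<close>
  have gvan: "mp_eval w g * mp_eval w (e' i) = 0" if i: "i \<in> {2..n}" and w: "w \<in> L" for i w
  proof -
    obtain x y where xy: "w = x *s u + y *s v"
      using Lxy[OF w] by blast
    show ?thesis
    proof (cases "y = 0")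
      case True
      hence "mp_eval w g = 0"
        using fe(2)[of x y] by (simp only: xy)
      thus ?thesis by simp
    next
      case False
      have "e' i \<in> homog (int l' - a i)"
        using hom[OF _ re', of i] i by simp
      from homog_line_vanish[OF this evan'[OF i] False] show ?thesis
        by (simp add: xy)
    qed
  qed
  have fvan: "mp_eval w f * mp_eval w (e i) = 0" if i: "i \<in> {2..n}" and w: "w \<in> L" for i w
  proof -
    obtain x y where xy: "w = x *s u + y *s v"
      using Lxy[OF w] by blast
    show ?thesis
    proof (cases "x = 0")
      case True
      hence "mp_eval w f = 0"
        using fe(1)[of x y] by (simp only: xy)
      thus ?thesis by simp
    next
      case False
      have "e i \<in> homog (int l - a i)"
        using hom[OF _ re, of i] i by simp
      from homog_line_vanish[OF this evan[OF i] False, of y] show ?thesis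
        by (simp add: xy add.commute)
    qed
  qed
  note zero = represents_zero[OF A iso[unfolded M_def] _ _ m _ _ a(1), folded M_def]
  have P: "mp_eval (t *s u + v) (e' 1) \<noteq> 0" for t
  proof
    assume 0: "mp_eval (t *s u + v) (e' 1) = 0"
    have "\<Lambda> m = 0" if "fibre_functional A (t *s u + v) \<Lambda>" for \<Lambda>
      by (rule zero[OF g re' _ gvan inL1(1) fe1(2) 0 that]) (use n in auto)
    thus False
      using nonvan(1)[of t] by blast
  qed
  have Q0: "mp_eval u (e 1) \<noteq> 0"
  proof
    assume 0: "mp_eval u (e 1) = 0"
    have "\<Lambda> m = 0" if "fibre_functional A u \<Lambda>" for \<Lambda>
      by (rule zero[OF f re _ fvan inL1(4) fe1(5) 0 that]) (use n in auto)
    thus False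
      using nonvan(2) by blast
  qed
  let ?P = "line_poly (\<lambda>w. mp_eval w (e' 1)) v u"
  have "degree ?P = 0"
  proof (rule ccontr)
    assume "degree ?P \<noteq> 0"
    then obtain t where "poly ?P t = 0"
      using alg_closed_imp_poly_has_root[of ?P] by auto
    thus False
      using P[of t] by (simp add: line_poly_mp_eval)
  qed
  then obtain \<kappa> where \<kappa>: "?P = [:\<kappa>:]"
    by (rule degree_eq_zeroE)
  have P\<kappa>: "mp_eval (t *s u + v) (e' 1) = \<kappa>" for t
    using line_poly_mp_eval[of "e' 1" v u t] unfolding \<kappa> by simp
  have e'1: "e' 1 \<in> homog (int l' - a 1)"
    using hom[OF _ re', of 1] n by simp
  moreover have "e' 1 \<noteq> 0"
    using P[of 0] by auto
  ultimately have "int l' - a 1 \<ge> 0"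
    using homog_negative[of "int l' - a 1" "e' 1"] by force
  then obtain b where b: "int l' - a 1 = int b"
    by (metis zero_le_imp_eq_int)
  let ?Q = "line_poly (\<lambda>w. mp_eval w (e 1)) u v"
  \<comment> \<open>In the chart of \<open>f\<close> the form \<open>e' 1\<close> of degree
    \<open>b\<close> is \<kappa> times \<open>y ^ b\<close>, and the transition rule adds
    \<open>d'\<close> to the exponent. As \<open>?Q\<close> does not vanish at 0, comparing powers
    of \<open>y\<close> yields \<open>l' = d' + b\<close>.\<close>
  have "monom 1 l' * ?Q = monom \<kappa> (d' + b)"
  proof (rule poly_eqI_cofinite[of "{0}"])
    fix y :: 'k assume "y \<notin> {0}"
    hence y: "y \<noteq> 0" by simp
    have w: "u + y *s v = y *s (inverse y *s u + v)"
      using y by (simp add: vec_eq_iff algebra_simps)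
    have "mp_eval (u + y *s v) (e' 1) = y ^ b * \<kappa>"
      unfolding w using mp_eval_homog[of "e' 1" b] e'1 b P\<kappa> by simp
    moreover have "y ^ l' * mp_eval (u + y *s v) (e 1) = y ^ d' * mp_eval (u + y *s v) (e' 1)"
      using glue[of m d' e l e' l' "u + y *s v" 1] m re re' inL1 y by (simp add: up fe1)
    ultimately have "y ^ l' * mp_eval (u + y *s v) (e 1) = \<kappa> * y ^ (d' + b)"
      by (simp add: power_add mult_ac)
    thus "poly (monom 1 l' * ?Q) y = poly (monom \<kappa> (d' + b)) y"
      by (simp add: poly_monom line_poly_mp_eval add.commute)
  qed simp
  hence "coeff (monom 1 l' * ?Q) l' = coeff (monom \<kappa> (d' + b)) l'"
    by simp
  moreover have "coeff ?Q 0 = mp_eval u (e 1)"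
    by (simp add: coeff_0_line_poly polyfun_mp_eval)
  ultimately have "l' = d' + b"
    using Q0 by (auto simp: coeff_monom_mult split: if_splits)
  thus ?thesis
    using b by simp
qed

section \<open>Minimal homogeneous generators\<close>

definition hpart :: "nat \<Rightarrow> ('n::finite, 'k::comm_ring_1) mpoly \<Rightarrow> ('n, 'k) mpoly" where
  "hpart k p = reweight (\<lambda>m. of_bool (mdeg m = k)) p"

lemma lookup_hpart: "lookup (hpart k p) m = (if mdeg m = k then lookup p m else 0)"
  by (simp add: hpart_def lookup_reweight)

lemma hpart_0_left: "hpart 0 p = Const (lookup p 0)"
proof (rule poly_mapping_eqI)
  fix m :: "'a \<Rightarrow>\<^sub>0 nat"
  have "mdeg m = 0 \<longleftrightarrow> m = 0"
    by (auto intro!: poly_mapping_eqI)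
  thus "lookup (hpart 0 p) m = lookup (Const (lookup p 0)) m"
    by (simp add: lookup_hpart Const_def lookup_single when_def)
qed

lemma Const_1: "Const 1 = 1"
  by (simp add: Const_def)

lemma Const_add: "Const (a + b) = Const a + Const b"
  and Const_mult: "Const (a * b) = Const a * Const b"
  by (simp_all add: Const_def single_add mult_single)

lemma pscale_vector_space:
  "vector_space (\<lambda>c x. pscale (Const c) x :: 'i \<Rightarrow> ('n, 'k::field) mpoly)"
  by unfold_locales (auto simp: pscale_def Const_add Const_mult Const_1 algebra_simps)

text \<open>Graded Nakayama: in each degree \<open>k\<close> choose a basis of a complement, over the ground field, of
  the part \<open>W k\<close> generated in lower degrees.\<close>

lemma graded_minimal_generators:
  fixes M :: "('i, 'n::finite, 'k::field) grmod"
    and hc :: "nat \<Rightarrow> ('i \<Rightarrow> ('n, 'k) mpoly) \<Rightarrow> ('i \<Rightarrow> ('n, 'k) mpoly)"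
  assumes U: "pmod.subspace (upper M)" and Lw: "pmod.subspace (lower M)" "lower M \<subseteq> upper M"
    and gr: "\<And>d. 0 \<in> grad M d" "\<And>d x y. x \<in> grad M d \<Longrightarrow> y \<in> grad M d \<Longrightarrow> x + y \<in> grad M d"
      "\<And>d x c. x \<in> grad M d \<Longrightarrow> pscale (Const c) x \<in> grad M d"
    and hc_mem: "\<And>k x. x \<in> upper M \<Longrightarrow> hc k x \<in> upper M \<inter> grad M (int k)"
    and hc_lower: "\<And>k x. x \<in> lower M \<Longrightarrow> hc k x \<in> lower M"
    and hc_add: "\<And>k x y. x \<in> upper M \<Longrightarrow> y \<in> upper M \<Longrightarrow> hc k (x + y) = hc k x + hc k y"
    and hc_scale: "\<And>k j s x. x \<in> upper M \<Longrightarrow> x \<in> grad M (int j) \<Longrightarrow>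
      hc k (pscale s x) = (if j \<le> k then pscale (hpart (k - j) s) x else 0)"
    and hc_sum: "\<And>x. x \<in> upper M \<Longrightarrow> \<exists>N. x = (\<Sum>k\<le>N. hc k x)"
    and X: "X \<in> upper M" "X \<in> grad M (int d)" "X \<notin> lower M"
    and least: "\<And>j x. j < d \<Longrightarrow> x \<in> upper M \<Longrightarrow> x \<in> grad M (int j) \<Longrightarrow> x \<in> lower M"
  shows "has_minimal_generator_in_degree M (int d)"
proof -
  interpret vs: vector_space "\<lambda>c x. pscale (Const c) x :: 'i \<Rightarrow> ('n, 'k) mpoly"
    by (rule pscale_vector_space)
  have vs_sub: "vs.subspace S" if "pmod.subspace S" for S
    using that by (auto simp: vs.subspace_def pmod.subspace_def)
  define V where "V k = upper M \<inter> grad M (int k)" for k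
  have Vsub: "vs.subspace (V k)" for k
    using vs_sub[OF U] gr by (auto simp: V_def vs.subspace_def)
  define W where "W k = V k \<inter> pmod.span ((\<Union>j<k. V j) \<union> lower M)" for k
  have Wsub: "vs.subspace (W k)" for k
    unfolding W_def by (intro vs.subspace_inter Vsub vs_sub pmod.subspace_span)
  have "\<exists>C B. C \<subseteq> W k \<and> W k \<subseteq> vs.span C \<and> B \<subseteq> V k \<and> C \<inter> B = {} \<and>
      vs.independent (C \<union> B) \<and> V k \<subseteq> vs.span (C \<union> B)" for k
  proof -
    obtain C where C: "C \<subseteq> W k" "vs.independent C" "W k \<subseteq> vs.span C"
      using vs.maximal_independent_subset by blast
    obtain B' where B': "C \<subseteq> B'" "B' \<subseteq> V k" "vs.independent B'" "V k \<subseteq> vs.span B'"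
      using vs.maximal_independent_subset_extend[of C "V k"] C by (auto simp: W_def)
    have "C \<union> (B' - C) = B'"
      using B' by auto
    thus ?thesis
      using C B' by (intro exI[of _ C] exI[of _ "B' - C"]) auto
  qed
  then obtain C B where CB: "\<And>k. C k \<subseteq> W k" "\<And>k. W k \<subseteq> vs.span (C k)" "\<And>k. B k \<subseteq> V k"
    "\<And>k. C k \<inter> B k = {}" "\<And>k. vs.independent (C k \<union> B k)" "\<And>k. V k \<subseteq> vs.span (C k \<union> B k)"
    by metis
  define G where "G = coset M ` (\<Union>k. B k)"
  have BU: "b \<in> upper M" if "b \<in> B k" for b k
    using that CB(3) by (auto simp: V_def)
  have cosetU: "y \<in> upper M" if "y \<in> coset M b" "b \<in> upper M" for y b
  proof -
    have "(y - b) + b \<in> upper M"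
      using that Lw(2) by (intro pmod.subspace_add[OF U]) (auto simp: coset_def)
    thus ?thesis by simp
  qed
  have genU: "pmod.span (\<Union>G' \<union> lower M) \<subseteq> upper M" if "G' \<subseteq> G" for G'
    using that BU cosetU Lw(2) by (intro pmod.span_minimal[OF _ U]) (auto simp: G_def)
  have gens: "generates M G"
    unfolding generates_def
  proof (rule subset_antisym[OF genU[OF subset_refl]])
    let ?S = "pmod.span (\<Union>G \<union> lower M)"
    have low: "lower M \<subseteq> ?S"
      using pmod.span_superset[of "\<Union>G \<union> lower M"] by auto
    have BS: "B k \<subseteq> ?S" for k
    proof
      fix b assume "b \<in> B k"
      moreover have "b \<in> coset M b"
        using pmod.subspace_0[OF Lw(1)] by (simp add: coset_def)
      ultimately show "b \<in> ?S"
        by (intro pmod.span_base) (auto simp: G_def)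
    qed
    have VS: "V k \<subseteq> ?S" for k
    proof (induction k rule: less_induct)
      case (less k)
      have "pmod.span ((\<Union>j<k. V j) \<union> lower M) \<subseteq> ?S"
        using less low by (intro pmod.span_minimal pmod.subspace_span) auto
      hence "C k \<subseteq> ?S"
        using CB(1)[of k] by (auto simp: W_def)
      hence "vs.span (C k \<union> B k) \<subseteq> ?S"
        using BS[of k] by (intro vs.span_minimal vs_sub pmod.subspace_span) auto
      thus ?case
        using CB(6) by blast
    qed
    show "upper M \<subseteq> ?S"
    proof
      fix x assume x: "x \<in> upper M"
      then obtain N where N: "x = (\<Sum>k\<le>N. hc k x)"
        using hc_sum by blast
      have "(\<Sum>k\<le>N. hc k x) \<in> ?S"
        by (rule pmod.span_sum) (use hc_mem[OF x] VS in \<open>auto simp: V_def\<close>)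
      thus "x \<in> ?S"
        using N by simp
    qed
  qed
  have "\<not> generates M G'" if G': "G' \<subset> G" for G'
  proof
    assume "generates M G'"
    hence span: "pmod.span (\<Union>G' \<union> lower M) = upper M"
      by (simp add: generates_def)
    obtain b k where b: "b \<in> B k" "coset M b \<notin> G'"
      using G' by (auto simp: G_def)
    \<comment> \<open>The degree \<open>k\<close> component of everything generated by
      \<open>G'\<close> is shown to lie in \<open>T\<close>. In particular \<open>b\<close> does,
      against the independence of the basis.\<close>
    define T where "T = vs.span (C k \<union> {b'\<in>B k. coset M b' \<in> G'})"
    have Tsub: "vs.subspace T"
      unfolding T_def by (rule vs.subspace_span)
    have WT: "W k \<subseteq> T"
      unfolding T_def using CB(2)[of k] vs.span_mono[of "C k"] by blast
    have lowT: "hc k y \<in> T" if "y \<in> lower M" for y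
    proof -
      have "hc k y \<in> W k"
        unfolding W_def V_def using hc_mem[of y k] hc_lower[of y k] that Lw(2)
        by (auto intro: pmod.span_base)
      thus ?thesis using WT by blast
    qed
    have BT: "hc k (pscale s b') \<in> T" if b': "b' \<in> B j" "coset M b' \<in> G'" for s b' j
    proof -
      have b'V: "b' \<in> upper M" "b' \<in> grad M (int j)"
        using b' CB(3)[of j] by (auto simp: V_def)
      note hcs = hc_scale[OF b'V, of k s]
      \<comment> \<open>A multiple of a generator contributes to degree \<open>k\<close> an element
        of \<open>W k\<close> if the generator has smaller degree, a scalar multiple if the degree
        is equal, and nothing if it is larger.\<close>
      consider "j < k" | "j = k" | "k < j"
        by linarith
      thus ?thesis
      proof cases
        case 1
        have "hc k (pscale s b') \<in> V k"
          unfolding V_def using b'V(1) U by (intro hc_mem pmod.subspace_scale)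
        moreover have "pscale (hpart (k - j) s) b' \<in> pmod.span ((\<Union>j<k. V j) \<union> lower M)"
          using b'V 1 by (intro pmod.span_scale pmod.span_base) (auto simp: V_def)
        ultimately have "hc k (pscale s b') \<in> W k"
          using hcs 1 by (simp add: W_def)
        thus ?thesis using WT by blast
      next
        case 2
        hence "hc k (pscale s b') = pscale (Const (lookup s 0)) b'"
          using hcs by (simp add: hpart_0_left)
        moreover have "b' \<in> T"
          unfolding T_def using b' 2 by (intro vs.span_base) auto
        ultimately show ?thesis
          using vs.subspace_scale[OF Tsub] by simp
      next
        case 3
        thus ?thesis
          using hcs vs.subspace_0[OF Tsub] by simp
      qed
    qed
    have stepT: "hc k (pscale s y) \<in> T" if y: "y \<in> \<Union>G' \<union> lower M" for s y
    proof (cases "y \<in> lower M")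
      case True
      thus ?thesis
        by (intro lowT pmod.subspace_scale Lw)
    next
      case False
      then obtain g where g: "g \<in> G'" "y \<in> g"
        using y by blast
      have "g \<in> coset M ` (\<Union>k. B k)"
        using g(1) G' by (auto simp: G_def)
      then obtain b' j where "b' \<in> B j" "g = coset M b'"
        by blast
      with g have b': "b' \<in> B j" "coset M b' \<in> G'" "y \<in> coset M b'"
        by simp_all
      have l: "y - b' \<in> lower M"
        using b' by (simp add: coset_def)
      hence ls: "pscale s (y - b') \<in> lower M"
        by (intro pmod.subspace_scale Lw)
      have "hc k (pscale s y) = hc k (pscale s b' + pscale s (y - b'))"
        by (simp add: pmod.scale_right_diff_distrib)
      also have "\<dots> = hc k (pscale s b') + hc k (pscale s (y - b'))"
        using ls Lw(2) by (intro hc_add pmod.subspace_scale[OF U BU[OF b'(1)]]) blast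
      finally show ?thesis
        using BT[OF b'(1,2)] lowT[OF ls] vs.subspace_add[OF Tsub] by simp
    qed
    have "x \<in> upper M \<and> hc k x \<in> T" if "x \<in> pmod.span (\<Union>G' \<union> lower M)" for x
      using that
    proof (induction rule: pmod.span_induct_alt)
      case base
      have "0 \<in> lower M"
        by (rule pmod.subspace_0[OF Lw(1)])
      thus ?case
        using lowT Lw(2) by blast
    next
      case (step c y z)
      have "y \<in> pmod.span (\<Union>G' \<union> lower M)"
        by (rule pmod.span_base[OF step(1)])
      hence y: "pscale c y \<in> upper M"
        unfolding span by (rule pmod.subspace_scale[OF U])
      have eq: "hc k (pscale c y + z) = hc k (pscale c y) + hc k z"
        using y step(2) by (intro hc_add) blast+
      have "pscale c y + z \<in> upper M"
        using step(2) by (intro pmod.subspace_add[OF U y]) blast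
      moreover have "hc k (pscale c y + z) \<in> T"
        unfolding eq using step(2) by (intro vs.subspace_add[OF Tsub stepT[OF step(1)]]) blast
      ultimately show ?case by blast
    qed
    hence "hc k b \<in> T"
      using BU[OF b(1)] span by blast
    moreover have "hc k b = b"
    proof -
      have "hc k (pscale 1 b) = pscale (hpart (k - k) 1) b"
        using hc_scale[of b k k 1] b(1) CB(3)[of k] by (auto simp: V_def)
      thus ?thesis
        by (simp add: hpart_0_left Const_1)
    qed
    ultimately have bT: "b \<in> T"
      by simp
    have "T \<subseteq> vs.span ((C k \<union> B k) - {b})"
      unfolding T_def using b CB(4)[of k] by (intro vs.span_mono) auto
    hence "vs.dependent (C k \<union> B k)"
      using bT b(1) unfolding vs.dependent_def by blast
    thus False
      using CB(5) by blast
  qed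
  moreover have "G \<subseteq> (\<Union>d. homog_elements M d)"
    using CB(3) by (fastforce simp: G_def homog_elements_def V_def)
  ultimately have "minimal_homog_generators M G"
    using gens by (simp add: minimal_homog_generators_def)
  \<comment> \<open>The module is zero below degree \<open>d\<close>, so \<open>W d\<close> lies in
    \<open>lower M\<close> and cannot contain \<open>X\<close>.\<close>
  moreover have "B d \<noteq> {}"
  proof
    assume "B d = {}"
    hence "X \<in> vs.span (C d)"
      using CB(6)[of d] X by (auto simp: V_def)
    also have "vs.span (C d) \<subseteq> W d"
      by (rule vs.span_minimal[OF CB(1) Wsub])
    also have "W d \<subseteq> pmod.span ((\<Union>j<d. V j) \<union> lower M)"
      by (simp add: W_def)
    also have "\<dots> \<subseteq> lower M"
      using least by (intro pmod.span_minimal[OF _ Lw(1)]) (auto simp: V_def)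
    finally show False
      using X(3) by blast
  qed
  then obtain b where "b \<in> B d" by blast
  hence "coset M b \<in> G \<inter> homog_elements M (int d)"
    using CB(3)[of d] by (auto simp: G_def homog_elements_def V_def)
  ultimately show ?thesis
    unfolding has_minimal_generator_in_degree_def by blast
qed

section \<open>Homogeneous components of derivations\<close>

lemma hpart_homog: "hpart k p \<in> homog (int k)"
  by (simp add: homog_iff lookup_hpart del: of_nat_sum)

lemma hpart_add: "hpart k (p + q) = hpart k p + hpart k q"
  by (rule poly_mapping_eqI) (simp add: lookup_hpart lookup_add)

text \<open>Scaling a point by \<open>s\<close> multiplies the part of degree \<open>k\<close> by
  \<open>s ^ k\<close>. Identities along lines through the origin thereby pass to homogeneous
  parts.\<close>

lemma mp_eval_hpart:
  fixes p :: "('n::finite, 'k::alg_closed_field) mpoly"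
  shows "mp_eval x (hpart k p) = coeff (line_poly (\<lambda>w. mp_eval w p) 0 x) k"
proof -
  have "line_poly (\<lambda>w. mp_eval w p) 0 x =
      (\<Sum>m\<in>keys p. monom (lookup p m * mono_eval x m) (mdeg m))"
    by (rule line_poly_unique)
       (simp add: poly_sum poly_monom mp_eval_def mono_eval_scale mult_ac del: vector_smult_component)
  thus ?thesis
    by (auto simp: hpart_def mp_eval_reweight coeff_sum intro!: sum.cong)
qed

lemma hpart_mult_homog:
  fixes p q :: "('n::finite, 'k::alg_closed_field) mpoly"
  assumes "q \<in> homog (int j)"
  shows "hpart k (p * q) = (if j \<le> k then hpart (k - j) p * q else 0)"
proof (rule mp_eval_inject)
  fix x
  have "line_poly (\<lambda>w. mp_eval w q) 0 x = monom (mp_eval x q) j"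
    by (rule line_poly_unique) (simp add: poly_monom mp_eval_homog[OF assms])
  hence "line_poly (\<lambda>w. mp_eval w (p * q)) 0 x = monom (mp_eval x q) j * line_poly (\<lambda>w. mp_eval w p) 0 x"
    by (simp add: line_poly_mult polyfun_mp_eval)
  thus "mp_eval x (hpart k (p * q)) = mp_eval x (if j \<le> k then hpart (k - j) p * q else 0)"
    by (auto simp: mp_eval_hpart coeff_monom_mult)
qed

lemma ex_sum_hpart: "\<exists>N. \<forall>N'\<ge>N. p = (\<Sum>k\<le>N'. hpart k p)"
proof -
  define N where "N = (\<Sum>m\<in>keys p. mdeg m)"
  have "p = (\<Sum>k\<le>N'. hpart k p)" if "N' \<ge> N" for N'
  proof (rule poly_mapping_eqI)
    fix m
    show "lookup p m = lookup (\<Sum>k\<le>N'. hpart k p) m"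
    proof (cases "m \<in> keys p")
      case True
      hence "mdeg m \<le> N"
        unfolding N_def by (intro member_le_sum) auto
      thus ?thesis
        using that by (simp add: lookup_sum lookup_hpart)
    next
      case False
      thus ?thesis
        by (simp add: lookup_sum lookup_hpart in_keys_iff)
    qed
  qed
  thus ?thesis by blast
qed

definition hcomp ::
  "nat \<Rightarrow> (('n::finite, 'k::field) mpoly \<Rightarrow> ('n, 'k) mpoly) \<Rightarrow> ('n, 'k) mpoly \<Rightarrow> ('n, 'k) mpoly" where
  "hcomp k \<theta> = der_of (\<lambda>i. hpart k (\<theta> (Var i)))"

lemma hcomp_Var [simp]: "hcomp k \<theta> (Var i) = hpart k (\<theta> (Var i))"
  by (simp add: hcomp_def)

lemma hcomp_derivation: "hcomp k \<theta> \<in> derivations"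
  by (simp add: hcomp_def der_of_derivation)

lemma grad_D0_iff:
  fixes A :: "('k::alg_closed_field ^ 'n::finite) set set"
  assumes "\<theta> \<in> derivations"
  shows "\<theta> \<in> grad (D0 A) d \<longleftrightarrow> (\<forall>i. \<theta> (Var i) \<in> homog d)"
  using derivations_homog[OF assms] Var_homog by (auto simp: D0_def)

lemma grad_D0_iff_vfield:
  fixes A :: "('k::alg_closed_field ^ 'n::finite) set set"
  assumes "\<theta> \<in> derivations"
  shows "\<theta> \<in> grad (D0 A) (int d) \<longleftrightarrow> (\<forall>c x. vfield \<theta> (c *s x) = c ^ d *s vfield \<theta> x)"
proof
  assume "\<theta> \<in> grad (D0 A) (int d)"
  thus "\<forall>c x. vfield \<theta> (c *s x) = c ^ d *s vfield \<theta> x"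
    using assms by (simp add: grad_D0_iff vfield_def vec_eq_iff mp_eval_homog)
next
  assume *: "\<forall>c x. vfield \<theta> (c *s x) = c ^ d *s vfield \<theta> x"
  have "mp_eval (c *s x) (\<theta> (Var i)) = c ^ d * mp_eval x (\<theta> (Var i))" for c x i
    using arg_cong[OF *[rule_format, of c x], of "\<lambda>v. v $ i"] by (simp add: vfield_def)
  thus "\<theta> \<in> grad (D0 A) (int d)"
    using assms by (auto simp: grad_D0_iff intro: homogI)
qed

lemma D0_simps: "upper (D0 A) = log_derivations A" "lower (D0 A) = pmod.span {euler}"
  by (simp_all add: D0_def)

lemma log_derivations_derivations: "\<theta> \<in> log_derivations A \<Longrightarrow> \<theta> \<in> derivations"
  by (simp add: log_derivations_def)

lemma span_euler: "\<theta> \<in> pmod.span {euler} \<longleftrightarrow> (\<exists>p. \<theta> = pscale p euler)"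
  by (auto simp: pmod.span_singleton)

lemma euler_derivation: "euler \<in> derivations"
  by (simp add: euler_eq_der_of der_of_derivation)

lemma euler_grad:
  fixes A :: "('k::alg_closed_field ^ 'n::finite) set set"
  shows "euler \<in> grad (D0 A) 1"
  using grad_D0_iff_vfield[OF euler_derivation, of A 1] by (simp add: vfield_euler)

text \<open>A hyperplane contains the line from the origin to each of its points. On it the
  component of \<theta> across the hyperplane vanishes identically in the parameter, hence
  coefficient by coefficient.\<close>

lemma hcomp_log_derivation:
  fixes A :: "('k::alg_closed_field ^ 'n::finite) set set"
  assumes A: "hyperplane_arrangement A" and \<theta>: "\<theta> \<in> log_derivations A"
  shows "hcomp k \<theta> \<in> log_derivations A"
  unfolding log_derivations_iff[OF A]
proof (intro conjI ballI hcomp_derivation)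
  fix K x assume K: "K \<in> A" "x \<in> K"
  obtain \<alpha> where \<alpha>: "K = {x. dot \<alpha> x = 0}"
    using A K hyperplane_eq_kernel by (auto simp: hyperplane_arrangement_def)
  have "dot \<alpha> (vfield (hcomp k \<theta>) x) = (\<Sum>i\<in>UNIV. \<alpha> $ i * coeff (line_poly (\<lambda>w. vfield \<theta> w $ i) 0 x) k)"
    by (simp add: dot_def vfield_def mp_eval_hpart)
  also have "\<dots> = coeff (line_poly (\<lambda>w. dot \<alpha> (vfield \<theta> w)) 0 x) k"
    unfolding dot_def using polyfun_vfield[of \<theta>]
    by (simp add: line_poly_sum line_poly_mult line_poly_const polyfun_const polyfun_mult coeff_sum)
  also have "line_poly (\<lambda>w. dot \<alpha> (vfield \<theta> w)) 0 x = 0"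
  proof (rule line_poly_unique)
    fix s
    have "s *s x \<in> K"
      using K by (simp add: \<alpha> dot_scale)
    hence "vfield \<theta> (s *s x) \<in> K"
      using \<theta> K unfolding log_derivations_iff[OF A] by blast
    thus "poly 0 s = dot \<alpha> (vfield \<theta> (0 + s *s x))"
      by (simp add: \<alpha>)
  qed
  finally show "vfield (hcomp k \<theta>) x \<in> K"
    by (simp add: \<alpha>)
qed

lemma hcomp_scale:
  fixes A :: "('k::alg_closed_field ^ 'n::finite) set set"
  assumes "\<theta> \<in> derivations" "\<theta> \<in> grad (D0 A) (int j)"
  shows "hcomp k (pscale s \<theta>) = (if j \<le> k then pscale (hpart (k - j) s) \<theta> else 0)"
proof (rule derivations_eqI[OF hcomp_derivation])
  show "(if j \<le> k then pscale (hpart (k - j) s) \<theta> else 0) \<in> derivations"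
    using pmod.subspace_scale[OF derivations_subspace assms(1)] pmod.subspace_0[OF derivations_subspace]
    by metis
  fix i
  have "\<theta> (Var i) \<in> homog (int j)"
    using assms grad_D0_iff by blast
  from hpart_mult_homog[OF this, of k s]
  show "hcomp k (pscale s \<theta>) (Var i) = (if j \<le> k then pscale (hpart (k - j) s) \<theta> else 0) (Var i)"
    by (simp add: pscale_def)
qed

lemma D0_minimal_generator:
  fixes A :: "('k::alg_closed_field ^ 'n::finite) set set"
  assumes A: "hyperplane_arrangement A"
    and X: "X \<in> log_derivations A" "X \<in> grad (D0 A) (int d)" "X \<notin> lower (D0 A)"
    and least: "\<And>j x. j < d \<Longrightarrow> x \<in> log_derivations A \<Longrightarrow> x \<in> grad (D0 A) (int j) \<Longrightarrow> x \<in> lower (D0 A)"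
  shows "has_minimal_generator_in_degree (D0 A) (int d)"
proof (rule graded_minimal_generators[where hc = hcomp and X = X])
  note sub = log_derivations_subspace[of A]
  note dersub = derivations_subspace
  show "pmod.subspace (upper (D0 A))" "pmod.subspace (lower (D0 A))"
    using sub by (simp_all add: D0_simps pmod.subspace_span)
  show "lower (D0 A) \<subseteq> upper (D0 A)"
    using euler_log_derivation[OF A] sub by (simp add: D0_simps pmod.span_minimal)
  show "0 \<in> grad (D0 A) e" for e
    by (simp add: D0_def)
  show "x + y \<in> grad (D0 A) e" if "x \<in> grad (D0 A) e" "y \<in> grad (D0 A) e" for e x y
    using that by (auto simp: D0_def intro: homog_add)
  show "pscale (Const c) x \<in> grad (D0 A) e" if "x \<in> grad (D0 A) e" for e x c
    using that homog_mult[OF Const_homog] by (force simp: D0_def pscale_def)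
  show "hcomp k x \<in> upper (D0 A) \<inter> grad (D0 A) (int k)" if "x \<in> upper (D0 A)" for k x
    using that hcomp_log_derivation[OF A]
    by (simp add: D0_simps grad_D0_iff[OF hcomp_derivation] hpart_homog)
  show "hcomp k (pscale s x) = (if j \<le> k then pscale (hpart (k - j) s) x else 0)"
    if "x \<in> upper (D0 A)" "x \<in> grad (D0 A) (int j)" for k j s x
    using that by (intro hcomp_scale log_derivations_derivations[of _ A]) (auto simp: D0_simps)
  show "hcomp k x \<in> lower (D0 A)" if x: "x \<in> lower (D0 A)" for k x
  proof -
    obtain p where "x = pscale p euler"
      using x unfolding D0_simps span_euler by blast
    moreover have "euler \<in> grad (D0 A) (int 1)"
      using euler_grad[of A] by simp
    ultimately have "hcomp k x = (if 1 \<le> k then pscale (hpart (k - 1) p) euler else 0)"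
      by (simp only: hcomp_scale[OF euler_derivation])
    thus ?thesis
      unfolding D0_simps by (metis insertI1 pmod.span_base pmod.span_scale pmod.span_zero)
  qed
  show "hcomp k (x + y) = hcomp k x + hcomp k y" if "x \<in> upper (D0 A)" "y \<in> upper (D0 A)" for k x y
  proof (rule derivations_eqI[OF hcomp_derivation])
    show "hcomp k x + hcomp k y \<in> derivations"
      by (intro pmod.subspace_add[OF dersub] hcomp_derivation)
    show "hcomp k (x + y) (Var i) = (hcomp k x + hcomp k y) (Var i)" for i
      by (simp add: hpart_add)
  qed
  show "\<exists>N. x = (\<Sum>k\<le>N. hcomp k x)" if x: "x \<in> upper (D0 A)" for x
  proof -
    have "\<forall>i. \<exists>N. \<forall>N'\<ge>N. x (Var i) = (\<Sum>k\<le>N'. hpart k (x (Var i)))"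
      by (intro allI ex_sum_hpart)
    then obtain N where N: "\<And>i N'. N' \<ge> N i \<Longrightarrow> x (Var i) = (\<Sum>k\<le>N'. hpart k (x (Var i)))"
      unfolding choice_iff by blast
    define N' where "N' = (\<Sum>i\<in>UNIV. N i)"
    have "x = (\<Sum>k\<le>N'. hcomp k x)"
    proof (rule derivations_eqI)
      show "x \<in> derivations"
        using x log_derivations_derivations by (auto simp: D0_simps)
      show "(\<Sum>k\<le>N'. hcomp k x) \<in> derivations"
        by (intro pmod.subspace_sum dersub hcomp_derivation)
      fix i
      have "N i \<le> N'"
        unfolding N'_def by (intro member_le_sum) auto
      from N[OF this] show "x (Var i) = (\<Sum>k\<le>N'. hcomp k x) (Var i)"
        by (simp add: sum_fun_apply)
    qed
    thus ?thesis by blast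
  qed
  show "X \<in> upper (D0 A)" "X \<in> grad (D0 A) (int d)" "X \<notin> lower (D0 A)"
    using X by (simp_all add: D0_simps)
  show "x \<in> lower (D0 A)" if "j < d" "x \<in> upper (D0 A)" "x \<in> grad (D0 A) (int j)" for j x
    using least that by (simp add: D0_simps)
qed

section \<open>Functionals on the fibres\<close>

text \<open>This is \<theta> applied to the linear form \<alpha>, divided by \<alpha>. It is linear
  in \<theta> and 1 on the Euler field, so it measures the Euler part of \<theta> relative to the
  hyperplane of \<alpha>.\<close>

definition quot_form :: "'k::field ^ 'n::finite \<Rightarrow> (('n, 'k) mpoly \<Rightarrow> ('n, 'k) mpoly) \<Rightarrow> 'k ^ 'n \<Rightarrow> 'k" where
  "quot_form \<alpha> \<theta> = (SOME g. polyfun g \<and> (\<forall>x. dot \<alpha> (vfield \<theta> x) = dot \<alpha> x * g x))"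

lemma quot_form:
  fixes A :: "('k::alg_closed_field ^ 'n::finite) set set"
  assumes A: "hyperplane_arrangement A" and \<theta>: "\<theta> \<in> log_derivations A"
    and K: "{x. dot \<alpha> x = 0} \<in> A" "\<alpha> \<noteq> 0"
  shows "polyfun (quot_form \<alpha> \<theta>)" "dot \<alpha> (vfield \<theta> x) = dot \<alpha> x * quot_form \<alpha> \<theta> x"
proof -
  have "\<exists>g. polyfun g \<and> (\<forall>x. dot \<alpha> (vfield \<theta> x) = dot \<alpha> x * g x)"
  proof (rule polyfun_factor_linear[OF _ K(2)])
    show "polyfun (\<lambda>x. dot \<alpha> (vfield \<theta> x))"
      by (intro polyfun_dot polyfun_vfield)
    have tan: "\<forall>K\<in>A. \<forall>x\<in>K. vfield \<theta> x \<in> K"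
      using \<theta> unfolding log_derivations_iff[OF A] by (rule conjunct2)
    show "dot \<alpha> (vfield \<theta> x) = 0" if "dot \<alpha> x = 0" for x
      using tan[rule_format, OF K(1), of x] that by simp
  qed
  hence "polyfun (quot_form \<alpha> \<theta>) \<and> (\<forall>x. dot \<alpha> (vfield \<theta> x) = dot \<alpha> x * quot_form \<alpha> \<theta> x)"
    unfolding quot_form_def by (rule someI_ex)
  thus "polyfun (quot_form \<alpha> \<theta>)" "dot \<alpha> (vfield \<theta> x) = dot \<alpha> x * quot_form \<alpha> \<theta> x"
    by auto
qed

lemma quot_form_unique:
  fixes A :: "('k::alg_closed_field ^ 'n::finite) set set"
  assumes "hyperplane_arrangement A" "\<theta> \<in> log_derivations A" "{x. dot \<alpha> x = 0} \<in> A" "\<alpha> \<noteq> 0"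
    and g: "polyfun g" "\<And>x. dot \<alpha> (vfield \<theta> x) = dot \<alpha> x * g x"
  shows "quot_form \<alpha> \<theta> x = g x"
proof -
  obtain e where "dot \<alpha> e = 1"
    using ex_dot_eq_1 assms(4) by blast
  hence e: "dot \<alpha> e \<noteq> 0"
    by simp
  have d: "polyfun (dot \<alpha>)"
    using polyfun_dot[of "\<lambda>x. x" \<alpha>] by (simp add: polyfun_coord)
  have eq: "dot \<alpha> x * quot_form \<alpha> \<theta> x = dot \<alpha> x * g x" for x
    by (rule trans[OF quot_form(2)[OF assms(1-4), symmetric] g(2)])
  show ?thesis
    by (rule polyfun_mult_cancel[OF d quot_form(1)[OF assms(1-4)] g(1) eq e])
qed

lemma quot_form_add:
  fixes A :: "('k::alg_closed_field ^ 'n::finite) set set"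
  assumes A: "hyperplane_arrangement A" "{x. dot \<alpha> x = 0} \<in> A" "\<alpha> \<noteq> 0"
    and \<theta>: "\<theta> \<in> log_derivations A" "\<theta>' \<in> log_derivations A"
  shows "quot_form \<alpha> (\<theta> + \<theta>') x = quot_form \<alpha> \<theta> x + quot_form \<alpha> \<theta>' x"
proof (rule quot_form_unique[OF A(1) _ A(2,3)])
  note q = quot_form[OF A(1) \<theta>(1) A(2,3)] quot_form[OF A(1) \<theta>(2) A(2,3)]
  show "\<theta> + \<theta>' \<in> log_derivations A"
    by (intro pmod.subspace_add[OF log_derivations_subspace] \<theta>)
  show "polyfun (\<lambda>x. quot_form \<alpha> \<theta> x + quot_form \<alpha> \<theta>' x)"
    by (intro polyfun_add q)
  show "dot \<alpha> (vfield (\<theta> + \<theta>') x) = dot \<alpha> x * (quot_form \<alpha> \<theta> x + quot_form \<alpha> \<theta>' x)" for x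
    unfolding vfield_add by (simp only: dot_add distrib_left q)
qed

lemma quot_form_scale:
  fixes A :: "('k::alg_closed_field ^ 'n::finite) set set"
  assumes A: "hyperplane_arrangement A" "{x. dot \<alpha> x = 0} \<in> A" "\<alpha> \<noteq> 0"
    and \<theta>: "\<theta> \<in> log_derivations A"
  shows "quot_form \<alpha> (pscale p \<theta>) x = mp_eval x p * quot_form \<alpha> \<theta> x"
proof (rule quot_form_unique[OF A(1) _ A(2,3)])
  note q = quot_form[OF A(1) \<theta> A(2,3)]
  show "pscale p \<theta> \<in> log_derivations A"
    by (intro pmod.subspace_scale[OF log_derivations_subspace] \<theta>)
  show "polyfun (\<lambda>x. mp_eval x p * quot_form \<alpha> \<theta> x)"
    by (intro polyfun_mult polyfun_mp_eval q)
  show "dot \<alpha> (vfield (pscale p \<theta>) x) = dot \<alpha> x * (mp_eval x p * quot_form \<alpha> \<theta> x)" for x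
    unfolding vfield_pscale by (simp only: dot_scale q mult_ac)
qed

lemma quot_form_euler:
  fixes A :: "('k::alg_closed_field ^ 'n::finite) set set"
  assumes A: "hyperplane_arrangement A" "{x. dot \<alpha> x = 0} \<in> A" "\<alpha> \<noteq> 0"
  shows "quot_form \<alpha> euler x = 1"
  by (intro quot_form_unique[OF A(1) euler_log_derivation[OF A(1)] A(2,3)])
     (auto simp: vfield_euler intro: polyfun_const)

text \<open>Component \<open>i\<close> of the representative of \<theta> with values in the
  hyperplane of \<alpha>, obtained by subtracting \<open>quot_form \<alpha> \<theta>\<close> times
  the Euler field; hence Euler multiples are invisible to it.\<close>

lemma fibre_functional_coord:
  fixes A :: "('k::alg_closed_field ^ 'n::finite) set set"
  assumes "hyperplane_arrangement A" "{x. dot \<alpha> x = 0} \<in> A" "\<alpha> \<noteq> 0"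
  shows "fibre_functional A w (\<lambda>\<theta>. vfield \<theta> w $ i - quot_form \<alpha> \<theta> w * w $ i)"
  unfolding fibre_functional_def
  by (intro conjI ballI allI)
     (simp_all only: quot_form_add[OF assms] quot_form_scale[OF assms] quot_form_euler[OF assms]
        vfield_add vfield_pscale vfield_euler vector_add_component vector_smult_component,
      simp_all add: algebra_simps)

text \<open>Both quotients are 1 on the Euler field, so their difference kills it. It can detect a
  field at a point where the field vanishes as a vector.\<close>

lemma fibre_functional_quot:
  fixes A :: "('k::alg_closed_field ^ 'n::finite) set set"
  assumes "hyperplane_arrangement A" "{x. dot \<alpha> x = 0} \<in> A" "\<alpha> \<noteq> 0"
    "{x. dot \<beta> x = 0} \<in> A" "\<beta> \<noteq> 0"
  shows "fibre_functional A w (\<lambda>\<theta>. quot_form \<beta> \<theta> w - quot_form \<alpha> \<theta> w)"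
  unfolding fibre_functional_def
  by (intro conjI ballI allI)
     (simp_all only: quot_form_add[OF assms(1-3)] quot_form_scale[OF assms(1-3)]
        quot_form_euler[OF assms(1-3)] quot_form_add[OF assms(1,4,5)]
        quot_form_scale[OF assms(1,4,5)] quot_form_euler[OF assms(1,4,5)],
      simp_all add: algebra_simps)

section \<open>Normalized derivations and general lines\<close>

text \<open>Subtracting \<open>quot_form \<alpha> \<theta>\<close> times the Euler field removes the
  component across the hyperplane without changing the class.\<close>

lemma ex_normalized:
  fixes A :: "('k::alg_closed_field ^ 'n::finite) set set"
  assumes A: "hyperplane_arrangement A" "{x. dot \<alpha> x = 0} \<in> A" "\<alpha> \<noteq> 0"
    and \<theta>: "\<theta> \<in> log_derivations A" "\<theta> \<in> grad (D0 A) (int d)" "\<theta> \<notin> lower (D0 A)"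
  shows "\<exists>\<theta>'. \<theta>' \<in> log_derivations A \<and> \<theta>' \<in> grad (D0 A) (int d) \<and> \<theta>' \<notin> lower (D0 A) \<and>
    (\<forall>x. dot \<alpha> (vfield \<theta>' x) = 0)"
proof -
  let ?g = "quot_form \<alpha> \<theta>"
  note g = quot_form[OF A(1) \<theta>(1) A(2,3)]
  obtain p where p: "\<And>v. mp_eval v p = ?g v"
    using polyfun_imp_mp_eval[OF g(1)] by blast
  define \<theta>' where "\<theta>' = \<theta> - pscale p euler"
  have pe: "pscale p euler \<in> log_derivations A"
    by (intro pmod.subspace_scale[OF log_derivations_subspace] euler_log_derivation A)
  have \<theta>'A: "\<theta>' \<in> log_derivations A"
    unfolding \<theta>'_def by (intro pmod.subspace_diff[OF log_derivations_subspace] \<theta> pe)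
  have v: "vfield \<theta>' x = vfield \<theta> x - ?g x *s x" for x
    unfolding \<theta>'_def vfield_diff vfield_pscale vfield_euler p ..
  have "\<theta>' \<notin> lower (D0 A)"
  proof
    assume a: "\<theta>' \<in> lower (D0 A)"
    have "\<theta>' + pscale p euler \<in> lower (D0 A)"
      unfolding D0_simps
      by (rule pmod.span_add[OF a[unfolded D0_simps] pmod.span_scale[OF pmod.span_base]]) simp
    moreover have "\<theta>' + pscale p euler = \<theta>"
      unfolding \<theta>'_def by (rule diff_add_cancel)
    ultimately show False
      using \<theta>(3) by metis
  qed
  moreover have "\<theta>' \<in> grad (D0 A) (int d)"
    unfolding grad_D0_iff_vfield[OF log_derivations_derivations[OF \<theta>'A]]
  proof (intro allI)
    fix c :: 'k and x :: "'k ^ 'n"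
    have hom: "vfield \<theta> (c *s x) = c ^ d *s vfield \<theta> x" for x
      using \<theta>(2) unfolding grad_D0_iff_vfield[OF log_derivations_derivations[OF \<theta>(1)]] by blast
    obtain e where "dot \<alpha> e = 1"
      using ex_dot_eq_1 A(3) by blast
    hence e: "dot \<alpha> e \<noteq> 0" by simp
    have d: "polyfun (dot \<alpha>)"
      using polyfun_dot[of "\<lambda>x. x" \<alpha>] by (simp add: polyfun_coord)
    \<comment> \<open>The quotient has degree \<open>d - 1\<close>; the extra factor
      \<open>c\<close> avoids this exponent, which is negative for \<open>d = 0\<close>.\<close>
    have p1: "polyfun (\<lambda>x. c * ?g (c *s x))"
      by (intro polyfun_intros polyfun_compose[OF g(1), of "\<lambda>x. c *s x"]) (auto intro: polyfun_intros)
    have p2: "polyfun (\<lambda>x. c ^ d * ?g x)"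
      by (intro polyfun_intros g)
    have "dot \<alpha> x * (c * ?g (c *s x)) = dot \<alpha> x * (c ^ d * ?g x)" for x
    proof -
      have "dot \<alpha> x * (c * ?g (c *s x)) = dot \<alpha> (c *s x) * ?g (c *s x)"
        by (simp add: dot_scale mult_ac)
      also have "\<dots> = dot \<alpha> (vfield \<theta> (c *s x))"
        by (rule g(2)[symmetric])
      also have "\<dots> = c ^ d * dot \<alpha> (vfield \<theta> x)"
        by (simp only: hom dot_scale)
      also have "\<dots> = dot \<alpha> x * (c ^ d * ?g x)"
        by (simp only: g(2) mult_ac)
      finally show ?thesis .
    qed
    from polyfun_mult_cancel[OF d p1 p2 this e]
    have "c * ?g (c *s x) = c ^ d * ?g x" .
    thus "vfield \<theta>' (c *s x) = c ^ d *s vfield \<theta>' x"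
      by (simp add: v hom vec_eq_iff algebra_simps)
  qed
  moreover have "dot \<alpha> (vfield \<theta>' x) = 0" for x
    using g(2)[of x] by (simp add: v dot_diff dot_scale mult.commute)
  ultimately show ?thesis
    using \<theta>'A by blast
qed

text \<open>A nonempty open set contains the nonvanishing locus of one of its defining polynomials,
  so generality of a line becomes a single inequation in Pluecker coordinates.\<close>

lemma has_splitting_typeD:
  fixes M :: "('i, 'n::finite, 'k::field) grmod"
  assumes "has_splitting_type M n a"
  shows "\<exists>F :: ('n \<times> 'n, 'k) mpoly. (\<exists>u v. mp_eval (pluecker u v) F \<noteq> 0) \<and>
    (\<forall>u v. vec.span {u, v} \<in> proj_lines \<longrightarrow> mp_eval (pluecker u v) F \<noteq> 0 \<longrightarrow>
      sheaf_iso (restrict_to (vec.span {u, v}) M) (restrict_to (vec.span {u, v}) (twisted_free n a)))"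
proof -
  obtain \<U> where \<U>: "zariski_open_lines \<U>" "\<U> \<noteq> {}"
    "\<And>L. L \<in> \<U> \<Longrightarrow> sheaf_iso (restrict_to L M) (restrict_to L (twisted_free n a))"
    using assms unfolding has_splitting_type_def for_general_line_def by blast
  then obtain \<F> where \<F>: "\<U> = {L \<in> proj_lines. \<exists>F\<in>\<F>. \<exists>u v. vec.span {u, v} = L \<and> mp_eval (pluecker u v) F \<noteq> 0}"
    unfolding zariski_open_lines_def by blast
  obtain F u v where F: "F \<in> \<F>" "mp_eval (pluecker u v) F \<noteq> 0"
    using \<U>(2) unfolding \<F> by blast
  show ?thesis
    using F \<U>(3) unfolding \<F> by (intro exI[of _ F] conjI allI impI) blast+
qed

lemma polyfun_pluecker:
  "polyfun (\<lambda>u. mp_eval (pluecker u v) F)" "polyfun (\<lambda>v. mp_eval (pluecker u v) F)"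
  by (rule polyfun_compose[OF polyfun_mp_eval, where g = "\<lambda>u. pluecker u v"],
      simp add: pluecker_def, intro polyfun_intros,
      rule polyfun_compose[OF polyfun_mp_eval, where g = "\<lambda>v. pluecker u v"],
      simp add: pluecker_def, intro polyfun_intros)

lemma ex_dual_forms:
  fixes u v :: "'k::field ^ 'n::finite"
  assumes "u $ i * v $ j - u $ j * v $ i \<noteq> 0"
  shows "\<exists>\<alpha> \<beta>. dot \<alpha> u = 1 \<and> dot \<alpha> v = 0 \<and> dot \<beta> u = 0 \<and> dot \<beta> v = 1"
proof -
  define D where "D = u $ i * v $ j - u $ j * v $ i"
  have D: "D \<noteq> 0"
    using assms by (simp add: D_def)
  define form where "form a b = (axis i a + axis j b :: 'k ^ 'n)" for a b
  have "dot x y = dot y x" for x y :: "'k ^ 'n"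
    by (simp add: dot_def mult.commute)
  hence form: "dot (form a b) x = a * x $ i + b * x $ j" for a b x
    by (metis dot_add dot_axis form_def mult.commute)
  have "dot (form (v $ j / D) (- v $ i / D)) u = D / D" "dot (form (v $ j / D) (- v $ i / D)) v = 0 / D"
    "dot (form (- u $ j / D) (u $ i / D)) u = 0 / D" "dot (form (- u $ j / D) (u $ i / D)) v = D / D"
    using D by (simp_all add: form divide_simps) (simp_all add: D_def algebra_simps)
  thus ?thesis
    using D by (intro exI[of _ "form (v $ j / D) (- v $ i / D)"] exI[of _ "form (- u $ j / D) (u $ i / D)"]) simp
qed

lemma span_proj_line:
  fixes u v :: "'k::field ^ 'n::finite"
  assumes "dot \<alpha> u = 1" "dot \<alpha> v = 0" "dot \<beta> v = 1"
  shows "vec.span {u, v} \<in> proj_lines"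
proof -
  have "u \<notin> vec.span {v}"
  proof
    assume "u \<in> vec.span {v}"
    then obtain k where "u = k *s v"
      unfolding vec.span_singleton by blast
    thus False
      using assms by (simp add: dot_scale)
  qed
  moreover have "v \<noteq> 0"
    using assms by (auto simp: dot_0)
  ultimately have ind: "vec.independent {u, v}"
    by (intro vec.independent_insertI) (auto simp: vec.independent_empty)
  have "u \<noteq> v"
    using assms by auto
  hence "vec.dim (vec.span {u, v}) = 2"
    using vec.dim_span_eq_card_independent[OF ind] by simp
  thus ?thesis
    by (simp add: proj_lines_def)
qed

theorem proposition6p2:
  fixes A :: "('k::alg_closed_field ^ 'n::finite) set set"
    and n :: nat and a :: "nat \<Rightarrow> int"
  assumes "CARD('n) = n + 1" and "n \<ge> 2"
    and "hyperplane_arrangement A" and "A \<noteq> {}"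
    and "has_splitting_type (D0 A) n a" and "a 1 < a 2"
    and "\<exists>d < a 2. \<exists>\<theta> \<in> homog_elements (D0 A) d. \<theta> \<noteq> lower (D0 A)"
  shows "has_minimal_generator_in_degree (D0 A) (a 1)"
proof -
  note A = assms(3)
  have "\<exists>\<alpha>. \<alpha> \<noteq> 0 \<and> K = {x. dot \<alpha> x = 0}" if "K \<in> A" for K
    using that A hyperplane_eq_kernel by (auto simp: hyperplane_arrangement_def)
  then obtain al where al: "\<And>K. K \<in> A \<Longrightarrow> al K \<noteq> 0" "\<And>K. K \<in> A \<Longrightarrow> K = {x. dot (al K) x = 0}"
    by metis
  have alA: "{x. dot (al K) x = 0} \<in> A" if "K \<in> A" for K
    using al(2)[OF that] that by simp
  have mem: "x \<in> K \<longleftrightarrow> dot (al K) x = 0" if "K \<in> A" for x K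
    using al(2)[OF that] by blast
  have fin: "finite A"
    using A by (simp add: hyperplane_arrangement_def)
  obtain H where H: "H \<in> A"
    using assms(4) by blast
  note nz = al(1)[OF H] and HA = alA[OF H]

  \<comment> \<open>A normalised field of least degree\<close>
  define P where "P d \<longleftrightarrow> (\<exists>x. x \<in> log_derivations A \<and> x \<in> grad (D0 A) (int d) \<and> x \<notin> lower (D0 A))" for d
  obtain d0 x0 where d0: "d0 < a 2" "x0 \<in> log_derivations A" "x0 \<in> grad (D0 A) d0" "coset (D0 A) x0 \<noteq> lower (D0 A)"
    using assms(7) by (auto simp: homog_elements_def D0_simps)
  have x0: "x0 \<notin> lower (D0 A)"
  proof
    assume x: "x0 \<in> lower (D0 A)"
    have "y - x0 \<in> lower (D0 A) \<longleftrightarrow> y \<in> lower (D0 A)" for y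
    proof
      assume "y - x0 \<in> lower (D0 A)"
      hence "(y - x0) + x0 \<in> lower (D0 A)"
        using x unfolding D0_simps by (rule pmod.span_add)
      thus "y \<in> lower (D0 A)"
        by (simp only: diff_add_cancel)
    next
      assume "y \<in> lower (D0 A)"
      thus "y - x0 \<in> lower (D0 A)"
        using x unfolding D0_simps by (rule pmod.span_diff)
    qed
    hence "coset (D0 A) x0 = lower (D0 A)"
      unfolding coset_def by blast
    thus False using d0(4) by simp
  qed
  have "d0 \<ge> 0"
  proof (rule ccontr)
    assume "\<not> d0 \<ge> 0"
    moreover have "x0 (Var i) \<in> homog d0" for i
      using d0(3) grad_D0_iff[OF log_derivations_derivations[OF d0(2)]] by blast
    ultimately have "x0 (Var i) = 0" for i
      using homog_negative[of d0 "x0 (Var i)"] by simp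
    hence "x0 = 0"
      using pmod.subspace_0[OF derivations_subspace]
      by (intro derivations_eqI log_derivations_derivations[OF d0(2)]) auto
    thus False
      using x0 pmod.span_zero unfolding D0_simps by metis
  qed
  then obtain d1 where d1: "d0 = int d1"
    by (metis zero_le_imp_eq_int)
  have "P d1"
    using d0 x0 d1 unfolding P_def by blast
  define d where "d = (LEAST d. P d)"
  have Pd: "P d"
    unfolding d_def using \<open>P d1\<close> by (rule LeastI)
  have "d \<le> d1"
    unfolding d_def using \<open>P d1\<close> by (rule Least_le)
  hence da: "int d < a 2"
    using d0(1) d1 by simp
  have least: "d \<le> j" if "P j" for j
    unfolding d_def using that by (rule Least_le)
  obtain x1 where x1: "x1 \<in> log_derivations A" "x1 \<in> grad (D0 A) (int d)" "x1 \<notin> lower (D0 A)"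
    using Pd unfolding P_def by blast
  obtain \<theta> where \<theta>: "\<theta> \<in> log_derivations A" "\<theta> \<in> grad (D0 A) (int d)" "\<theta> \<notin> lower (D0 A)"
    "\<And>x. dot (al H) (vfield \<theta> x) = 0"
    using ex_normalized[OF A HA nz x1] by blast
  note \<theta>der = log_derivations_derivations[OF \<theta>(1)]
  have "\<exists>x. vfield \<theta> x \<noteq> 0"
  proof (rule ccontr)
    assume "\<not> ?thesis"
    hence "\<theta> = 0"
      using pmod.subspace_0[OF derivations_subspace] \<theta>der by (intro vfield_inject) (auto simp: vfield_0)
    thus False
      using \<theta>(3) pmod.span_zero unfolding D0_simps by metis
  qed
  then obtain i0 u1 where i0: "vfield \<theta> u1 $ i0 \<noteq> 0"
    by (auto simp: vec_eq_iff)
  obtain F u0 v0 where F: "mp_eval (pluecker u0 v0) F \<noteq> 0"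
    and iso: "\<And>u v. vec.span {u, v} \<in> proj_lines \<Longrightarrow> mp_eval (pluecker u v) F \<noteq> 0 \<Longrightarrow>
      sheaf_iso (restrict_to (vec.span {u, v}) (D0 A)) (restrict_to (vec.span {u, v}) (twisted_free n a))"
    using has_splitting_typeD[OF assms(5)] by blast

  \<comment> \<open>A general point\<close>
  obtain u2 where u2: "\<And>K. K \<in> A \<Longrightarrow> dot (al K) u2 \<noteq> 0"
  proof -
    have "\<exists>x. \<forall>K\<in>A. dot (al K) x \<noteq> 0"
    proof (rule polyfun_finite_nonzero[OF fin])
      show "polyfun (dot (al K))" for K
        using polyfun_dot[of "\<lambda>x. x" "al K"] by (simp add: polyfun_coord)
      show "\<exists>x. dot (al K) x \<noteq> 0" if "K \<in> A" for K
        using ex_dot_eq_1[OF al(1)[OF that]] by (metis zero_neq_one)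
    qed
    thus ?thesis using that by blast
  qed
  have pfA: "polyfun (\<lambda>x. \<Prod>K\<in>A. dot (al K) x)"
    by (intro polyfun_prod polyfun_dot polyfun_coord)
  obtain u3 where u3: "vfield \<theta> u3 $ i0 \<noteq> 0" "(\<Prod>K\<in>A. dot (al K) u3) \<noteq> 0"
    using polyfun_mult_nonzero[OF polyfun_vfield pfA i0, of u2] u2 fin by auto
  \<comment> \<open>The Pluecker condition with \<open>v0\<close> leaves room for a general line
    through \<open>e\<close>, chosen later.\<close>
  obtain e where e0: "vfield \<theta> e $ i0 * (\<Prod>K\<in>A. dot (al K) e) \<noteq> 0" "mp_eval (pluecker e v0) F \<noteq> 0"
    using polyfun_mult_nonzero[OF polyfun_mult[OF polyfun_vfield pfA] polyfun_pluecker(1), of \<theta> u3 i0 u0 v0 F] u3 F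
    by auto
  have e: "vfield \<theta> e $ i0 \<noteq> 0" "\<And>K. K \<in> A \<Longrightarrow> e \<notin> K"
    using e0(1) fin by (auto simp: mem)

  \<comment> \<open>The primitive field as a logarithmic derivation\<close>
  have tan: "tangent A (vfield \<theta>)"
    using \<theta>(1) unfolding log_derivations_iff[OF A] tangent_def by blast
  have hom\<theta>: "vfield \<theta> (c *s x) = c ^ d *s vfield \<theta> x" for c x
    using \<theta>(2) grad_D0_iff_vfield[OF \<theta>der] by blast
  have "\<exists>X m h. polyvec X \<and> tangent A X \<and> (\<forall>x. X x \<in> H) \<and> (\<forall>c x. X (c *s x) = c ^ m *s X x) \<and>
    m \<le> d \<and> (\<forall>x. vfield \<theta> x $ i0 *s X x = X x $ i0 *s vfield \<theta> x) \<and> X e $ i0 \<noteq> 0 \<and>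
    polyfun h \<and> (\<exists>x. h x \<noteq> 0) \<and> (\<forall>x s. h (x + s *s e) = h x) \<and>
    (\<forall>w. h w \<noteq> 0 \<longrightarrow> X w \<noteq> 0 \<or>
       (\<exists>K\<in>A. \<exists>g. polyfun g \<and> (\<forall>x. dot (al K) (X x) = dot (al K) x * g x) \<and> g w \<noteq> 0))"
    by (rule ex_primitive_parallel[OF fin al(2) H _ tan _ hom\<theta> e])
       (simp_all add: polyvec_def polyfun_vfield mem[OF H] \<theta>(4))
  then obtain X m h where X: "polyvec X" "tangent A X" "\<And>x. X x \<in> H" "\<And>c x. X (c *s x) = c ^ m *s X x"
    and md: "m \<le> d" and par: "\<And>x. vfield \<theta> x $ i0 *s X x = X x $ i0 *s vfield \<theta> x" and Xe: "X e $ i0 \<noteq> 0"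
    and h: "polyfun h" "\<exists>x. h x \<noteq> 0" "\<And>x s. h (x + s *s e) = h x"
    and hw: "\<And>w. h w \<noteq> 0 \<Longrightarrow> X w \<noteq> 0 \<or>
       (\<exists>K\<in>A. \<exists>g. polyfun g \<and> (\<forall>x. dot (al K) (X x) = dot (al K) x * g x) \<and> g w \<noteq> 0)"
    by blast
  obtain \<xi> where \<xi>: "\<xi> \<in> derivations" "vfield \<xi> = X"
    using polyfun_imp_vfield[of X] X(1) unfolding polyvec_def by blast
  have \<xi>A: "\<xi> \<in> log_derivations A"
    using X(2) \<xi> unfolding log_derivations_iff[OF A] tangent_def by simp
  have \<xi>m: "\<xi> \<in> grad (D0 A) (int m)"
    using X(4) \<xi> grad_D0_iff_vfield[OF \<xi>(1)] by simp
  \<comment> \<open>As \<open>X\<close> takes values in \<open>H\<close>, its quotient at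
    \<open>H\<close> is zero, and the functionals below reduce to components of \<open>X\<close> and
    quotients at the hyperplanes \<open>K\<close>.\<close>
  have \<xi>H: "quot_form (al H) \<xi> x = 0" for x
    by (rule quot_form_unique[OF A \<xi>A HA nz, of "\<lambda>_. 0"])
       (use X(3) \<xi>(2) mem[OF H] in \<open>auto intro: polyfun_const\<close>)
  have coordX: "\<exists>\<Lambda>. fibre_functional A w \<Lambda> \<and> \<Lambda> \<xi> \<noteq> 0" if w: "X w \<noteq> 0" for w
  proof -
    obtain i where "X w $ i \<noteq> 0"
      using w by (auto simp: vec_eq_iff)
    hence "(\<lambda>\<theta>. vfield \<theta> w $ i - quot_form (al H) \<theta> w * w $ i) \<xi> \<noteq> 0"
      by (simp add: \<xi>H \<xi>(2))
    with fibre_functional_coord[OF A HA nz, of w i] show ?thesis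
      by blast
  qed
  have nonvan: "\<exists>\<Lambda>. fibre_functional A w \<Lambda> \<and> \<Lambda> \<xi> \<noteq> 0" if w: "h w \<noteq> 0" for w
  proof (cases "X w = 0")
    case False
    thus ?thesis by (rule coordX)
  next
    case True
    then obtain K g where K: "K \<in> A" "polyfun g" "\<And>x. dot (al K) (X x) = dot (al K) x * g x" "g w \<noteq> 0"
      using hw[OF w] by blast
    have "quot_form (al K) \<xi> w = g w"
      by (rule quot_form_unique[OF A \<xi>A alA[OF K(1)] al(1)[OF K(1)] K(2)]) (simp add: \<xi>(2) K(3))
    hence "(\<lambda>\<theta>. quot_form (al K) \<theta> w - quot_form (al H) \<theta> w) \<xi> \<noteq> 0"
      using K(4) by (simp add: \<xi>H)
    with fibre_functional_quot[OF A HA nz alA[OF K(1)] al(1)[OF K(1)], of w] show ?thesis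
      by blast
  qed
  have Xe0: "X e \<noteq> 0"
    using Xe by auto

  \<comment> \<open>A general line through \<open>e\<close>\<close>
  have "e \<noteq> 0"
    using e(2)[OF H] mem[OF H, of e] dot_0[of "al H"] by metis
  then obtain i where i: "e $ i \<noteq> 0"
    by (auto simp: vec_eq_iff)
  obtain j where j: "j \<noteq> i"
  proof -
    have "\<exists>j. j \<noteq> i"
    proof (rule ccontr)
      assume "\<nexists>j. j \<noteq> i"
      hence "UNIV = {i}" by auto
      hence "CARD('n) = 1"
        by (metis card_1_singleton_iff One_nat_def)
      thus False using assms(1,2) by simp
    qed
    thus ?thesis using that by blast
  qed
  \<comment> \<open>A nonzero minor makes \<open>e\<close> and \<open>v\<close> independent and
    provides the dual forms; \<open>axis j 1\<close> witnesses that it is not identically zero in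
    \<open>v\<close>.\<close>
  have pfD: "polyfun (\<lambda>v. e $ i * v $ j - e $ j * v $ i)"
    by (intro polyfun_intros)
  obtain v1 where v1: "h v1 \<noteq> 0" "mp_eval (pluecker e v1) F \<noteq> 0"
    using h(2) polyfun_mult_nonzero[OF h(1) polyfun_pluecker(2), of _ e v0 F] e0(2) by blast
  have "e $ i * axis j 1 $ j - e $ j * axis j 1 $ i \<noteq> 0"
    using i j by (simp add: axis_def)
  then obtain v where v0: "h v * mp_eval (pluecker e v) F \<noteq> 0" and v2: "e $ i * v $ j - e $ j * v $ i \<noteq> 0"
    using polyfun_mult_nonzero[OF polyfun_mult[OF h(1) polyfun_pluecker(2)] pfD, of v1 e F "axis j 1"] v1 by auto
  hence v: "h v \<noteq> 0" "mp_eval (pluecker e v) F \<noteq> 0"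
    by auto
  obtain \<alpha> \<beta> where dual: "dot \<alpha> e = 1" "dot \<alpha> v = 0" "dot \<beta> e = 0" "dot \<beta> v = 1"
    using ex_dual_forms[OF v2] by blast
  obtain \<phi> where \<phi>: "is_sheaf_iso (restrict_to (vec.span {e, v}) (D0 A))
      (restrict_to (vec.span {e, v}) (twisted_free n a)) \<phi>"
    using iso[OF span_proj_line[OF dual(1,2,4)] v(2)] unfolding sheaf_iso_iff by blast

  \<comment> \<open>Comparison of degrees\<close>
  have am: "0 \<le> a 1" "int d < a i" if "i \<in> {2..n}" for i
    using assms(2,5) da that unfolding has_splitting_type_def by force+
  have parder: "pscale (\<theta> (Var i0)) \<xi> = pscale (\<xi> (Var i0)) \<theta>"
  proof (rule vfield_inject)
    show "pscale (\<theta> (Var i0)) \<xi> \<in> derivations" "pscale (\<xi> (Var i0)) \<theta> \<in> derivations"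
      by (intro pmod.subspace_scale[OF derivations_subspace] \<xi> \<theta>der)+
    fix x
    have "mp_eval x (\<theta> (Var i0)) = vfield \<theta> x $ i0" "mp_eval x (\<xi> (Var i0)) = vfield \<xi> x $ i0"
      by (simp_all add: vfield_def)
    thus "vfield (pscale (\<theta> (Var i0)) \<xi>) x = vfield (pscale (\<xi> (Var i0)) \<theta>) x"
      unfolding vfield_pscale using par[of x] \<xi>(2) by simp
  qed
  have "int m = a 1"
  proof (rule degree_of_parallel[OF A refl dual \<phi> assms(2) _ _ \<theta>(1,2) \<xi>A \<xi>m _ _ parder])
    show "0 \<le> a 1"
      using am(1)[of 2] assms(2) by simp
    show "int d < a i" if "i \<in> {2..n}" for i
      by (rule am(2)[OF that])
    show "\<theta> (Var i0) \<in> homog (int d)" "\<xi> (Var i0) \<in> homog (int m)"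
      using \<theta>(2) \<xi>m grad_D0_iff[OF \<theta>der] grad_D0_iff[OF \<xi>(1)] by blast+
    show "mp_eval e (\<theta> (Var i0)) \<noteq> 0"
      using e(1) by (simp add: vfield_def)
    \<comment> \<open>Since \<open>h\<close> is constant along \<open>e\<close>, its value at
      \<open>v\<close> settles every point of the projective line except \<open>e\<close>.\<close>
    show "\<exists>\<Lambda>. fibre_functional A (t *s e + v) \<Lambda> \<and> \<Lambda> \<xi> \<noteq> 0" for t
      using h(3)[of v t] v(1) by (intro nonvan) (simp add: add.commute)
    show "\<exists>\<Lambda>. fibre_functional A e \<Lambda> \<and> \<Lambda> \<xi> \<noteq> 0"
      by (rule coordX[OF Xe0])
  qed
  moreover have "\<xi> \<notin> lower (D0 A)"
  proof
    assume "\<xi> \<in> lower (D0 A)"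
    then obtain p where p: "\<xi> = pscale p euler"
      unfolding D0_simps span_euler by blast
    have "mp_eval x p = 0" for x
      using \<xi>H[of x] quot_form_scale[OF A HA nz euler_log_derivation[OF A], of p x]
        quot_form_euler[OF A HA nz, of x] by (simp add: p)
    hence "vfield \<xi> e = 0"
      unfolding p vfield_pscale by simp
    thus False
      using Xe0 \<xi>(2) by simp
  qed
  \<comment> \<open>The choice of \<open>d\<close> gives \<open>d \<le> m\<close>, and
    \<open>m \<le> d\<close> holds by construction of the primitive field.\<close>
  hence "P m"
    using \<xi>A \<xi>m unfolding P_def by blast
  hence "d = m"
    using least md by (simp add: le_antisym)
  ultimately have "a 1 = int d"
    by simp
  moreover have "has_minimal_generator_in_degree (D0 A) (int d)"
  proof (rule D0_minimal_generator[OF A x1])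
    fix j x assume j: "j < d" "x \<in> log_derivations A" "x \<in> grad (D0 A) (int j)"
    show "x \<in> lower (D0 A)"
    proof (rule ccontr)
      assume "x \<notin> lower (D0 A)"
      hence "P j"
        using j unfolding P_def by blast
      thus False
        using least j(1) by force
    qed
  qed
  ultimately show ?thesis
    by simp
qed

end
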